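(* Let $K$ be a discrete valuation field with perfect residue field, ring of integers $\mathcal{O}_K$ and uniformiser $\pi$, and let $\Phi\in X_5(\mathcal{O}_K)$ be non-singular. Let $\ell_0$ be the minimum of the levels of all integral models of the form $[A,\mu I_5]\Phi$ with $A\in\mathrm{GL}_5(K)$, $\mu\in K^\times$. (i) An integral model of the form $[A,\mu I_5]\Phi$ with level $\ell_0$ is obtained as follows. Step 1: writing $\mathrm{Pf}(\Phi)=(p_1,\ldots,p_5)$, take $A=(a_{ij})\in\mathrm{GL}_5(K)$ and quadrics $q_1,\ldots,q_5\in\mathcal{O}_K[x_1,\ldots,x_5]$ with $p_j=\sum_i a_{ij}q_i$ and $q_1,\ldots,q_5$ linearly independent mod $\pi$; replace $\Phi$ by $[A,\mu I_5]\Phi$ with $\mu\in K^\times$ chosen so that $\Phi$ has coefficients in $\mathcal{O}_K$ not all in $\pi\mathcal{O}_K$. Step 2: replace $\Phi$ by $[A',I_5]\Phi$ where $A'\in\mathrm{GL}_5(\mathcal{O}_K)$ is chosen so that all entries of the first two rows of $\Phi$ are divisible by $\pi^e$ with $e\ge0$ as large as possible; then divide the first row and the first column by $\pi^e$. (ii) If the model obtained after Step 1 is non-saturated, then modifying Step 2 so that the first two rows and the first two columns are divided by $\pi^e$, followed by a transformation of the form $[I_5,B]$ ($B\in\mathrm{GL}_5(K)$) chosen to restore integrality, yields an integral model of level smaller than $\ell_0$.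
   Context: A genus one model over a ring $R$ is a $5\times5$ alternating matrix $\Phi$ of linear forms in $x_1,\ldots,x_5$ with coefficients in $R$; $X_5(R)$ is the set of these. For $A,B\in\mathrm{GL}_5$, $[A,B]\Phi$ is obtained by replacing $\Phi$ by $A\Phi A^T$ and substituting $x_j\mapsto\sum_iB_{ij}x_i$; $\det[A,B]=(\det A)^2\det B$. $\mathrm{Pf}(\Phi)=(p_1,\ldots,p_5)$ where $p_i$ is $(-1)^{i-1}$ times the Pfaffian of the $4\times4$ submatrix of $\Phi$ obtained by deleting row and column $i$. Over a field, $\Phi$ is non-singular if the subscheme of $\mathbb{P}^4$ defined by $p_1,\ldots,p_5$ is a smooth genus one curve. $\Delta$ is the discriminant invariant of weight 12 ($\Delta([A,B]\Phi)=(\det[A,B])^{12}\Delta(\Phi)$) normalised as in Fisher, "The invariants of a genus one curve", equal for non-singular $\Phi$ to the discriminant of a Weierstrass equation for the Jacobian with coefficients integer polynomials in those of $\Phi$. A model is integral if its coefficients lie in $\mathcal{O}_K$; for non-singular integral $\Phi$, $v(\Delta(\Phi))=v(\Delta_E)+12\ell(\Phi)$ where $\Delta_E$ is the minimal discriminant of the Jacobian and $\ell(\Phi)\ge0$ is the level. $\Phi\in X_5(\mathcal{O}_K)$ is saturated if $p_1,\ldots,p_5$ are linearly independent mod $\pi$. *)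

theory Defs
  imports
    "HOL-Analysis.Analysis"
    "HOL-Library.Poly_Mapping"
    "HOL-Algebra.Algebraic_Closure_Type"
begin

unbundle no fps_syntax

section \<open>Multivariate polynomials\<close>

type_synonym ('v, 'a) mpoly = "('v \<Rightarrow>\<^sub>0 nat) \<Rightarrow>\<^sub>0 'a"

abbreviation mconst :: "'a::zero \<Rightarrow> ('v, 'a) mpoly" where
  "mconst c \<equiv> Poly_Mapping.single 0 c"

abbreviation mvar :: "'v \<Rightarrow> ('v, 'a::zero_neq_one) mpoly" where
  "mvar k \<equiv> Poly_Mapping.single (Poly_Mapping.single k 1) 1"

text \<open>
  \<^term>\<open>meval h x f\<close> is the value of \<^term>\<open>f\<close> at \<^term>\<open>x\<close>, the coefficients being mapped
  along the ring homomorphism \<^term>\<open>h\<close>.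
\<close>
definition meval :: "('a::zero \<Rightarrow> 'b::comm_ring_1) \<Rightarrow> ('v \<Rightarrow> 'b) \<Rightarrow> ('v, 'a) mpoly \<Rightarrow> 'b" where
  "meval h x f = (\<Sum>m\<in>Poly_Mapping.keys f. h (Poly_Mapping.lookup f m) *
     (\<Prod>i\<in>Poly_Mapping.keys m. x i ^ Poly_Mapping.lookup m i))"

definition homogeneous :: "nat \<Rightarrow> ('v, 'a::zero) mpoly \<Rightarrow> bool" where
  "homogeneous d f \<longleftrightarrow> (\<forall>m\<in>Poly_Mapping.keys f.
     (\<Sum>i\<in>Poly_Mapping.keys m. Poly_Mapping.lookup m i) = d)"

definition pdiff :: "'v \<Rightarrow> ('v, 'a::comm_ring_1) mpoly \<Rightarrow> ('v, 'a) mpoly" where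
  "pdiff k f = (\<Sum>m\<in>Poly_Mapping.keys f.
     Poly_Mapping.single (m - Poly_Mapping.single k 1)
       (of_nat (Poly_Mapping.lookup m k) * Poly_Mapping.lookup f m))"


section \<open>Projective varieties over an algebraically closed field\<close>

text \<open>
  A subset of projective space is represented by the set of all nonzero coordinate vectors of its
  points.
\<close>

definition proj_eq :: "'a::field^'n \<Rightarrow> 'a^'n \<Rightarrow> bool" where
  "proj_eq P Q \<longleftrightarrow> (\<exists>c. c \<noteq> 0 \<and> P = c *s Q)"

definition geometric_points ::
    "('m \<Rightarrow> ('n::finite, 'k::field) mpoly) \<Rightarrow> ('k alg_closure^'n) set" where
  "geometric_points p = {P. P \<noteq> 0 \<and> (\<forall>i. meval to_ac (($) P) (p i) = 0)}"

definition proj_irreducible :: "('a::field^'n::finite) set \<Rightarrow> bool" where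
  "proj_irreducible Z \<longleftrightarrow> Z \<noteq> {} \<and>
     (\<forall>d e (f :: ('n, 'a) mpoly) g. homogeneous d f \<and> homogeneous e g \<and>
        (\<forall>P\<in>Z. meval id (($) P) f * meval id (($) P) g = 0) \<longrightarrow>
        (\<forall>P\<in>Z. meval id (($) P) f = 0) \<or> (\<forall>P\<in>Z. meval id (($) P) g = 0))"

definition proj_morphism ::
    "('a::field^'n::finite) set \<Rightarrow> ('a^'m::finite) set \<Rightarrow> ('a^'n \<Rightarrow> 'a^'m) \<Rightarrow> bool" where
  "proj_morphism V W f \<longleftrightarrow> (\<forall>P\<in>V. f P \<in> W) \<and>
     (\<forall>P\<in>V. \<exists>d (F :: 'm \<Rightarrow> ('n, 'a) mpoly).
        (\<forall>i. homogeneous d (F i)) \<and>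
        (\<chi> i. meval id (($) P) (F i)) \<noteq> 0 \<and>
        (\<forall>Q\<in>V. (\<chi> i. meval id (($) Q) (F i)) \<noteq> 0 \<longrightarrow>
           proj_eq (f Q) (\<chi> i. meval id (($) Q) (F i))))"

definition proj_isomorphism ::
    "('a::field^'n::finite) set \<Rightarrow> ('a^'m::finite) set \<Rightarrow> ('a^'n \<Rightarrow> 'a^'m) \<Rightarrow> bool" where
  "proj_isomorphism V W f \<longleftrightarrow> proj_morphism V W f \<and>
     (\<exists>g. proj_morphism W V g \<and> (\<forall>P\<in>V. proj_eq (g (f P)) P) \<and> (\<forall>Q\<in>W. proj_eq (f (g Q)) Q))"

text \<open>The automorphisms of the algebraic closure that fix the base field.\<close>
definition closure_auts :: "('k::field alg_closure \<Rightarrow> 'k alg_closure) set" where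
  "closure_auts = {\<sigma>. bij \<sigma> \<and> (\<forall>x y. \<sigma> (x + y) = \<sigma> x + \<sigma> y) \<and> (\<forall>x y. \<sigma> (x * y) = \<sigma> x * \<sigma> y) \<and>
     (\<forall>c. \<sigma> (to_ac c) = to_ac c)}"

definition vec_map :: "('a \<Rightarrow> 'b) \<Rightarrow> 'a^'n \<Rightarrow> 'b^'n" where
  "vec_map \<sigma> P = (\<chi> i. \<sigma> (P $ i))"


section \<open>Smooth curves of given genus\<close>

definition graded_ideal ::
    "('m::finite \<Rightarrow> ('n::finite, 'k::field) mpoly) \<Rightarrow> nat \<Rightarrow> ('n, 'k) mpoly set" where
  "graded_ideal p n = {f. homogeneous n f \<and> (\<exists>g. f = (\<Sum>i\<in>UNIV. g i * p i))}"

definition hilbert_function :: "('m::finite \<Rightarrow> ('n::finite, 'k::field) mpoly) \<Rightarrow> nat \<Rightarrow> int" where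
  "hilbert_function p n =
     int (vector_space.dim (\<lambda>c f. mconst c * f) {f :: ('n, 'k) mpoly. homogeneous n f}) -
     int (vector_space.dim (\<lambda>c f. mconst c * f) (graded_ideal p n))"

text \<open>
  The subscheme of projective space cut out by homogeneous polynomials \<^term>\<open>p\<close> is a smooth,
  geometrically irreducible curve of genus \<^term>\<open>g\<close>. The first clause says that the Hilbert
  polynomial of the scheme is \<open>d n + 1 - g\<close> with \<open>d > 0\<close>, i.e. that the scheme has dimension one
  and arithmetic genus \<^term>\<open>g\<close>. Given irreducibility, every geometric point has local dimension
  one, so that smoothness is the Jacobian criterion: the Jacobian matrix has corank two.
\<close>
definition smooth_curve_of_genus ::
    "int \<Rightarrow> ('m::finite \<Rightarrow> ('n::finite, 'k::field) mpoly) \<Rightarrow> bool" where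
  "smooth_curve_of_genus g p \<longleftrightarrow>
     (\<exists>d>0. \<exists>N. \<forall>n\<ge>N. hilbert_function p n = d * int n + 1 - g) \<and>
     proj_irreducible (geometric_points p) \<and>
     (\<forall>P\<in>geometric_points p.
        rank ((\<chi> i j. meval to_ac (($) P) (pdiff j (p i))) :: 'k alg_closure^'n^'m) + 2 = CARD('n))"


section \<open>Weierstrass equations and Jacobians\<close>

text \<open>The equation \<open>y\<^sup>2 + a\<^sub>1 x y + a\<^sub>3 y = x\<^sup>3 + a\<^sub>2 x\<^sup>2 + a\<^sub>4 x + a\<^sub>6\<close>.\<close>
datatype 'a weierstrass = Weierstrass (wa1: 'a) (wa2: 'a) (wa3: 'a) (wa4: 'a) (wa6: 'a)

definition wdisc :: "'a::comm_ring_1 weierstrass \<Rightarrow> 'a" where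
  "wdisc W = (let a1 = wa1 W; a2 = wa2 W; a3 = wa3 W; a4 = wa4 W; a6 = wa6 W;
     b2 = a1^2 + 4 * a2;
     b4 = 2 * a4 + a1 * a3;
     b6 = a3^2 + 4 * a6;
     b8 = a1^2 * a6 + 4 * a2 * a6 - a1 * a3 * a4 + a2 * a3^2 - a4^2
     in - (b2^2 * b8) - 8 * b4^3 - 27 * b6^2 + 9 * b2 * b4 * b6)"

definition wcurve :: "'a::field weierstrass \<Rightarrow> ('a^3) set" where
  "wcurve W = {P. P \<noteq> 0 \<and> (let x = P $ 1; y = P $ 2; z = P $ 3 in
     y^2 * z + wa1 W * x * y * z + wa3 W * y * z^2 =
     x^3 + wa2 W * x^2 * z + wa4 W * x * z^2 + wa6 W * z^3)}"

text \<open>The point at infinity is \<^const>\<open>None\<close>.\<close>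
definition waffine :: "'a::field^3 \<Rightarrow> ('a \<times> 'a) option" where
  "waffine P = (if P $ 3 = 0 then None else Some (P $ 1 / P $ 3, P $ 2 / P $ 3))"

text \<open>The chord and tangent group law.\<close>
fun wadd :: "'a::field weierstrass \<Rightarrow> ('a \<times> 'a) option \<Rightarrow> ('a \<times> 'a) option \<Rightarrow> ('a \<times> 'a) option" where
  "wadd W None Q = Q"
| "wadd W P None = P"
| "wadd W (Some (x1, y1)) (Some (x2, y2)) =
     (if x1 = x2 \<and> y1 + y2 + wa1 W * x2 + wa3 W = 0 then None
      else let
        m = (if x1 = x2
             then (3 * x1^2 + 2 * wa2 W * x1 + wa4 W - wa1 W * y1) / (2 * y1 + wa1 W * x1 + wa3 W)
             else (y2 - y1) / (x2 - x1));
        n = y1 - m * x1;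
        x3 = m^2 + wa1 W * m - wa2 W - x1 - x2
        in Some (x3, - (m + wa1 W) * x3 - n - wa3 W))"

text \<open>
  \<^term>\<open>W\<close> is a Weierstrass equation over \<open>'k\<close> of the Jacobian of the smooth genus one curve cut
  out by \<^term>\<open>p\<close>: the curve is a torsor under the elliptic curve \<^term>\<open>W\<close>. That is, there is an
  isomorphism \<open>\<psi>\<close> from the former to the latter over the algebraic closure such that, for each
  automorphism \<open>\<sigma>\<close>, \<open>\<sigma>(\<psi>) \<circ> \<psi>\<^sup>-\<^sup>1\<close> is a translation; below this is evaluated at \<open>\<psi>(\<sigma> P)\<close>.
\<close>
definition jacobian_equation ::
    "('m \<Rightarrow> ('n::finite, 'k::field) mpoly) \<Rightarrow> 'k weierstrass \<Rightarrow> bool" where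
  "jacobian_equation p W \<longleftrightarrow> wdisc W \<noteq> 0 \<and>
     (let C = geometric_points p; W' = map_weierstrass to_ac W; E = wcurve W' in
      \<exists>\<psi>. proj_isomorphism C E \<psi> \<and>
        (\<forall>\<sigma>\<in>closure_auts. \<exists>T\<in>E. \<forall>P\<in>C.
           waffine (vec_map \<sigma> (\<psi> P)) = wadd W' (waffine (\<psi> (vec_map \<sigma> P))) (waffine T)))"


section \<open>Genus one models of degree five\<close>

text \<open>
  \<open>\<Phi> $ i $ j $ k\<close> is the coefficient of \<open>x\<^sub>k\<close> in the linear form in row \<open>i\<close> and column \<open>j\<close>.
  The elements of the index type are 1, 2, 3, 4, 5 (the numeral 5 denotes the same element as 0).
\<close>
type_synonym 'a model = "'a^5^5^5"

definition alternating :: "'a::ab_group_add model \<Rightarrow> bool" where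
  "alternating \<Phi> \<longleftrightarrow> (\<forall>i. \<Phi> $ i $ i = 0) \<and> (\<forall>i j. \<Phi> $ j $ i = - \<Phi> $ i $ j)"

definition linear_form :: "'a::comm_ring_1^'n::finite \<Rightarrow> ('n, 'a) mpoly" where
  "linear_form c = (\<Sum>k\<in>UNIV. mconst (c $ k) * mvar k)"

text \<open>
  The model \<open>[A, B] \<Phi>\<close>. Substituting \<open>x\<^sub>j \<mapsto> \<Sum>\<^sub>i B\<^sub>i\<^sub>j x\<^sub>i\<close> in a linear form multiplies its
  coefficient vector by \<open>B\<close>.
\<close>
definition act :: "'a::comm_ring_1^5^5 \<Rightarrow> 'a^5^5 \<Rightarrow> 'a model \<Rightarrow> 'a model" where
  "act A B \<Phi> = (\<chi> i j. B *v (\<Sum>r\<in>UNIV. \<Sum>s\<in>UNIV. (A $ i $ r * A $ j $ s) *s \<Phi> $ r $ s))"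

definition act_det :: "'a::comm_ring_1^5^5 \<Rightarrow> 'a^5^5 \<Rightarrow> 'a" where
  "act_det A B = (det A)^2 * det B"

definition pf4 :: "'a::comm_ring_1 model \<Rightarrow> 5 \<Rightarrow> 5 \<Rightarrow> 5 \<Rightarrow> 5 \<Rightarrow> (5, 'a) mpoly" where
  "pf4 \<Phi> i j k l =
     linear_form (\<Phi> $ i $ j) * linear_form (\<Phi> $ k $ l) -
     linear_form (\<Phi> $ i $ k) * linear_form (\<Phi> $ j $ l) +
     linear_form (\<Phi> $ i $ l) * linear_form (\<Phi> $ j $ k)"

definition pf :: "'a::comm_ring_1 model \<Rightarrow> 5 \<Rightarrow> (5, 'a) mpoly" where
  "pf \<Phi> i =
     (if i = 1 then pf4 \<Phi> 2 3 4 5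
      else if i = 2 then - pf4 \<Phi> 1 3 4 5
      else if i = 3 then pf4 \<Phi> 1 2 4 5
      else if i = 4 then - pf4 \<Phi> 1 2 3 5
      else pf4 \<Phi> 1 2 3 4)"

definition nonsingular_model :: "'k::field model \<Rightarrow> bool" where
  "nonsingular_model \<Phi> \<longleftrightarrow> smooth_curve_of_genus 1 (pf \<Phi>)"


section \<open>The discriminant\<close>

text \<open>
  The model of the elliptic curve \<^term>\<open>W\<close> embedded by
  \<open>(x\<^sub>1 : x\<^sub>2 : x\<^sub>3 : x\<^sub>4 : x\<^sub>5) = (1 : x : y : x\<^sup>2 : x y)\<close>.
  Its Pfaffians are, up to sign, the \<open>2 \<times> 2\<close> minors of the matrix with rows \<open>x\<^sub>1, x\<^sub>2, x\<^sub>3\<close> and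
  \<open>x\<^sub>2, x\<^sub>4, x\<^sub>5\<close>, together with quadrics expressing the Weierstrass equation and \<open>x\<close> times the
  Weierstrass equation.
\<close>
definition weierstrass_model :: "'a::comm_ring_1 weierstrass \<Rightarrow> 'a model" where
  "weierstrass_model W =
    (let x = (\<lambda>k. axis k 1) :: 5 \<Rightarrow> 'a^5;
         u = (\<lambda>i j. if (i, j) = (1, 3) then x 1
                else if (i, j) = (1, 4) then x 2
                else if (i, j) = (1, 5) then x 3
                else if (i, j) = (2, 3) then x 2
                else if (i, j) = (2, 4) then x 4
                else if (i, j) = (2, 5) then x 5
                else if (i, j) = (3, 4) then x 3 + wa1 W *s x 2 + wa3 W *s x 1
                else if (i, j) = (3, 5) then x 4 + wa2 W *s x 2 + wa4 W *s x 1
                else if (i, j) = (4, 5) then - (wa6 W *s x 1)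
                else 0) :: 5 \<Rightarrow> 5 \<Rightarrow> 'a^5
     in \<chi> i j. u i j - u j i)"

text \<open>
  Integer polynomials in the coefficients of a model; the variable \<open>(i, j, k)\<close> stands for
  \<open>\<Phi> $ i $ j $ k\<close>.
\<close>
type_synonym model_poly = "(5 \<times> 5 \<times> 5, int) mpoly"

definition eval_model :: "model_poly \<Rightarrow> 'a::comm_ring_1 model \<Rightarrow> 'a" where
  "eval_model D \<Phi> = meval of_int (\<lambda>(i, j, k). \<Phi> $ i $ j $ k) D"

text \<open>
  The integer polynomial \<^term>\<open>D\<close> gives, over the field \<open>'k\<close>, the discriminant invariant of models
  of degree five: it is an invariant of weight 12, takes the usual value on Weierstrass models
  (Fisher's normalisation), and on non-singular models is the discriminant of a Weierstrass
  equation for the Jacobian whose coefficients are integer polynomials in those of the model.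
  For infinite \<open>'k\<close> the function \<open>eval_model D\<close> on alternating models over \<open>'k\<close> is determined by
  these conditions: over the algebraic closure every non-singular model is equivalent to a
  Weierstrass model.
\<close>
definition discriminant_polynomial :: "'k::field itself \<Rightarrow> model_poly \<Rightarrow> bool" where
  "discriminant_polynomial _ D \<longleftrightarrow>
     (\<forall>A B (\<Phi> :: 'k model). invertible A \<and> invertible B \<and> alternating \<Phi> \<longrightarrow>
        eval_model D (act A B \<Phi>) = act_det A B ^ 12 * eval_model D \<Phi>) \<and>
     (\<forall>W :: 'k weierstrass. eval_model D (weierstrass_model W) = wdisc W) \<and>
     (\<exists>\<alpha> :: model_poly weierstrass. \<forall>\<Phi> :: 'k model. alternating \<Phi> \<and> nonsingular_model \<Phi> \<longrightarrow>
        jacobian_equation (pf \<Phi>) (map_weierstrass (\<lambda>a. eval_model a \<Phi>) \<alpha>) \<and>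
        eval_model D \<Phi> = wdisc (map_weierstrass (\<lambda>a. eval_model a \<Phi>) \<alpha>))"


section \<open>Discrete valuation fields\<close>

text \<open>A normalised discrete valuation; \<open>v 0\<close> is irrelevant.\<close>
definition discrete_valuation :: "('k::field \<Rightarrow> int) \<Rightarrow> bool" where
  "discrete_valuation v \<longleftrightarrow>
     (\<forall>x y. x \<noteq> 0 \<and> y \<noteq> 0 \<longrightarrow> v (x * y) = v x + v y) \<and>
     (\<forall>x y. x \<noteq> 0 \<and> y \<noteq> 0 \<and> x + y \<noteq> 0 \<longrightarrow> min (v x) (v y) \<le> v (x + y)) \<and>
     (\<exists>x. x \<noteq> 0 \<and> v x = 1)"

definition val_ring :: "('k::field \<Rightarrow> int) \<Rightarrow> 'k set" where
  "val_ring v = {x. x = 0 \<or> 0 \<le> v x}"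

definition max_ideal :: "('k::field \<Rightarrow> int) \<Rightarrow> 'k set" where
  "max_ideal v = {x. x = 0 \<or> 1 \<le> v x}"

definition uniformiser :: "('k::field \<Rightarrow> int) \<Rightarrow> 'k \<Rightarrow> bool" where
  "uniformiser v \<pi> \<longleftrightarrow> \<pi> \<noteq> 0 \<and> v \<pi> = 1"

text \<open>If the residue field has prime characteristic \<open>p\<close>, its Frobenius is surjective.\<close>
definition perfect_residue_field :: "('k::field \<Rightarrow> int) \<Rightarrow> bool" where
  "perfect_residue_field v \<longleftrightarrow> (\<forall>p::nat. normalization_semidom_class.prime p \<and> of_nat p \<in> max_ideal v \<longrightarrow>
     (\<forall>x\<in>val_ring v. \<exists>y\<in>val_ring v. x - y ^ p \<in> max_ideal v))"


section \<open>Integral models and levels\<close>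

definition integral_model :: "('k::field \<Rightarrow> int) \<Rightarrow> 'k model \<Rightarrow> bool" where
  "integral_model v \<Phi> \<longleftrightarrow> alternating \<Phi> \<and> (\<forall>i j k. \<Phi> $ i $ j $ k \<in> val_ring v)"

definition integral_poly :: "('k::field \<Rightarrow> int) \<Rightarrow> ('v, 'k) mpoly \<Rightarrow> bool" where
  "integral_poly v f \<longleftrightarrow> (\<forall>m. Poly_Mapping.lookup f m \<in> val_ring v)"

text \<open>Linear independence over the residue field of the reductions of integral polynomials.\<close>
definition independent_mod ::
    "('k::field \<Rightarrow> int) \<Rightarrow> ('i::finite \<Rightarrow> ('v, 'k) mpoly) \<Rightarrow> bool" where
  "independent_mod v q \<longleftrightarrow> (\<forall>c. (\<forall>i. c i \<in> val_ring v) \<and>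
     (\<forall>m. Poly_Mapping.lookup (\<Sum>i\<in>UNIV. mconst (c i) * q i) m \<in> max_ideal v) \<longrightarrow>
     (\<forall>i. c i \<in> max_ideal v))"

definition saturated :: "('k::field \<Rightarrow> int) \<Rightarrow> 'k model \<Rightarrow> bool" where
  "saturated v \<Phi> \<longleftrightarrow> independent_mod v (pf \<Phi>)"

text \<open>The valuation of the minimal discriminant of the Jacobian.\<close>
definition min_disc_valuation :: "('k::field \<Rightarrow> int) \<Rightarrow> 'k model \<Rightarrow> nat" where
  "min_disc_valuation v \<Phi> = (LEAST n. \<exists>W. jacobian_equation (pf \<Phi>) W \<and>
     set_weierstrass W \<subseteq> val_ring v \<and> v (wdisc W) = int n)"

text \<open>
  The level is the solution \<open>\<ell>\<close> of \<open>v(\<Delta>(\<Phi>)) = v(\<Delta>\<^sub>E) + 12 \<ell>\<close>. That it is a non-negative integer for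
  non-singular integral models is a property, not part of the definition.
\<close>
definition level :: "('k::field \<Rightarrow> int) \<Rightarrow> model_poly \<Rightarrow> 'k model \<Rightarrow> rat" where
  "level v D \<Phi> = of_int (v (eval_model D \<Phi>) - int (min_disc_valuation v \<Phi>)) / 12"

definition integral_orbit :: "('k::field \<Rightarrow> int) \<Rightarrow> 'k model \<Rightarrow> 'k model set" where
  "integral_orbit v \<Phi> =
     {\<Psi>. integral_model v \<Psi> \<and> (\<exists>A \<mu>. invertible A \<and> \<mu> \<noteq> 0 \<and> \<Psi> = act A (mat \<mu>) \<Phi>)}"


section \<open>The algorithm\<close>

text \<open>\<^term>\<open>\<Psi>\<close> is a possible outcome of Step 1 applied to \<^term>\<open>\<Phi>\<close>.\<close>
definition step1 :: "('k::field \<Rightarrow> int) \<Rightarrow> 'k model \<Rightarrow> 'k model \<Rightarrow> bool" where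
  "step1 v \<Phi> \<Psi> \<longleftrightarrow> (\<exists>A q \<mu>. invertible A \<and>
     (\<forall>i. homogeneous 2 (q i) \<and> integral_poly v (q i)) \<and>
     (\<forall>j. pf \<Phi> j = (\<Sum>i\<in>UNIV. mconst (A $ i $ j) * q i)) \<and>
     independent_mod v q \<and>
     \<mu> \<noteq> 0 \<and> \<Psi> = act A (mat \<mu>) \<Phi> \<and> integral_model v \<Psi> \<and>
     \<not> (\<forall>i j k. \<Psi> $ i $ j $ k \<in> max_ideal v))"

definition GL_integral :: "('k::field \<Rightarrow> int) \<Rightarrow> ('k^'n::finite^'n) set" where
  "GL_integral v = {A. (\<forall>i j. A $ i $ j \<in> val_ring v) \<and>
     (\<exists>A'. (\<forall>i j. A' $ i $ j \<in> val_ring v) \<and> A ** A' = mat 1 \<and> A' ** A = mat 1)}"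

definition first_two_rows_divisible :: "('k::field \<Rightarrow> int) \<Rightarrow> 'k \<Rightarrow> 'k model \<Rightarrow> bool" where
  "first_two_rows_divisible v c \<Phi> \<longleftrightarrow> (\<forall>i\<in>{1, 2}. \<forall>j k. \<exists>y\<in>val_ring v. \<Phi> $ i $ j $ k = c * y)"

text \<open>The possible choices of \<open>A'\<close> and \<open>e\<close> in Step 2.\<close>
definition step2_choice :: "('k::field \<Rightarrow> int) \<Rightarrow> 'k \<Rightarrow> 'k model \<Rightarrow> 'k^5^5 \<Rightarrow> nat \<Rightarrow> bool" where
  "step2_choice v \<pi> \<Phi> A e \<longleftrightarrow>
     A \<in> GL_integral v \<and> first_two_rows_divisible v (\<pi> ^ e) (act A (mat 1) \<Phi>) \<and>
     (\<forall>A' e'. A' \<in> GL_integral v \<and> first_two_rows_divisible v (\<pi> ^ e') (act A' (mat 1) \<Phi>) \<longrightarrow>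
        e' \<le> e)"

text \<open>
  Divide each row with index in \<^term>\<open>S\<close> and then each column with index in \<^term>\<open>S\<close> by
  \<^term>\<open>c\<close>; entries with both indices in \<^term>\<open>S\<close> are divided twice.
\<close>
definition divide_rows_cols :: "5 set \<Rightarrow> 'k::field \<Rightarrow> 'k model \<Rightarrow> 'k model" where
  "divide_rows_cols S c \<Phi> =
     (\<chi> i j. (if j \<in> S then inverse c else 1) *s ((if i \<in> S then inverse c else 1) *s \<Phi> $ i $ j))"

end

theory Submission
  imports Defs
begin

text \<open>
  Since \<open>Pf(A \<Phi> A\<^sup>T) = det(A) A\<^sup>-\<^sup>T Pf(\<Phi>)\<close>, after Step 1 the Pfaffians of \<open>\<Phi>\<close> are \<open>c q\<^sub>i\<close> with the
  \<open>q\<^sub>i\<close> independent modulo \<open>\<pi>\<close>. Put \<open>m = v(c)\<close>; the model is saturated iff \<open>m = 0\<close>. Comparing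
  valuations of \<open>\<Phi>\<close> and of its Pfaffians under \<open>[A, \<mu> I]\<close> shows that passing to an integral model
  lowers the level by at most \<open>2 m\<close>, and Step 2 lowers it by \<open>2 e\<close>. So everything follows from
  \<open>e = m\<close>; in (ii) the level drops by at least \<open>3 e\<close> instead.

  To find two rows divisible by \<open>\<pi>\<^sup>m\<close>, take an integral model \<open>[A, \<mu> I] \<Phi>\<close> of minimal level. Its
  reduction is stable: no basis makes a row or a \<open>3 \<times> 3\<close> block vanish. Linear algebra over the
  residue field shows that if \<open>m > 0\<close> then it has a \<open>3 \<times> 3\<close> block whose three linear forms are
  independent, and that this block comes from one of \<open>\<Phi>\<close> itself. By exactness of the Koszul complex
  the other two rows can then be made divisible by \<open>\<pi>\<^sup>m\<close>.
\<close>

text \<open>A stable equivalent model is reached from the given one by a matrix \<open>A\<close>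
  that need not be integral. What links the two is \<open>N\<close>, the scalar \<mu>^2 det(A) c
  times the inverse transpose of \<open>A\<close>, which expresses the Pfaffians of the new model
  through the quadrics \<open>q i\<close>. It is integral because the \<open>q i\<close> are
  independent modulo \<pi>, and its rows modulo \<pi> show which Pfaffians survive reduction.
  Integrality of \<open>N\<close>, combined with the fact that \<open>M\<close> has a unit
  coefficient, gives the constant 2 in the bound; the same bound guarantees that a minimum, hence a
  stable model, exists. No quotient ring is formed. One elimination theory for pairs
  (\<open>R\<close>, \<open>I\<close>) is used modulo \<pi>, modulo \<pi>^m, and over the field with
  zero ideal. Modulo \<pi>^m there are zero divisors, so cancellation goes through functionals with
  exact values 0 and 1. Over the field it shows that a nonzero discriminant makes the Pfaffians
  linearly independent, which is what allows Step 1 to be carried out. Residue characteristic two is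
  allowed, so nothing is ever divided by 2.\<close>

no_notation fps_nth (infixl "$" 75)

section \<open>Rank one perturbations of the identity\<close>

lemma axis_nth_neq: "i \<noteq> j \<Longrightarrow> axis i x $ j = 0"
  by (simp add: axis_def)

lemma sum_axis_mult [simp]:
  fixes f :: "'n::finite \<Rightarrow> 'a::comm_ring_1"
  shows "(\<Sum>i\<in>UNIV. axis k c $ i * f i) = c * f k" "(\<Sum>i\<in>UNIV. f i * axis k c $ i) = f k * c"
proof -
  have "(\<Sum>i\<in>UNIV. axis k c $ i * f i) = (\<Sum>i\<in>UNIV. if i = k then c * f k else 0)"
    by (rule sum.cong) (auto simp: axis_def)
  then show "(\<Sum>i\<in>UNIV. axis k c $ i * f i) = c * f k" by simp
  have "(\<Sum>i\<in>UNIV. f i * axis k c $ i) = (\<Sum>i\<in>UNIV. if i = k then f k * c else 0)"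
    by (rule sum.cong) (auto simp: axis_def)
  then show "(\<Sum>i\<in>UNIV. f i * axis k c $ i) = f k * c" by simp
qed

lemma matrix_vector_mult_sum_right:
  "A *v (\<Sum>i\<in>S. f i) = (\<Sum>i\<in>S. (A :: 'a::comm_ring_1^'n::finite^'m) *v f i)"
  by (induction S rule: infinite_finite_induct) (simp_all add: matrix_vector_right_distrib)

text \<open>The matrix 1 + u w^T. A single family thus covers transvections, scalings of a row and
  simultaneous row operations.\<close>

definition rank1 :: "'a::comm_ring_1^'n \<Rightarrow> 'a^'n \<Rightarrow> 'a^'n::finite^'n" where
  "rank1 u w = (\<chi> i j. mat 1 $ i $ j + u $ i * w $ j)"

lemma sum_mat1 [simp]:
  fixes f :: "'n::finite \<Rightarrow> 'a::comm_ring_1"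
  shows "(\<Sum>j\<in>UNIV. mat 1 $ i $ j * f j) = f i" "(\<Sum>j\<in>UNIV. f j * mat 1 $ j $ i) = f i"
    "(\<Sum>j\<in>UNIV. mat 1 $ j $ i * f j) = f i"
proof -
  have "(\<Sum>j\<in>UNIV. mat 1 $ i $ j * f j) = (\<Sum>j\<in>UNIV. if j = i then f j else 0)"
    by (rule sum.cong) (auto simp: mat_def)
  then show "(\<Sum>j\<in>UNIV. mat 1 $ i $ j * f j) = f i" by simp
  have "(\<Sum>j\<in>UNIV. f j * mat 1 $ j $ i) = (\<Sum>j\<in>UNIV. if j = i then f j else 0)"
    by (rule sum.cong) (auto simp: mat_def)
  then show "(\<Sum>j\<in>UNIV. f j * mat 1 $ j $ i) = f i" by simp
  then show "(\<Sum>j\<in>UNIV. mat 1 $ j $ i * f j) = f i" by (simp add: mult.commute)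
qed

lemma rank1_mult_vec:
  "rank1 u w *v x = x + (\<Sum>j\<in>UNIV. w $ j * x $ j) *s u"
proof -
  have "(\<Sum>j\<in>UNIV. (mat 1 $ i $ j + u $ i * w $ j) * x $ j) =
    x $ i + (\<Sum>j\<in>UNIV. w $ j * x $ j) * u $ i" for i
  proof -
    have "(\<Sum>j\<in>UNIV. (mat 1 $ i $ j + u $ i * w $ j) * x $ j) =
      (\<Sum>j\<in>UNIV. mat 1 $ i $ j * x $ j) + (\<Sum>j\<in>UNIV. (w $ j * x $ j) * u $ i)"
      unfolding sum.distrib [symmetric] by (rule sum.cong) (simp_all add: algebra_simps)
    then show ?thesis
      unfolding sum_mat1 sum_distrib_right [symmetric] .
  qed
  then show ?thesis
    by (simp add: rank1_def matrix_vector_mult_def vec_eq_iff)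
qed

lemma rank1_axis_mult_vec: "rank1 u (axis i 1) *v x = x + x $ i *s u"
  by (simp add: rank1_mult_vec)

text \<open>For fixed \<open>w\<close> these matrices are closed under products, so finding an
  inverse means solving an equation between vectors: \<open>- u\<close> when w.u = 0, and
  \<open>u\<close> rescaled by -1/(1 + w.u) in general.\<close>

lemma rank1_mult:
  fixes u v w :: "'a::comm_ring_1^'n::finite"
  shows "rank1 u w ** rank1 v w = rank1 (u + v + (\<Sum>j\<in>UNIV. w $ j * v $ j) *s u) w"
proof -
  have "(\<Sum>k\<in>UNIV. (mat 1 $ i $ k + u $ i * w $ k) * (mat 1 $ k $ j + v $ k * w $ j)) =
    mat 1 $ i $ j + (u $ i + v $ i + (\<Sum>j\<in>UNIV. w $ j * v $ j) * u $ i) * w $ j" for i j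
  proof -
    have "(\<Sum>k\<in>UNIV. (mat 1 $ i $ k + u $ i * w $ k) * (mat 1 $ k $ j + v $ k * w $ j)) =
      (\<Sum>k\<in>UNIV. mat 1 $ i $ k * mat 1 $ k $ j) + (\<Sum>k\<in>UNIV. mat 1 $ i $ k * (v $ k * w $ j)) +
      (\<Sum>k\<in>UNIV. (u $ i * w $ k) * mat 1 $ k $ j) + (\<Sum>k\<in>UNIV. (w $ k * v $ k) * (u $ i * w $ j))"
      unfolding sum.distrib [symmetric] by (rule sum.cong) (simp_all add: algebra_simps)
    then show ?thesis
      unfolding sum_mat1 sum_distrib_right [symmetric] by (simp add: algebra_simps)
  qed
  then show ?thesis
    by (simp add: rank1_def matrix_matrix_mult_def vec_eq_iff)
qed

lemma rank1_zero [simp]: "rank1 0 w = mat 1"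
  by (simp add: rank1_def vec_eq_iff)

text \<open>Only column \<open>i\<close> differs from the identity matrix, so Cramer's rule gives
  the determinant as the entry \<open>i\<close> of that column.\<close>

lemma det_rank1_axis:
  fixes u :: "'a::field^'n::finite"
  shows "det (rank1 u (axis i 1)) = 1 + u $ i"
proof -
  have "rank1 u (axis i 1) =
      (\<chi> a b. if b = i then (mat 1 *v (axis i 1 + u)) $ a else (mat 1 :: 'a^'n^'n) $ a $ b)"
    unfolding matrix_vector_mul_lid by (auto simp: rank1_def vec_eq_iff axis_def mat_def)
  then show ?thesis
    using cramer_lemma [of i "mat 1 :: 'a^'n^'n" "axis i 1 + u"] by (simp add: axis_def)
qed

lemma invertible_iff_det: "invertible (A :: 'a::field^'n::finite^'n) \<longleftrightarrow> det A \<noteq> 0"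
  by (rule invertible_det_nz)


section \<open>Matrices over a local subring of a field\<close>

text \<open>The inverse is required explicitly, so that no ring structure on \<open>R\<close> is
  presupposed; this also agrees literally with \<open>GL_integral\<close>.\<close>

definition GL_over :: "'k::field set \<Rightarrow> ('k^'n::finite^'n) set" where
  "GL_over R = {A. (\<forall>i j. A $ i $ j \<in> R) \<and>
     (\<exists>A'. (\<forall>i j. A' $ i $ j \<in> R) \<and> A ** A' = mat 1 \<and> A' ** A = mat 1)}"

lemma GL_integral_eq: "GL_integral v = GL_over (val_ring v)"
  by (simp add: GL_integral_def GL_over_def)

lemma GL_over_invertible: "A \<in> GL_over R \<Longrightarrow> invertible A"
  unfolding GL_over_def invertible_def by blast

text \<open>The generators replace each row \<open>j\<close> by its sum with \<open>u\<^sub>j\<close> times row \<open>i\<close>.\<close>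
inductive generated :: "'k::field^'n::finite^'n \<Rightarrow> bool" where
  "generated (mat 1)"
| "generated A \<Longrightarrow> 1 + u $ i \<noteq> 0 \<Longrightarrow> generated (rank1 u (axis i 1) ** A)"

text \<open>Calculation in the residue ring R/I is expressed by membership in \<open>I\<close>, so
  that models and matrices keep their entries in the field. The pairs that occur are the valuation
  ring with its maximal ideal, the valuation ring with the multiples of a power of \<pi>, and the
  whole field with the zero ideal.\<close>

locale subring_ideal =
  fixes R I :: "'k::field set"
  assumes R_0 [simp, intro]: "0 \<in> R" and R_1 [simp, intro]: "1 \<in> R"
    and R_add [intro!]: "x \<in> R \<Longrightarrow> y \<in> R \<Longrightarrow> x + y \<in> R"
    and R_mult [intro!]: "x \<in> R \<Longrightarrow> y \<in> R \<Longrightarrow> x * y \<in> R"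
    and R_uminus [intro!]: "x \<in> R \<Longrightarrow> - x \<in> R"
    and I_sub: "I \<subseteq> R"
    and I_0 [simp, intro]: "0 \<in> I"
    and I_add [intro]: "x \<in> I \<Longrightarrow> y \<in> I \<Longrightarrow> x + y \<in> I"
    and I_mult [intro]: "x \<in> R \<Longrightarrow> y \<in> I \<Longrightarrow> x * y \<in> I"
begin

lemma R_diff [intro!]: "x \<in> R \<Longrightarrow> y \<in> R \<Longrightarrow> x - y \<in> R"
  using R_add R_uminus by fastforce

lemma R_sum [intro!]: "(\<And>i. i \<in> S \<Longrightarrow> f i \<in> R) \<Longrightarrow> sum f S \<in> R"
  by (induction S rule: infinite_finite_induct) auto

lemma R_prod [intro!]: "(\<And>i. i \<in> S \<Longrightarrow> f i \<in> R) \<Longrightarrow> prod f S \<in> R"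
  by (induction S rule: infinite_finite_induct) auto

lemma R_power [intro!]: "x \<in> R \<Longrightarrow> x ^ n \<in> R"
  by (induction n) auto

lemma R_of_int [simp, intro]: "of_int n \<in> R"
proof -
  have "of_nat m \<in> R" for m
    by (induction m) auto
  then show ?thesis
    by (cases n rule: int_cases2) auto
qed

lemma I_R [dest]: "x \<in> I \<Longrightarrow> x \<in> R"
  using I_sub by blast

lemma I_mult' [intro]: "x \<in> I \<Longrightarrow> y \<in> R \<Longrightarrow> x * y \<in> I"
  using I_mult [of y x] by (simp add: mult.commute)

lemma I_uminus [intro]: "x \<in> I \<Longrightarrow> - x \<in> I"
  using I_mult [of "-1" x] by auto

lemma I_diff [intro]: "x \<in> I \<Longrightarrow> y \<in> I \<Longrightarrow> x - y \<in> I"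
  using I_add [of x "- y"] by auto

lemma I_sum [intro]: "(\<And>i. i \<in> S \<Longrightarrow> f i \<in> I) \<Longrightarrow> sum f S \<in> I"
  by (induction S rule: infinite_finite_induct) auto

lemma R_axis [simp, intro]: "axis i 1 $ j \<in> R"
  by (auto simp: axis_def)

lemma R_mat1 [simp, intro]: "mat 1 $ i $ j \<in> R"
  by (auto simp: mat_def)

lemma R_matrix_vector:
  fixes A :: "'k^'n::finite^'m"
  assumes "\<And>i j. A $ i $ j \<in> R" "\<And>j. x $ j \<in> R"
  shows "(A *v x) $ i \<in> R"
  unfolding matrix_vector_mult_def vec_lambda_beta by (intro R_sum R_mult assms)

lemma I_matrix_vector:
  fixes A :: "'k^'n::finite^'m"
  assumes "\<And>i j. A $ i $ j \<in> R" "\<And>j. x $ j \<in> I"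
  shows "(A *v x) $ i \<in> I"
  unfolding matrix_vector_mult_def vec_lambda_beta by (intro I_sum I_mult assms)

lemma GL_mat1: "mat 1 \<in> GL_over R"
  by (auto simp: GL_over_def intro!: exI [of _ "mat 1"])

lemma GL_entry: "A \<in> GL_over R \<Longrightarrow> A $ i $ j \<in> R"
  by (simp add: GL_over_def)

lemma GL_mult:
  assumes "A \<in> GL_over R" "B \<in> GL_over R"
  shows "A ** B \<in> GL_over R"
proof -
  obtain A' where A': "\<And>i j. A' $ i $ j \<in> R" "A ** A' = mat 1" "A' ** A = mat 1"
    using assms(1) by (auto simp: GL_over_def)
  obtain B' where B': "\<And>i j. B' $ i $ j \<in> R" "B ** B' = mat 1" "B' ** B = mat 1"
    using assms(2) by (auto simp: GL_over_def)
  have 1: "(A ** B) $ i $ j \<in> R" "(B' ** A') $ i $ j \<in> R" for i j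
    unfolding matrix_matrix_mult_def vec_lambda_beta
    by (intro R_sum R_mult assms A' B' GL_entry)+
  have "A ** B ** (B' ** A') = A ** (B ** B') ** A'" "B' ** A' ** (A ** B) = B' ** (A' ** A) ** B"
    by (simp_all add: matrix_mul_assoc)
  with 1 A' B' show ?thesis
    by (auto simp: GL_over_def intro!: exI [of _ "B' ** A'"])
qed

lemma GL_inverse:
  assumes "A \<in> GL_over R"
  obtains A' where "A' \<in> GL_over R" "A ** A' = mat 1" "A' ** A = mat 1"
  using assms unfolding GL_over_def by blast

lemma GL_rank1:
  assumes "\<And>i. u $ i \<in> R" "\<And>i. w $ i \<in> R" "(\<Sum>j\<in>UNIV. w $ j * u $ j) = 0"
  shows "rank1 u w \<in> GL_over R"
proof -
  have "rank1 u w ** rank1 (- u) w = mat 1" "rank1 (- u) w ** rank1 u w = mat 1"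
    using assms(3) by (simp_all add: rank1_mult sum_negf)
  moreover have "rank1 u w $ i $ j \<in> R" "rank1 (- u) w $ i $ j \<in> R" for i j
    using assms by (auto simp: rank1_def)
  ultimately show ?thesis
    by (auto simp: GL_over_def)
qed

lemma det_in_R:
  fixes A :: "'k^'n::finite^'n"
  assumes "\<And>i j. A $ i $ j \<in> R"
  shows "det A \<in> R"
  using assms unfolding det_def by auto

end

text \<open>Elements of \<open>R\<close> outside \<open>I\<close> are units, so R/I is a field and
  elimination with pivots works.\<close>

locale local_subring = subring_ideal R I for R I :: "'k::field set" +
  assumes one_notin_I: "1 \<notin> I"
    and inverse_R: "x \<in> R \<Longrightarrow> x \<notin> I \<Longrightarrow> inverse x \<in> R"
begin

lemma GL_rank1_axis:
  assumes "\<And>j. u $ j \<in> R" "1 + u $ i \<notin> I"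
  shows "rank1 u (axis i 1) \<in> GL_over R"
proof -
  let ?d = "1 + u $ i"
  have d: "?d \<in> R" "inverse ?d \<in> R"
    by (intro inverse_R R_add R_1 assms)+
  have d0: "?d \<noteq> 0"
    using assms(2) I_0 by metis
  \<comment> \<open>The multiple s u for which the composition law of \<open>rank1_mult\<close>
    gives zero: 1 + s (1 + u_i) = 0.\<close>
  let ?u = "(- inverse ?d) *s u"
  have a: "u $ j - u $ j * inverse ?d - u $ i * inverse ?d * u $ j = 0" for j
  proof -
    have "u $ j - u $ j * inverse ?d - u $ i * inverse ?d * u $ j = u $ j * (1 - inverse ?d * ?d)"
      by (simp add: algebra_simps)
    then show ?thesis using d0 by simp
  qed
  have "u + ?u + (\<Sum>j\<in>UNIV. axis i 1 $ j * ?u $ j) *s u = 0"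
       "?u + u + (\<Sum>j\<in>UNIV. axis i 1 $ j * u $ j) *s ?u = 0"
    unfolding sum_axis_mult using a by (simp_all add: vec_eq_iff algebra_simps)
  then have "rank1 u (axis i 1) ** rank1 ?u (axis i 1) = mat 1"
    "rank1 ?u (axis i 1) ** rank1 u (axis i 1) = mat 1"
    by (simp_all only: rank1_mult rank1_zero)
  moreover have "rank1 u (axis i 1) $ a $ b \<in> R" "rank1 ?u (axis i 1) $ a $ b \<in> R" for a b
    using assms(1) d by (auto simp: rank1_def)
  ultimately show ?thesis
    by (auto simp: GL_over_def)
qed

text \<open>Gaussian elimination over a local ring: vectors independent modulo \<open>I\<close>
  extend to a basis over \<open>R\<close>, and the coordinates come out exact, not merely modulo
  \<open>I\<close>. The vectors are indexed by coordinates, so each one has its own pivot position.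
  That \<open>G\<close> is a product of generators matters for
  \<open>invertible_generated\<close>.\<close>

lemma reduce_independent:
  fixes t :: "'n::finite \<Rightarrow> 'k^'n"
  assumes tR: "\<And>j k. j \<in> S \<Longrightarrow> t j $ k \<in> R"
    and indep: "\<And>c. (\<And>j. j \<in> S \<Longrightarrow> c j \<in> R) \<Longrightarrow> (\<And>k. (\<Sum>j\<in>S. c j * t j $ k) \<in> I) \<Longrightarrow>
      \<forall>j\<in>S. c j \<in> I"
  shows "\<exists>G\<in>GL_over R. generated G \<and> (\<forall>j\<in>S. G *v t j = axis j 1)"
  using finite [of S] tR indep
proof (induction S rule: finite_induct)
  case empty
  then show ?case
    using GL_mat1 generated.intros(1) by blast
next
  case (insert j S)
  have "\<exists>G\<in>GL_over R. generated G \<and> (\<forall>j\<in>S. G *v t j = axis j 1)"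
  proof (rule insert.IH)
    fix c assume c: "\<And>i. i \<in> S \<Longrightarrow> c i \<in> R" "\<And>k. (\<Sum>j\<in>S. c j * t j $ k) \<in> I"
    have "\<forall>i\<in>insert j S. (c(j := 0)) i \<in> I"
    proof (rule insert.prems(2))
      fix k
      have "(\<Sum>i\<in>insert j S. (c(j := 0)) i * t i $ k) = (\<Sum>i\<in>S. c i * t i $ k)"
        using insert.hyps by (auto intro!: sum.cong)
      then show "(\<Sum>i\<in>insert j S. (c(j := 0)) i * t i $ k) \<in> I"
        using c by simp
    qed (use c in auto)
    then show "\<forall>i\<in>S. c i \<in> I"
      using insert.hyps by (auto split: if_splits)
  qed (use insert.prems in auto)
  then obtain G where G: "G \<in> GL_over R" "generated G" "\<And>i. i \<in> S \<Longrightarrow> G *v t i = axis i 1"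
    by blast
  obtain G' where G': "G' \<in> GL_over R" "G ** G' = mat 1" "G' ** G = mat 1"
    using GL_inverse G(1) by blast
  define y where "y = G *v t j"
  have yR: "y $ k \<in> R" for k
    unfolding y_def by (intro R_matrix_vector GL_entry G insert.prems) auto
  have "\<exists>i. i \<notin> S \<and> y $ i \<notin> I"
  proof (rule ccontr)
    assume "\<nexists>i. i \<notin> S \<and> y $ i \<notin> I"
    then have yI: "y $ i \<in> I" if "i \<notin> S" for i
      using that by blast
    \<comment> \<open>Without a pivot outside \<open>S\<close>, the image of \<open>t j\<close>
      would be a combination of the basis vectors already reached; applying the inverse of
      \<open>G\<close> turns this into a relation with coefficient -1 at \<open>j\<close>.\<close>
    define z where "z = (\<Sum>i\<in>S. y $ i *s t i) - t j"
    have "G *v z = (\<Sum>i\<in>S. y $ i *s (G *v t i)) - y"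
      by (simp add: z_def y_def matrix_vector_mult_diff_distrib matrix_vector_mult_sum_right
          vector_scalar_commute)
    then have Gz: "G *v z = (\<Sum>i\<in>S. y $ i *s axis i 1) - y"
      using G(3) by simp
    have "(G *v z) $ k \<in> I" for k
    proof -
      have "(\<Sum>i\<in>S. y $ i * axis i 1 $ k) = (\<Sum>i\<in>S. if i = k then y $ k else 0)"
        by (rule sum.cong) (auto simp: axis_def)
      then have "(G *v z) $ k = (if k \<in> S then y $ k else 0) - y $ k"
        unfolding Gz by simp
      then show ?thesis
        using yI by auto
    qed
    then have "(G' *v (G *v z)) $ k \<in> I" for k
      by (rule I_matrix_vector [OF GL_entry [OF G'(1)]])
    then have zI: "z $ k \<in> I" for k
      by (simp add: matrix_vector_mul_assoc G')
    have "\<forall>i\<in>insert j S. (\<lambda>i. if i = j then -1 else y $ i) i \<in> I"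
    proof (rule insert.prems(2))
      fix k
      have "(\<Sum>i\<in>insert j S. (if i = j then -1 else y $ i) * t i $ k) =
        - t j $ k + (\<Sum>i\<in>S. (if i = j then -1 else y $ i) * t i $ k)"
        using insert.hyps by simp
      also have "(\<Sum>i\<in>S. (if i = j then -1 else y $ i) * t i $ k) = (\<Sum>i\<in>S. y $ i * t i $ k)"
        using insert.hyps by (auto intro!: sum.cong)
      also have "- t j $ k + \<dots> = z $ k"
        by (simp add: z_def)
      finally show "(\<Sum>i\<in>insert j S. (if i = j then -1 else y $ i) * t i $ k) \<in> I"
        using zI by simp
    qed (use yR in auto)
    then have "-1 \<in> I" by simp
    then have "1 \<in> I" using I_uminus [of "-1"] by simp
    then show False using one_notin_I by blast
  qed
  then obtain i where i: "i \<notin> S" "y $ i \<notin> I" by blast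
  have "\<exists>G\<in>GL_over R. generated G \<and> (\<forall>l\<in>S. G *v t l = axis l 1) \<and> (G *v t j) $ j \<notin> I"
  proof (cases "y $ j \<in> I")
    case False
    then show ?thesis using G y_def by blast
  next
    case True
    with i have ij: "i \<noteq> j" by blast
    \<comment> \<open>Adding row \<open>i\<close> to row \<open>j\<close> moves the pivot to
      position \<open>j\<close>. As \<open>i\<close> is outside \<open>S\<close>, the vectors
      treated earlier stay fixed.\<close>
    let ?E = "rank1 (axis j 1) (axis i 1) :: 'k^'n^'n"
    have "1 + axis j 1 $ i = (1::'k)"
      using ij by (simp add: axis_def)
    then have "?E \<in> GL_over R" "generated (?E ** G)"
      using one_notin_I G(2) by (auto simp del: R_axis intro!: GL_rank1_axis R_axis generated.intros)
    moreover have "(?E ** G) *v t l = axis l 1" if "l \<in> S" for l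
      using that i(1) G(3) [OF that]
      axis_nth_neq [of l i 1]
      by (auto simp: matrix_vector_mul_assoc [symmetric] rank1_axis_mult_vec)
    moreover have "((?E ** G) *v t j) $ j = y $ j + y $ i"
      by (simp add: matrix_vector_mul_assoc [symmetric] rank1_axis_mult_vec y_def [symmetric])
    moreover have "y $ j + y $ i \<notin> I"
      using I_diff [of "y $ j + y $ i" "y $ j"] True i by auto
    ultimately show ?thesis
      using G(1) GL_mult by (intro bexI [of _ "?E ** G"]) simp_all
  qed
  then obtain G1 where G1: "G1 \<in> GL_over R" "generated G1" "\<And>l. l \<in> S \<Longrightarrow> G1 *v t l = axis l 1"
    "(G1 *v t j) $ j \<notin> I" by blast
  define x where "x = G1 *v t j"
  have xR: "x $ k \<in> R" for k
    unfolding x_def by (intro R_matrix_vector GL_entry G1 insert.prems) auto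
  have xj: "x $ j \<notin> I"
    using G1(4) by (simp add: x_def)
  then have xj0: "x $ j \<noteq> 0" and xjR: "inverse (x $ j) \<in> R"
    using I_0 inverse_R [OF xR] by metis+
  \<comment> \<open>The solution of x + x_j u = e_j; the new determinant factor 1 + u_j is the
    inverse of the pivot.\<close>
  define u where "u = inverse (x $ j) *s (axis j 1 - x)"
  have uR: "u $ k \<in> R" for k
    using xR xjR unfolding u_def by (simp add: R_mult R_diff)
  have "1 + u $ j = inverse (x $ j)"
    using xj0 by (simp add: u_def right_diff_distrib)
  moreover have "inverse (x $ j) \<notin> I"
    using I_mult [OF xR [of j], of "inverse (x $ j)"] xj0 one_notin_I by auto
  ultimately have u1: "1 + u $ j \<notin> I" by simp
  then have u2: "1 + u $ j \<noteq> 0" using I_0 by metis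
  let ?H = "rank1 u (axis j 1)"
  have "?H ** G1 \<in> GL_over R" "generated (?H ** G1)"
    by (intro GL_mult GL_rank1_axis generated.intros uR u1 u2 G1)+
  moreover have "(?H ** G1) *v t l = axis l 1" if "l \<in> S" for l
    using that insert.hyps G1(3) [OF that]
      axis_nth_neq [of l j 1]
      by (auto simp: matrix_vector_mul_assoc [symmetric] rank1_axis_mult_vec)
  moreover have "(?H ** G1) *v t j = axis j 1"
    using xj0 by (simp add: matrix_vector_mul_assoc [symmetric] rank1_axis_mult_vec x_def [symmetric])
      (simp add: u_def vec_eq_iff)
  ultimately show ?case
    by blast
qed

end

text \<open>Over the field with zero ideal, \<open>reduce_independent\<close> applied to the columns
  of the inverse matrix produces a product of generators \<open>G\<close> with G A' = 1, which is
  then \<open>A\<close> itself.\<close>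

lemma invertible_generated:
  fixes A :: "'k::field^'n::finite^'n"
  assumes "invertible A"
  shows "generated A"
proof -
  interpret local_subring "UNIV :: 'k set" "{0}"
    by unfold_locales auto
  obtain A' where A': "A ** A' = mat 1" "A' ** A = mat 1"
    using assms invertible_def by blast
  have "\<exists>G\<in>GL_over UNIV. generated G \<and> (\<forall>j\<in>UNIV. G *v column j A' = axis j 1)"
  proof (rule reduce_independent)
    fix c :: "'n \<Rightarrow> 'k"
    assume "\<And>k. (\<Sum>j\<in>UNIV. c j * column j A' $ k) \<in> {0}"
    then have "A' *v (\<chi> j. c j) = 0"
      by (simp add: vec_eq_iff matrix_vector_mult_def column_def mult.commute)
    then have "(A ** A') *v (\<chi> j. c j) = 0"
      by (simp add: matrix_vector_mul_assoc [symmetric])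
    then show "\<forall>j\<in>UNIV. c j \<in> {0}"
      by (simp add: A' vec_eq_iff)
  qed auto
  then obtain G where G: "generated G" "\<And>j. G *v column j A' = axis j 1"
    by blast
  have "(G ** A') $ i $ j = mat 1 $ i $ j" for i j
    using arg_cong [OF G(2) [of j], of "\<lambda>x. x $ i"]
    by (auto simp: matrix_vector_mult_def matrix_matrix_mult_def column_def axis_def mat_def)
  then have "G ** A' = mat 1"
    by (simp add: vec_eq_iff)
  then have "G = A"
    by (metis A'(2) matrix_mul_assoc matrix_mul_lid matrix_mul_rid)
  with G show ?thesis by simp
qed

section \<open>Models as bilinear forms\<close>

lemma exhaust_5: fixes x :: 5 obtains "x = 1" | "x = 2" | "x = 3" | "x = 4" | "x = 5"
proof (induct x)
  case (of_int z)
  then have "0 \<le> z" and "z < 5" by simp_all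
  then have "z = 0 \<or> z = 1 \<or> z = 2 \<or> z = 3 \<or> z = 4" by arith
  then show ?case using of_int by auto
qed

lemma forall_5: "(\<forall>i::5. P i) \<longleftrightarrow> P 1 \<and> P 2 \<and> P 3 \<and> P 4 \<and> P 5"
  by (metis exhaust_5)

lemma UNIV_5: "(UNIV :: 5 set) = {1, 2, 3, 4, 5}"
  using exhaust_5 by auto

lemma sum_5: "(\<Sum>i\<in>UNIV. f (i::5)) = f 1 + (f 2 + (f 3 + (f 4 + f 5)))"
  unfolding UNIV_5 by simp

lemma distinct_5_UNIV: "distinct [a, b, c, d, e] \<Longrightarrow> (UNIV :: 5 set) = {a, b, c, d, e}"
  using card_subset_eq [of "UNIV :: 5 set" "{a, b, c, d, e}"] by simp

text \<open>The vector-valued bilinear form whose Gram matrix is \<open>M\<close>. Acting by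
  \<open>A\<close> evaluates it at the rows of \<open>A\<close>, which is a pullback along the
  transpose.\<close>

definition form :: "'a::comm_ring_1 model \<Rightarrow> 'a^5 \<Rightarrow> 'a^5 \<Rightarrow> 'a^5" where
  "form M x y = (\<Sum>r\<in>UNIV. \<Sum>s\<in>UNIV. (x $ r * y $ s) *s M $ r $ s)"

lemma form_nth: "form M x y $ k = (\<Sum>r\<in>UNIV. \<Sum>s\<in>UNIV. x $ r * y $ s * M $ r $ s $ k)"
  by (simp add: form_def)

lemma act_nth: "act A B M $ i $ j = B *v form M (A $ i) (A $ j)"
  by (simp add: act_def form_def)

lemma form_add: "form M (x + y) z = form M x z + form M y z" "form M x (y + z) = form M x y + form M x z"
  by (simp_all add: form_def vec_eq_iff distrib_left distrib_right sum.distrib)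

lemma form_scale: "form M (c *s x) z = c *s form M x z" "form M x (c *s z) = c *s form M x z"
  by (simp_all add: form_def vec_eq_iff sum_distrib_left ac_simps)

lemma form_zero [simp]: "form M 0 z = 0" "form M x 0 = 0"
  by (simp_all add: form_def vec_eq_iff)

lemma form_sum: "form M (\<Sum>i\<in>S. f i) z = (\<Sum>i\<in>S. form M (f i) z)"
   "form M x (\<Sum>i\<in>S. f i) = (\<Sum>i\<in>S. form M x (f i))"
  by (induction S rule: infinite_finite_induct) (simp_all add: form_add)

lemma form_axis [simp]: "form M (axis i 1) (axis j 1) = M $ i $ j"
proof -
  have "form M (axis i 1) (axis j 1) $ k = M $ i $ j $ k" for k
    unfolding form_nth mult.assoc sum_distrib_left [symmetric] by simp
  then show ?thesis by (simp add: vec_eq_iff)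
qed

lemma matrix_vector_mult_scale:
  "A *v (c *s x) = c *s ((A :: 'a::comm_ring_1^'n::finite^'m) *v x)"
  by (simp add: matrix_vector_mult_def vec_eq_iff sum_distrib_left ac_simps)

lemma mat_mult_vec: "mat c *v x = c *s (x :: 'a::comm_ring_1^'n::finite)"
proof -
  have "(\<Sum>j\<in>UNIV. (if i = j then c else 0) * x $ j) = c * x $ i" for i
  proof -
    have "(\<Sum>j\<in>UNIV. (if i = j then c else 0) * x $ j) = (\<Sum>j\<in>UNIV. if i = j then c * x $ j else 0)"
      by (rule sum.cong) auto
    then show ?thesis by simp
  qed
  then show ?thesis
    by (simp add: mat_def matrix_vector_mult_def vec_eq_iff)
qed

lemma transpose_mult_vec: "transpose A *v x = (\<Sum>i\<in>UNIV. x $ i *s (A :: 'a::comm_ring_1^'n::finite^'m::finite) $ i)"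
  by (simp add: matrix_vector_mult_def transpose_def vec_eq_iff mult.commute)

lemma form_act: "form (act A B M) x y = B *v form M (transpose A *v x) (transpose A *v y)"
proof -
  have "form M (transpose A *v x) (transpose A *v y) =
      (\<Sum>j\<in>UNIV. y $ j *s (\<Sum>i\<in>UNIV. x $ i *s form M (A $ i) (A $ j)))"
    unfolding transpose_mult_vec form_sum form_scale ..
  also have "\<dots> = (\<Sum>i\<in>UNIV. \<Sum>j\<in>UNIV. (x $ i * y $ j) *s form M (A $ i) (A $ j))"
    by (subst sum.swap) (simp add: vec_eq_iff sum_distrib_left ac_simps)
  finally show ?thesis
    by (simp add: form_def [of "act A B M"] act_nth matrix_vector_mult_sum_right
        matrix_vector_mult_scale)
qed

lemma matrix_mult_nth: "(A ** B) $ i = transpose B *v (A :: 'a::comm_ring_1^'n::finite^'m) $ i"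
  by (simp add: matrix_matrix_mult_def matrix_vector_mult_def transpose_def vec_eq_iff mult.commute)

lemma model_eqI: "(\<And>i j. M $ i $ j = N $ i $ j) \<Longrightarrow> M = (N :: 'a model)"
  by (simp add: vec_eq_iff)

lemma act_act: "act A B (act A' B' M) = act (A ** A') (B ** B') M"
  by (rule model_eqI) (simp only: act_nth form_act matrix_mult_nth matrix_vector_mul_assoc)

lemma mat1_nth: "mat 1 $ i = axis i 1"
  by (auto simp: mat_def axis_def vec_eq_iff)

lemma act_one [simp]: "act (mat 1) (mat 1) M = M"
  by (rule model_eqI) (simp add: act_nth mat1_nth)

lemma act_mat: "act A (mat c) M $ i $ j = c *s form M (A $ i) (A $ j)"
  by (simp add: act_nth mat_mult_vec)

lemma form_alternating:
  assumes "alternating M"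
  shows "form M y x = - form M x y" "form M x x = 0"
proof -
  have M: "M $ i $ i = 0" "M $ j $ i = - M $ i $ j" for i j
    using assms unfolding alternating_def by blast+
  have "form M y x = (\<Sum>s\<in>UNIV. \<Sum>r\<in>UNIV. (y $ r * x $ s) *s M $ r $ s)"
    unfolding form_def by (rule sum.swap)
  also have "\<dots> = (\<Sum>s\<in>UNIV. \<Sum>r\<in>UNIV. - ((x $ s * y $ r) *s M $ s $ r))"
  proof (intro sum.cong refl)
    fix s r
    show "(y $ r * x $ s) *s M $ r $ s = - ((x $ s * y $ r) *s M $ s $ r)"
      unfolding M(2) [of r s] by (simp add: vec_eq_iff mult.commute)
  qed
  finally show "form M y x = - form M x y"
    by (simp add: form_def sum_negf)
  \<comment> \<open>Skew symmetry alone would only give that twice the value is zero, so the sum is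
    expanded and the vanishing diagonal is used.\<close>
  have "form M x x $ k = 0" for k
  proof -
    have "M $ 2 $ 1 = - M $ 1 $ 2" "M $ 3 $ 1 = - M $ 1 $ 3" "M $ 4 $ 1 = - M $ 1 $ 4" "M $ 5 $ 1 = - M $ 1 $ 5"
      "M $ 3 $ 2 = - M $ 2 $ 3" "M $ 4 $ 2 = - M $ 2 $ 4" "M $ 5 $ 2 = - M $ 2 $ 5"
      "M $ 4 $ 3 = - M $ 3 $ 4" "M $ 5 $ 3 = - M $ 3 $ 5" "M $ 5 $ 4 = - M $ 4 $ 5"
      by (rule M(2))+
    then show ?thesis
      unfolding form_nth sum_5 M(1) by (simp add: algebra_simps)
  qed
  then show "form M x x = 0"
    by (simp add: vec_eq_iff)
qed

lemma alternating_act: "alternating M \<Longrightarrow> alternating (act A B M)"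
proof -
  assume M: "alternating M"
  have "B *v (- x) = - (B *v x)" for x
    using matrix_vector_right_distrib [of B x "- x" for x]
    by (metis add_eq_0_iff matrix_vector_mult_0_right right_minus)
  then have "act A B M $ j $ i = - act A B M $ i $ j" for i j
    unfolding act_nth using form_alternating(1) [OF M, of "A $ j" "A $ i"] by simp
  moreover have "act A B M $ i $ i = 0" for i
    unfolding act_nth using form_alternating(2) [OF M] by simp
  ultimately show ?thesis
    unfolding alternating_def by blast
qed

lemma alternating_nth:
  assumes "alternating M"
  shows "M $ i $ i = 0" "M $ j $ i = - M $ i $ j"
  using assms unfolding alternating_def by blast+

text \<open>The term with factor \<open>u $ i * u $ j\<close> carries \<open>form M w w\<close>,
  which vanishes; the change is therefore linear in \<open>u\<close>.\<close>

lemma act_rank1_nth: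
  assumes M: "alternating M"
  shows "act (rank1 u w) (mat 1) M $ i $ j =
    M $ i $ j + u $ i *s form M w (axis j 1) + u $ j *s form M (axis i 1) w"
proof -
  have "rank1 u w $ i = axis i 1 + u $ i *s w" for i
    by (simp add: rank1_def vec_eq_iff mat1_nth)
  then show ?thesis
    using form_alternating(2) [OF M, of w] by (simp add: act_nth form_add form_scale)
qed

lemma act_rank1_axis_nth:
  assumes M: "alternating M"
  shows "act (rank1 u (axis k 1)) (mat 1) M $ i $ j =
    M $ i $ j + u $ i *s M $ k $ j + u $ j *s M $ i $ k"
  using act_rank1_nth [OF M, of u "axis k 1"] by simp


section \<open>The Pfaffians\<close>

lemma mconst_add: "mconst (a + b) = mconst a + mconst b"
  by (rule single_add)

lemma mconst_mult: "mconst (a * b) = mconst a * (mconst b :: ('v, 'a::comm_ring_1) mpoly)"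
  by (simp add: mult_single)

lemma mconst_sum: "mconst (\<Sum>i\<in>S. f i) = (\<Sum>i\<in>S. mconst (f i))"
  by (induction S rule: infinite_finite_induct) (simp_all add: mconst_add)

lemma linear_form_add: "linear_form (x + y) = linear_form x + linear_form y"
  by (simp add: linear_form_def mconst_add distrib_right sum.distrib)

lemma linear_form_scale: "linear_form (c *s x) = mconst c * linear_form x"
  by (simp only: linear_form_def mconst_mult sum_distrib_left mult.assoc vector_smult_component)

lemma linear_form_uminus: "linear_form (- x) = - linear_form x"
  by (simp add: linear_form_def single_uminus sum_negf)

lemma linear_form_zero: "linear_form 0 = 0"
  by (simp add: linear_form_def)

text \<open>Kept over an arbitrary commutative ring because the entries are polynomials in
  \<open>pf_eq_pfaff\<close> and values at a point in \<open>meval_pf\<close>.\<close>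

definition pfaff :: "(5 \<Rightarrow> 5 \<Rightarrow> 'r::comm_ring_1) \<Rightarrow> 5 \<Rightarrow> 'r" where
  "pfaff f i =
    (if i = 1 then f 2 3 * f 4 5 - f 2 4 * f 3 5 + f 2 5 * f 3 4
     else if i = 2 then - (f 1 3 * f 4 5 - f 1 4 * f 3 5 + f 1 5 * f 3 4)
     else if i = 3 then f 1 2 * f 4 5 - f 1 4 * f 2 5 + f 1 5 * f 2 4
     else if i = 4 then - (f 1 2 * f 3 5 - f 1 3 * f 2 5 + f 1 5 * f 2 3)
     else f 1 2 * f 3 4 - f 1 3 * f 2 4 + f 1 4 * f 2 3)"

lemma pf_eq_pfaff: "pf M i = pfaff (\<lambda>i j. linear_form (M $ i $ j)) i"
  by (simp add: pf_def pf4_def pfaff_def)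

lemma pfaff_simps:
  "pfaff f 1 = f 2 3 * f 4 5 - f 2 4 * f 3 5 + f 2 5 * f 3 4"
  "pfaff f 2 = - (f 1 3 * f 4 5 - f 1 4 * f 3 5 + f 1 5 * f 3 4)"
  "pfaff f 3 = f 1 2 * f 4 5 - f 1 4 * f 2 5 + f 1 5 * f 2 4"
  "pfaff f 4 = - (f 1 2 * f 3 5 - f 1 3 * f 2 5 + f 1 5 * f 2 3)"
  "pfaff f 5 = f 1 2 * f 3 4 - f 1 3 * f 2 4 + f 1 4 * f 2 3"
  by (simp_all add: pfaff_def)

text \<open>The generator case of the transformation law of the Pfaffians: the bracket is the entry
  (i, j) of 1 + u e_k^T, and 1 + u_k is its determinant. For each \<open>j\<close> and
  \<open>k\<close> it is a polynomial identity.\<close>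

lemma pfaff_row_operation:
  fixes f g :: "5 \<Rightarrow> 5 \<Rightarrow> 'r::comm_ring_1"
  assumes f: "\<And>i. f i i = 0" "\<And>i j. f j i = - f i j"
    and g: "\<And>i j. g i j = f i j + u i * f k j + u j * f i k"
  shows "(\<Sum>i\<in>UNIV. ((if i = j then 1 else 0) + (if j = k then u i else 0)) * pfaff g i) =
    (1 + u k) * pfaff f j"
proof -
  have h: "f 2 1 = - f 1 2" "f 3 1 = - f 1 3" "f 4 1 = - f 1 4" "f 5 1 = - f 1 5"
    "f 3 2 = - f 2 3" "f 4 2 = - f 2 4" "f 5 2 = - f 2 5" "f 4 3 = - f 3 4" "f 5 3 = - f 3 5"
    "f 5 4 = - f 4 5"
    by (rule f(2))+
  show ?thesis
    unfolding sum_5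
    by (cases j rule: exhaust_5; cases k rule: exhaust_5;
       simp add: pfaff_simps g h f(1) algebra_simps)
qed

lemma pf_rank1:
  assumes M: "alternating M"
  shows "(\<Sum>i\<in>UNIV. mconst (rank1 u (axis k 1) $ i $ j) *
      pf (act (rank1 u (axis k 1)) (mat 1) M) i) = mconst (1 + u $ k) * pf M j"
proof -
  let ?E = "rank1 u (axis k 1)"
  have E: "mconst (?E $ i $ j) =
      ((if i = j then 1 else 0) + (if j = k then mconst (u $ i) else 0) :: (5, 'a) mpoly)" for i
    by (auto simp: rank1_def mat_def axis_def mconst_add)
  have "(\<Sum>i\<in>UNIV. ((if i = j then 1 else 0) + (if j = k then mconst (u $ i) else 0)) *
      pfaff (\<lambda>i j. linear_form (act ?E (mat 1) M $ i $ j)) i) =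
    (1 + mconst (u $ k)) * pfaff (\<lambda>i j. linear_form (M $ i $ j)) j"
  proof (rule pfaff_row_operation)
    show "linear_form (M $ i $ i) = 0" for i
      by (simp only: alternating_nth(1) [OF M] linear_form_zero)
    show "linear_form (M $ j $ i) = - linear_form (M $ i $ j)" for i j
      by (simp only: alternating_nth(2) [OF M, of j i] linear_form_uminus)
    show "linear_form (act ?E (mat 1) M $ i $ j) = linear_form (M $ i $ j) +
        mconst (u $ i) * linear_form (M $ k $ j) + mconst (u $ j) * linear_form (M $ i $ k)" for i j
      by (simp only: act_rank1_axis_nth [OF M] linear_form_add linear_form_scale)
  qed
  then show ?thesis
    unfolding pf_eq_pfaff E mconst_add by simp
qed

text \<open>In matrix notation, \<open>A\<^sup>T Pf(A \<Phi> A\<^sup>T) = det(A) Pf(\<Phi>)\<close>.\<close>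
lemma pf_act:
  fixes A :: "'k::field^5^5"
  assumes "invertible A" "alternating M"
  shows "(\<Sum>i\<in>UNIV. mconst (A $ i $ j) * pf (act A (mat 1) M) i) = mconst (det A) * pf M j"
proof -
  \<comment> \<open>Both sides of the law are compatible with products of matrices, so it suffices
    to follow it through one generator at a time.\<close>
  have "generated A"
    using assms(1) by (rule invertible_generated)
  then show ?thesis
  proof (induction A arbitrary: j)
    case 1
    have "(\<Sum>i\<in>UNIV. mconst (mat 1 $ i $ j) * pf M i) = (\<Sum>i\<in>UNIV. if i = j then pf M i else 0)"
      by (rule sum.cong) (auto simp: mat_def)
    then show ?case
      by simp
  next
    case (2 A u k)
    let ?E = "rank1 u (axis k 1)"
    let ?M = "act A (mat 1) M"
    have "act (?E ** A) (mat 1) M = act ?E (mat 1) ?M"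
      by (simp add: act_act)
    moreover have "mconst ((?E ** A) $ i $ j) * f =
        (\<Sum>l\<in>UNIV. mconst (A $ l $ j) * (mconst (?E $ i $ l) * f))" for i and f :: "(5, 'k) mpoly"
      by (simp only: matrix_matrix_mult_def vec_lambda_beta mconst_sum mconst_mult sum_distrib_right
          sum_distrib_left ac_simps)
    ultimately have "(\<Sum>i\<in>UNIV. mconst ((?E ** A) $ i $ j) * pf (act (?E ** A) (mat 1) M) i) =
        (\<Sum>i\<in>UNIV. \<Sum>l\<in>UNIV. mconst (A $ l $ j) * (mconst (?E $ i $ l) * pf (act ?E (mat 1) ?M) i))"
      by simp
    also have "\<dots> = (\<Sum>l\<in>UNIV. mconst (A $ l $ j) *
        (\<Sum>i\<in>UNIV. mconst (?E $ i $ l) * pf (act ?E (mat 1) ?M) i))"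
      unfolding sum_distrib_left by (rule sum.swap)
    also have "\<dots> = mconst (1 + u $ k) * (\<Sum>l\<in>UNIV. mconst (A $ l $ j) * pf ?M l)"
      unfolding pf_rank1 [OF alternating_act [OF assms(2)]]
      by (simp only: sum_distrib_left ac_simps)
    also have "\<dots> = mconst (det (?E ** A)) * pf M j"
      by (simp only: "2.IH" det_mul det_rank1_axis mconst_mult mult.assoc)
    finally show ?case .
  qed
qed

lemma pf_act_mat: "pf (act A (mat c) M) i = mconst (c ^ 2) * pf (act A (mat 1) M) i"
proof -
  have "linear_form (act A (mat c) M $ i $ j) = mconst c * linear_form (act A (mat 1) M $ i $ j)" for i j
    by (simp add: act_mat linear_form_scale [symmetric])
  then have *: "pf (act A (mat c) M) i =
      pfaff (\<lambda>i j. mconst c * linear_form (act A (mat 1) M $ i $ j)) i"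
    unfolding pf_eq_pfaff by simp
  show ?thesis
    unfolding *
    unfolding pf_eq_pfaff power2_eq_square mconst_mult
    by (cases i rule: exhaust_5) (simp_all add: pfaff_simps algebra_simps)
qed


subsection \<open>Coefficients of quadrics\<close>

definition mono2 :: "'v \<Rightarrow> 'v \<Rightarrow> 'v \<Rightarrow>\<^sub>0 nat" where
  "mono2 k l = Poly_Mapping.single k 1 + Poly_Mapping.single l 1"

text \<open>The coefficient at \<open>mono2 k l\<close> of the product of the linear forms with
  coefficient vectors \<open>x\<close> and \<open>y\<close>. Squares are treated apart, so that the
  diagonal coefficients are not lost in characteristic two.\<close>

definition sq :: "'a::comm_ring_1^'n \<Rightarrow> 'a^'n \<Rightarrow> 'n \<Rightarrow> 'n \<Rightarrow> 'a" where
  "sq x y k l = (if k = l then x $ k * y $ k else x $ k * y $ l + x $ l * y $ k)"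

lemma mono2_eq_iff: "mono2 i j = mono2 k l \<longleftrightarrow> i = k \<and> j = l \<or> i = l \<and> j = k"
proof
  assume "mono2 i j = mono2 k l"
  then have *: "Poly_Mapping.lookup (mono2 i j) x = Poly_Mapping.lookup (mono2 k l) x" for x
    by simp
  show "i = k \<and> j = l \<or> i = l \<and> j = k"
    using * [of i] * [of j] * [of k] * [of l]
    by (auto simp: mono2_def lookup_add lookup_single when_def split: if_splits)
qed (auto simp: mono2_def add.commute)

lemma lookup_mconst_mult: "Poly_Mapping.lookup (mconst c * f) m = c * Poly_Mapping.lookup f m"
  by (simp add: mult_map_scale_conv_mult [symmetric] Poly_Mapping.map.rep_eq when_def)

lemma linear_form_mult:
  "linear_form x * linear_form y = (\<Sum>i\<in>UNIV. \<Sum>j\<in>UNIV. Poly_Mapping.single (mono2 i j) (x $ i * y $ j))"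
  by (simp add: linear_form_def sum_product mult_single mono2_def)

lemma lookup_linear_form_mult:
  "Poly_Mapping.lookup (linear_form x * linear_form y) (mono2 k l) = sq x y k l"
proof -
  have "Poly_Mapping.lookup (linear_form x * linear_form y) (mono2 k l) =
      (\<Sum>i\<in>UNIV. \<Sum>j\<in>UNIV. if i = k \<and> j = l \<or> i = l \<and> j = k then x $ i * y $ j else 0)"
    by (simp add: linear_form_mult lookup_sum lookup_single mono2_eq_iff when_def)
  also have "\<dots> = (\<Sum>p\<in>UNIV \<times> UNIV. if p = (k, l) \<or> p = (l, k) then x $ fst p * y $ snd p else 0)"
    by (simp add: sum.cartesian_product case_prod_unfold prod_eq_iff)
  also have "\<dots> = (\<Sum>p\<in>{(k, l), (l, k)}. x $ fst p * y $ snd p)"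
    by (rule sum.mono_neutral_cong_right) auto
  also have "\<dots> = sq x y k l"
    by (auto simp: sq_def)
  finally show ?thesis .
qed

lemma linear_form_mult_support:
  "Poly_Mapping.lookup (linear_form x * linear_form y) m \<noteq> 0 \<Longrightarrow> \<exists>k l. m = mono2 k l"
proof (rule ccontr)
  assume *: "Poly_Mapping.lookup (linear_form x * linear_form y) m \<noteq> 0" "\<nexists>k l. m = mono2 k l"
  then have "mono2 k l \<noteq> m" for k l
    by blast
  with *(1) show False
    by (simp add: linear_form_mult lookup_sum lookup_single)
qed

definition pfc :: "'a::comm_ring_1 model \<Rightarrow> 5 \<Rightarrow> 5 \<Rightarrow> 5 \<Rightarrow> 'a" where
  "pfc M i k l = Poly_Mapping.lookup (pf M i) (mono2 k l)"

definition pfc4 :: "'a::comm_ring_1 model \<Rightarrow> 5 \<Rightarrow> 5 \<Rightarrow> 5 \<Rightarrow> 5 \<Rightarrow> 5 \<Rightarrow> 5 \<Rightarrow> 'a" where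
  "pfc4 M a b c d k l = sq (M $ a $ b) (M $ c $ d) k l - sq (M $ a $ c) (M $ b $ d) k l +
     sq (M $ a $ d) (M $ b $ c) k l"

lemma pf_support: "Poly_Mapping.lookup (pf M i) m \<noteq> 0 \<Longrightarrow> \<exists>k l. m = mono2 k l"
proof (rule ccontr)
  assume *: "Poly_Mapping.lookup (pf M i) m \<noteq> 0" "\<nexists>k l. m = mono2 k l"
  then have "Poly_Mapping.lookup (linear_form x * linear_form y) m = 0" for x y :: "'a^5"
    using linear_form_mult_support [of x y m] by blast
  then show False
    using *(1) by (auto simp: pf_def pf4_def lookup_add lookup_minus split: if_splits)
qed

lemma lookup_pf4: "Poly_Mapping.lookup (pf4 M a b c d) (mono2 k l) = pfc4 M a b c d k l"
  by (simp add: pf4_def pfc4_def lookup_add lookup_minus lookup_linear_form_mult)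

lemma pfc_simps:
  "pfc M 1 = pfc4 M 2 3 4 5" "pfc M 2 = (\<lambda>k l. - pfc4 M 1 3 4 5 k l)" "pfc M 3 = pfc4 M 1 2 4 5"
  by (simp_all add: fun_eq_iff pfc_def pf_def lookup_pf4 del: One_nat_def)

lemma pfc_act:
  fixes A :: "'k::field^5^5"
  assumes "invertible A" "alternating M"
  shows "(\<Sum>i\<in>UNIV. A $ i $ j * pfc (act A (mat 1) M) i k l) = det A * pfc M j k l"
  using arg_cong [OF pf_act [OF assms, of j], of "\<lambda>f. Poly_Mapping.lookup f (mono2 k l)"]
  by (simp add: lookup_sum lookup_mconst_mult pfc_def)

lemma permutation_5:
  assumes "distinct [a, b, c, d, e :: 5]"
  obtains p :: "5 \<Rightarrow> 5" where "inj p" "p 1 = a" "p 2 = b" "p 3 = c" "p 4 = d" "p 5 = e"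
proof -
  define p where "p i = (if i = 1 then a else if i = 2 then b else if i = 3 then c else
    if i = 4 then d else e)" for i :: 5
  have p: "p 1 = a" "p 2 = b" "p 3 = c" "p 4 = d" "p 5 = e"
    by (simp_all add: p_def)
  have "x = y" if "p x = p y" for x y
    using that assms by (cases x rule: exhaust_5; cases y rule: exhaust_5; simp add: p)
  then have "inj p"
    by (rule injI)
  then show ?thesis
    using p by (rule that)
qed

text \<open>The transformation law for a permutation matrix, whose determinant is a sign. It allows
  all later arguments to name the five indices in any convenient order.\<close>

lemma pfc_perm:
  fixes M :: "'k::field model"
  assumes M: "alternating M" and d: "distinct [a, b, c, d, e]"
  shows "\<exists>s\<in>{1, -1}. \<forall>k l. pfc M a k l = s * pfc4 M b c d e k l"
proof -
  obtain p :: "5 \<Rightarrow> 5" where "inj p" and p: "p 1 = a" "p 2 = b" "p 3 = c" "p 4 = d" "p 5 = e"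
    using d by (rule permutation_5) (rule that)
  from \<open>inj p\<close> have perm: "p permutes UNIV"
    using finite_UNIV_inj_surj [of p] by (intro bij_imp_permutes) (auto simp: bij_def)
  define A :: "'k^5^5" where "A = (\<chi> i. mat 1 $ p i)"
  have A: "A $ i = axis (p i) 1" for i
    by (simp add: A_def mat1_nth)
  have det: "det A = of_int (sign p)"
    unfolding A_def by (subst det_permute_rows [OF perm]) simp
  have sign: "sign p = 1 \<or> sign p = -1"
    by (simp add: sign_def)
  have inv: "invertible A"
    using sign by (auto simp: invertible_iff_det det)
  have act: "act A (mat 1) M $ i $ j = M $ p i $ p j" for i j
    by (simp add: act_nth A)
  have "det A * pfc M a k l = pfc4 M b c d e k l" for k l
  proof -
    have "det A * pfc M a k l = (\<Sum>i\<in>UNIV. A $ i $ a * pfc (act A (mat 1) M) i k l)"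
      using pfc_act [OF inv M, of a k l] by simp
    also have "\<dots> = (\<Sum>i\<in>UNIV. if i = 1 then pfc (act A (mat 1) M) i k l else 0)"
      using \<open>inj p\<close> p(1) by (intro sum.cong) (auto simp: A axis_def inj_def)
    also have "\<dots> = pfc4 M b c d e k l"
      by (simp add: pfc_simps pfc4_def act p)
    finally show ?thesis .
  qed
  then have "pfc M a k l = det A * pfc4 M b c d e k l" for k l
    using sign det by (metis minus_minus mult_1 mult_minus1 of_int_1 of_int_minus)
  then show ?thesis
    using sign det by auto
qed

section \<open>Quadratic relations between linear forms modulo an ideal\<close>

definition dot :: "'a::comm_ring_1^'n::finite \<Rightarrow> 'a^'n \<Rightarrow> 'a" where
  "dot f x = (\<Sum>k\<in>UNIV. f $ k * x $ k)"

definition vec_in :: "'a set \<Rightarrow> 'a^'n \<Rightarrow> bool" where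
  "vec_in S x \<longleftrightarrow> (\<forall>k. x $ k \<in> S)"

lemma vec_inD: "vec_in S x \<Longrightarrow> x $ k \<in> S"
  by (simp add: vec_in_def)

lemma dot_axis [simp]: "dot (axis k 1) x = x $ k"
  by (simp add: dot_def)

lemma dot_simps:
  "dot f (x + y) = dot f x + dot f y" "dot f (c *s x) = c * dot f x" "dot f (- x) = - dot f x"
  "dot f (x - y) = dot f x - dot f y" "dot f 0 = 0"
  by (simp_all add: dot_def algebra_simps sum.distrib sum_distrib_left sum_negf sum_subtractf)

lemma matrix_vector_dot: "(A *v x) $ i = dot (A $ i) x"
  by (simp add: matrix_vector_mult_def dot_def)

lemma sq_simps:
  "sq (x + y) z k l = sq x z k l + sq y z k l" "sq z (x + y) k l = sq z x k l + sq z y k l"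
  "sq (c *s x) z k l = c * sq x z k l" "sq z (c *s x) k l = c * sq z x k l"
  "sq (- x) z k l = - sq x z k l" "sq z (- x) k l = - sq z x k l"
  "sq (x - y) z k l = sq x z k l - sq y z k l" "sq z (x - y) k l = sq z x k l - sq z y k l"
  "sq 0 z k l = 0" "sq z 0 k l = 0"
  by (auto simp: sq_def algebra_simps)

context subring_ideal
begin

lemma vec_in_R: "vec_in I x \<Longrightarrow> vec_in R x"
  by (auto simp: vec_in_def)

lemma vec_in_axis [simp]: "vec_in R (axis k 1)"
  by (simp add: vec_in_def)

lemma vec_in_ops:
  "vec_in R x \<Longrightarrow> vec_in R y \<Longrightarrow> vec_in R (x + y)" "vec_in R x \<Longrightarrow> vec_in R y \<Longrightarrow> vec_in R (x - y)"
  "vec_in R x \<Longrightarrow> vec_in R (- x)" "c \<in> R \<Longrightarrow> vec_in R x \<Longrightarrow> vec_in R (c *s x)" "vec_in R 0"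
  "vec_in I x \<Longrightarrow> vec_in I y \<Longrightarrow> vec_in I (x + y)" "vec_in I x \<Longrightarrow> vec_in I y \<Longrightarrow> vec_in I (x - y)"
  "vec_in I x \<Longrightarrow> vec_in I (- x)" "c \<in> R \<Longrightarrow> vec_in I x \<Longrightarrow> vec_in I (c *s x)" "vec_in I 0"
  by (auto simp: vec_in_def)

lemma dot_R: "vec_in R f \<Longrightarrow> vec_in R x \<Longrightarrow> dot f x \<in> R"
  by (auto simp: dot_def vec_in_def)

lemma sq_R: "vec_in R x \<Longrightarrow> vec_in R y \<Longrightarrow> sq x y k l \<in> R"
  by (auto simp: sq_def vec_in_def)

lemma sq_I: "vec_in I x \<Longrightarrow> vec_in R y \<Longrightarrow> sq x y k l \<in> I" "vec_in R x \<Longrightarrow> vec_in I y \<Longrightarrow> sq x y k l \<in> I"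
  by (auto simp: sq_def vec_in_def)

text \<open>Diagonal terms lie in \<open>I\<close> on their own and off-diagonal terms pair up. Only
  \<open>T k k\<close> and \<open>T k l + T l k\<close> are controlled, never a single
  \<open>T k l\<close>.\<close>

lemma alternating_sum_in_I:
  assumes T: "\<And>k. T k k \<in> I" "\<And>k l. T k l + T l k \<in> I" and f: "\<And>k. f k \<in> R" and "finite S"
  shows "(\<Sum>k\<in>S. \<Sum>l\<in>S. f k * f l * T k l) \<in> I"
  using \<open>finite S\<close>
proof (induction S)
  case (insert a S)
  have "(\<Sum>k\<in>insert a S. \<Sum>l\<in>insert a S. f k * f l * T k l) =
      f a * f a * T a a + (\<Sum>l\<in>S. f a * f l * (T a l + T l a)) + (\<Sum>k\<in>S. \<Sum>l\<in>S. f k * f l * T k l)"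
    using insert.hyps by (simp add: sum.distrib algebra_simps)
  moreover have "f a * f a * T a a \<in> I"
    by (intro I_mult R_mult f T(1))
  moreover have "(\<Sum>l\<in>S. f a * f l * (T a l + T l a)) \<in> I"
    by (rule I_sum) (rule I_mult [OF R_mult [OF f f] T(2)])
  ultimately show ?case
    using insert.IH by (simp only:) (intro I_add)
qed simp

text \<open>
  A relation \<open>\<Sum>\<^sub>i x\<^sub>i y\<^sub>i = 0\<close> between products of linear forms says that the tensor
  \<open>\<Sum>\<^sub>i x\<^sub>i \<otimes> y\<^sub>i\<close> is alternating; it may therefore be contracted with two linear functionals, also in
  characteristic two.
\<close>
lemma contract:
  assumes rel: "\<And>k l. sq x1 y1 k l + sq x2 y2 k l + sq x3 y3 k l \<in> I"
    and "vec_in R f" "vec_in R g"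
  shows "dot f x1 * dot g y1 + dot g x1 * dot f y1 + (dot f x2 * dot g y2 + dot g x2 * dot f y2) +
    (dot f x3 * dot g y3 + dot g x3 * dot f y3) \<in> I"
    "dot f x1 * dot f y1 + dot f x2 * dot f y2 + dot f x3 * dot f y3 \<in> I"
proof -
  define T where "T k l = x1 $ k * y1 $ l + x2 $ k * y2 $ l + x3 $ k * y3 $ l" for k l
  have T1: "T k k \<in> I" for k
    using rel [of k k] by (simp add: sq_def T_def)
  have T2: "T k l + T l k \<in> I" for k l
  proof (cases "k = l")
    case True
    then show ?thesis using I_add [OF T1 T1, of l l] by simp
  next
    case False
    then show ?thesis
      using rel [of k l] by (simp add: sq_def T_def algebra_simps)
  qed
  have d: "dot f x * dot g y + dot g x * dot f y =
      (\<Sum>k\<in>UNIV. \<Sum>l\<in>UNIV. f $ k * g $ l * (x $ k * y $ l + x $ l * y $ k))" for x y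
    unfolding mult.commute [of "dot g x"]
    unfolding dot_def sum_product sum.distrib [symmetric]
    by (intro sum.cong refl) (simp add: algebra_simps)
  have "(\<Sum>k\<in>UNIV. \<Sum>l\<in>UNIV. f $ k * g $ l * (T k l + T l k)) \<in> I"
    using assms(2,3) T2 by (auto simp: vec_in_def intro!: I_sum I_mult)
  moreover have "(\<Sum>k\<in>UNIV. \<Sum>l\<in>UNIV. f $ k * g $ l * (T k l + T l k)) =
      dot f x1 * dot g y1 + dot g x1 * dot f y1 + (dot f x2 * dot g y2 + dot g x2 * dot f y2) +
      (dot f x3 * dot g y3 + dot g x3 * dot f y3)"
    unfolding d sum.distrib [symmetric] T_def
    by (intro sum.cong refl) (simp add: algebra_simps)
  ultimately show "dot f x1 * dot g y1 + dot g x1 * dot f y1 +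
      (dot f x2 * dot g y2 + dot g x2 * dot f y2) + (dot f x3 * dot g y3 + dot g x3 * dot f y3) \<in> I"
    by simp
  have e: "dot f x * dot f y = (\<Sum>k\<in>UNIV. \<Sum>l\<in>UNIV. f $ k * f $ l * (x $ k * y $ l))" for x y
    unfolding dot_def sum_product by (intro sum.cong refl) (simp add: algebra_simps)
  have "dot f x1 * dot f y1 + dot f x2 * dot f y2 + dot f x3 * dot f y3 =
      (\<Sum>k\<in>UNIV. \<Sum>l\<in>UNIV. f $ k * f $ l * T k l)"
    unfolding e sum.distrib [symmetric] T_def
    by (intro sum.cong refl) (simp add: algebra_simps)
  moreover have "(\<Sum>k\<in>UNIV. \<Sum>l\<in>UNIV. f $ k * f $ l * T k l) \<in> I"
    using T1 T2 assms(2) by (intro alternating_sum_in_I) (auto simp: vec_in_def)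
  ultimately show "dot f x1 * dot f y1 + dot f x2 * dot f y2 + dot f x3 * dot f y3 \<in> I"
    by simp
qed

text \<open>Since \<open>I\<close> need not be prime, a functional with value 1 on \<open>y\<close>
  replaces the domain property: contracting with \<open>f\<close> twice puts \<open>dot f x\<close>
  in \<open>I\<close>, and contracting with \<open>f\<close> and a coordinate then isolates each
  \<open>x $ k\<close>.\<close>

lemma sq_cancel:
  assumes rel: "\<And>k l. sq x y k l \<in> I" and f: "vec_in R f" "dot f y = 1" and y: "vec_in R y"
  shows "vec_in I x"
proof -
  have rel': "sq x y k l + sq 0 0 k l + sq 0 0 k l \<in> I" for k l
    using rel by (simp add: sq_simps)
  have 1: "dot f x \<in> I"
    using contract(2) [OF rel' f(1) f(1)] f(2) by (simp add: dot_simps)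
  have "x $ k \<in> I" for k
  proof -
    have "dot f x * y $ k + x $ k \<in> I"
      using contract(1) [OF rel' f(1), of "axis k 1"] f(2) by (simp add: dot_simps)
    then have "(dot f x * y $ k + x $ k) - dot f x * y $ k \<in> I"
      using 1 y by (intro I_diff I_mult') (auto simp: vec_in_def)
    then show ?thesis by simp
  qed
  then show ?thesis by (simp add: vec_in_def)
qed

text \<open>Exactness of the Koszul complex of \<open>a\<close>, \<open>b\<close>, \<open>c\<close>.
  Contracting with one dual functional twice removes the diagonal coefficients of the syzygy, and
  mixed contractions match the others in pairs. If \<open>a\<close>, \<open>b\<close>,
  \<open>c\<close> are the entries (3,4), (3,5), (4,5) of a model and \<open>x3\<close>,
  \<open>x4\<close>, \<open>x5\<close> those of a further row, the conclusion says that adding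
  \<open>w3\<close>, \<open>w4\<close>, \<open>w5\<close> times rows 3, 4, 5 to that row clears them
  modulo \<open>I\<close>.\<close>

lemma koszul:
  assumes rel: "\<And>k l. sq x3 c k l - sq x4 b k l + sq x5 a k l \<in> I"
    and R: "vec_in R x3" "vec_in R x4" "vec_in R x5" "vec_in R a" "vec_in R b" "vec_in R c"
    and f: "vec_in R fa" "vec_in R fb" "vec_in R fc"
    and dual: "dot fa a = 1" "dot fa b = 0" "dot fa c = 0" "dot fb a = 0" "dot fb b = 1"
      "dot fb c = 0" "dot fc a = 0" "dot fc b = 0" "dot fc c = 1"
  shows "\<exists>w3\<in>R. \<exists>w4\<in>R. \<exists>w5\<in>R. vec_in I (x3 - w4 *s a - w5 *s b) \<and>
    vec_in I (x4 + w3 *s a - w5 *s c) \<and> vec_in I (x5 + w3 *s b + w4 *s c)"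
proof -
  have rel': "sq x3 c k l + sq (- x4) b k l + sq x5 a k l \<in> I" for k l
    using rel by (simp add: sq_simps)
  note ct = contract [OF rel']
  have cc: "dot fc x3 \<in> I" and bb: "- dot fb x4 \<in> I" and aa: "dot fa x5 \<in> I"
    using ct(2) [OF f(3) f(3)] ct(2) [OF f(2) f(2)] ct(2) [OF f(1) f(1)] dual
    by (simp_all add: dot_simps)
  have cb: "dot fb x3 - dot fc x4 \<in> I" and ca: "dot fa x3 + dot fc x5 \<in> I"
    and ba: "dot fb x5 - dot fa x4 \<in> I"
    using ct(1) [OF f(3) f(2)] ct(1) [OF f(3) f(1)] ct(1) [OF f(2) f(1)] dual
    by (simp_all add: dot_simps)
  have k: "dot fc x3 * c $ k + x3 $ k - dot fc x4 * b $ k + dot fc x5 * a $ k \<in> I"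
    "dot fb x3 * c $ k - dot fb x4 * b $ k - x4 $ k + dot fb x5 * a $ k \<in> I"
    "dot fa x3 * c $ k - dot fa x4 * b $ k + dot fa x5 * a $ k + x5 $ k \<in> I" for k
    using ct(1) [OF f(3), of "axis k 1"] ct(1) [OF f(2), of "axis k 1"] ct(1) [OF f(1), of "axis k 1"] dual
    by (simp_all add: dot_simps algebra_simps)
  note abc = vec_inD [OF R(4)] vec_inD [OF R(5)] vec_inD [OF R(6)]
  have 1: "x3 $ k - (- dot fc x5) * a $ k - dot fc x4 * b $ k \<in> I" for k
    using I_diff [OF k(1) I_mult' [OF cc abc(3)], of k k] by (simp add: algebra_simps)
  have 2: "x4 $ k + (- dot fb x5) * a $ k - dot fc x4 * c $ k \<in> I" for k
    using I_add [OF I_diff [OF I_mult' [OF cb abc(3)] k(2)] I_mult' [OF bb abc(2)], of k k k]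
    by (simp add: algebra_simps)
  have 3: "x5 $ k + (- dot fb x5) * b $ k + (- dot fc x5) * c $ k \<in> I" for k
    using I_diff [OF I_diff [OF I_diff [OF k(3) I_mult' [OF ca abc(3)]] I_mult' [OF ba abc(2)]]
        I_mult' [OF aa abc(1)], of k k k k]
    by (simp add: algebra_simps)
  have "- dot fb x5 \<in> R" "- dot fc x5 \<in> R" "dot fc x4 \<in> R"
    using R f by (auto intro!: dot_R)
  with 1 2 3 show ?thesis
    by (intro bexI [of _ "- dot fb x5"] bexI [of _ "- dot fc x5"] bexI [of _ "dot fc x4"])
      (auto simp: vec_in_def)
qed

end

context local_subring
begin

definition independent3 :: "'k^'n \<Rightarrow> 'k^'n \<Rightarrow> 'k^'n \<Rightarrow> bool" where
  "independent3 a b c \<longleftrightarrow> (\<forall>r\<in>R. \<forall>s\<in>R. \<forall>t\<in>R.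
     vec_in I (r *s a + s *s b + t *s c) \<longrightarrow> r \<in> I \<and> s \<in> I \<and> t \<in> I)"

lemma cancel_unit: "x \<in> R \<Longrightarrow> x \<notin> I \<Longrightarrow> y \<in> R \<Longrightarrow> x * y \<in> I \<Longrightarrow> y \<in> I"
  using I_mult [OF inverse_R [of x], of "x * y"] I_0 by (metis left_inverse mult.assoc mult_1)

text \<open>Rows of the matrix from \<open>reduce_independent\<close>. Independence is assumed only
  modulo the maximal ideal, but the values are exact, so the functionals remain dual modulo every
  power of \<pi>.\<close>

lemma dual3:
  fixes a b c :: "'k^5"
  assumes R: "vec_in R a" "vec_in R b" "vec_in R c" and ind: "independent3 a b c"
  obtains fa fb fc where "vec_in R fa" "vec_in R fb" "vec_in R fc"
    "dot fa a = 1" "dot fa b = 0" "dot fa c = 0" "dot fb a = 0" "dot fb b = 1"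
    "dot fb c = 0" "dot fc a = 0" "dot fc b = 0" "dot fc c = 1"
proof -
  define t where "t i = (if i = 1 then a else if i = 2 then b else c)" for i :: 5
  have t: "t 1 = a" "t 2 = b" "t 3 = c"
    by (simp_all add: t_def)
  have "\<exists>G\<in>GL_over R. generated G \<and> (\<forall>j\<in>{1, 2, 3}. G *v t j = axis j 1)"
  proof (rule reduce_independent)
    show "t j $ k \<in> R" for j k
      using R by (auto simp: t_def vec_in_def)
    fix w assume "\<And>j. j \<in> {1, 2, 3 :: 5} \<Longrightarrow> w j \<in> R" "\<And>k. (\<Sum>j\<in>{1, 2, 3}. w j * t j $ k) \<in> I"
    then have "w 1 \<in> R" "w 2 \<in> R" "w 3 \<in> R" "vec_in I (w 1 *s a + w 2 *s b + w 3 *s c)"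
      by (simp_all add: t vec_in_def add.assoc)
    then show "\<forall>j\<in>{1, 2, 3}. w j \<in> I"
      using ind by (auto simp: independent3_def)
  qed
  then obtain G where G: "G \<in> GL_over R" "G *v a = axis 1 1" "G *v b = axis 2 1" "G *v c = axis 3 1"
    by (auto simp: t)
  have "dot (G $ i) a = axis 1 1 $ i" "dot (G $ i) b = axis 2 1 $ i" "dot (G $ i) c = axis 3 1 $ i" for i
    by (simp_all add: matrix_vector_dot [symmetric] G)
  moreover have "vec_in R (G $ i)" for i
    using GL_entry [OF G(1)] by (simp add: vec_in_def)
  ultimately show ?thesis
    by (intro that [of "G $ 1" "G $ 2" "G $ 3"]) (simp_all add: axis_def)
qed

lemma dual1:
  assumes "vec_in R a" "\<not> vec_in I a"
  obtains f where "vec_in R f" "dot f a = 1"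
proof -
  obtain k where k: "a $ k \<notin> I" "a $ k \<noteq> 0"
    using assms(2) I_0 unfolding vec_in_def by metis
  then have "vec_in R (inverse (a $ k) *s axis k 1)"
    using assms(1) inverse_R by (intro vec_in_ops) (auto simp: vec_in_def)
  moreover have "dot (inverse (a $ k) *s axis k 1) a = 1"
    using k by (simp add: dot_def mult.assoc sum_distrib_left [symmetric])
  ultimately show ?thesis using that by blast
qed

lemma sq_domain:
  assumes "\<And>k l. sq x y k l \<in> I" "vec_in R y"
  shows "vec_in I x \<or> vec_in I y"
  using dual1 sq_cancel assms by metis

text \<open>Two elimination steps by hand, in any number of variables: \<open>b'\<close> is
  \<open>b\<close> with its \<open>a\<close> component removed, and \<open>g\<close> and
  \<open>f\<close> are then corrected to vanish on \<open>a\<close> and \<open>b\<close>.\<close>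

lemma dual2:
  fixes a b :: "'k^'n::finite"
  assumes R: "vec_in R a" "vec_in R b"
    and ind: "\<And>s t. s \<in> R \<Longrightarrow> t \<in> R \<Longrightarrow> vec_in I (s *s a + t *s b) \<Longrightarrow> s \<in> I \<and> t \<in> I"
  obtains f g where "vec_in R f" "vec_in R g" "dot f a = 1" "dot f b = 0" "dot g a = 0" "dot g b = 1"
proof -
  have "\<not> vec_in I a"
    using ind [of 1 0] one_notin_I by auto
  then obtain f where f: "vec_in R f" "dot f a = 1"
    using dual1 R by blast
  define b' where "b' = b - dot f b *s a"
  have fb: "dot f b \<in> R"
    using f R by (auto intro: dot_R)
  have b': "vec_in R b'"
    unfolding b'_def using fb R by (intro vec_in_ops)
  have "\<not> vec_in I b'"
    using ind [of "- dot f b" 1] fb one_notin_I by (auto simp: b'_def)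
  then obtain g where g: "vec_in R g" "dot g b' = 1"
    using dual1 b' by blast
  define g' where "g' = g - dot g a *s f"
  have dot_left: "dot (x - c *s y) z = dot x z - c * dot y z" for x y z :: "'k^'n" and c
    by (simp add: dot_def algebra_simps sum_subtractf sum_distrib_left)
  have g': "vec_in R g'" "dot g' a = 0" "dot g' b = 1"
    unfolding g'_def using g f R
    by (auto intro!: vec_in_ops dot_R simp: dot_left b'_def dot_simps)
      (simp add: algebra_simps)
  have "vec_in R (f - dot f b *s g')" "dot (f - dot f b *s g') a = 1" "dot (f - dot f b *s g') b = 0"
    using f fb g' by (auto intro!: vec_in_ops simp: dot_left)
  with g' show ?thesis using that by blast
qed

text \<open>A 2 x 2 matrix of linear forms over a field with zero determinant has proportional rows
  or proportional columns. The four alternatives also record which of the two is the multiple. If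
  \<open>a\<close> and \<open>b\<close> are independent, contraction shows that the second row is a
  multiple of the first; otherwise the columns are proportional or the first row vanishes.\<close>

lemma rank_one_2x2:
  fixes a b c d :: "'k^'n::finite"
  assumes rel: "\<And>k l. sq a d k l - sq b c k l \<in> I"
    and R: "vec_in R a" "vec_in R b" "vec_in R c" "vec_in R d"
  shows "\<exists>t\<in>R. vec_in I (a + t *s c) \<and> vec_in I (b + t *s d) \<or>
    vec_in I (c + t *s a) \<and> vec_in I (d + t *s b) \<or>
    vec_in I (a + t *s b) \<and> vec_in I (c + t *s d) \<or>
    vec_in I (b + t *s a) \<and> vec_in I (d + t *s c)"
proof (cases "\<exists>s\<in>R. \<exists>t\<in>R. vec_in I (s *s a + t *s b) \<and> \<not> (s \<in> I \<and> t \<in> I)")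
  case True
  then obtain s t where st: "s \<in> R" "t \<in> R" "vec_in I (s *s a + t *s b)" "s \<notin> I \<or> t \<notin> I"
    by blast
  have zero: ?thesis if "vec_in I a" "vec_in I b"
    using that by (intro bexI [of _ 0]) auto
  show ?thesis
  proof (cases "s \<in> I")
    case False
    then have s: "inverse s \<in> R" "s \<noteq> 0"
      using st inverse_R I_0 by metis+
    define r where "r = inverse s * t"
    have r: "r \<in> R" using s st by (auto simp: r_def)
    have "vec_in I (inverse s *s (s *s a + t *s b))"
      using s(1) st(3) by (rule vec_in_ops(9))
    then have ab: "vec_in I (a + r *s b)"
      using s by (simp add: r_def vector_add_ldistrib vector_smult_assoc)
    \<comment> \<open>Substituting a = - r b turns a d - b c into - b (c + r d).\<close>
    have "sq b (c + r *s d) k l \<in> I" for k l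
      using I_diff [OF sq_I(1) [OF ab R(4)] rel, of k l k l] by (simp add: sq_simps algebra_simps)
    then have "vec_in I b \<or> vec_in I (c + r *s d)"
      using r R by (intro sq_domain vec_in_ops)
    moreover have "vec_in I a" if "vec_in I b"
      using vec_in_ops(7) [OF ab vec_in_ops(9) [OF r that]] by simp
    ultimately show ?thesis
      using zero ab r by blast
  next
    case True
    then have s: "inverse t \<in> R" "t \<noteq> 0"
      using st inverse_R I_0 by metis+
    define r where "r = inverse t * s"
    have r: "r \<in> R" using s st by (auto simp: r_def)
    have "vec_in I (inverse t *s (s *s a + t *s b))"
      using s(1) st(3) by (rule vec_in_ops(9))
    then have ab: "vec_in I (b + r *s a)"
      using s by (simp add: r_def vector_add_ldistrib vector_smult_assoc add.commute)
    have "sq a (d + r *s c) k l \<in> I" for k l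
      using I_add [OF sq_I(1) [OF ab R(3)] rel, of k l k l] by (simp add: sq_simps algebra_simps)
    then have "vec_in I a \<or> vec_in I (d + r *s c)"
      using r R by (intro sq_domain vec_in_ops)
    moreover have "vec_in I b" if "vec_in I a"
      using vec_in_ops(7) [OF ab vec_in_ops(9) [OF r that]] by simp
    ultimately show ?thesis
      using zero ab r by blast
  qed
next
  case False
  then obtain f g where f: "vec_in R f" "vec_in R g"
    and dual: "dot f a = 1" "dot f b = 0" "dot g a = 0" "dot g b = 1"
    using dual2 [OF R(1,2)] by metis
  have rel': "sq a d k l + sq (- b) c k l + sq 0 0 k l \<in> I" for k l
    using rel by (simp add: sq_simps)
  note ct = contract [OF rel']
  have ff: "dot f d \<in> I" and gg: "- dot g c \<in> I" and fg: "dot g d - dot f c \<in> I"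
    using ct(2) [OF f(1) f(1)] ct(2) [OF f(2) f(2)] ct(1) [OF f] dual by (simp_all add: dot_simps)
  have k: "d $ k + a $ k * dot f d - b $ k * dot f c \<in> I"
    "a $ k * dot g d - c $ k - b $ k * dot g c \<in> I" for k
    using ct(1) [OF f(1), of "axis k 1"] ct(1) [OF f(2), of "axis k 1"] dual
    by (simp_all add: dot_simps algebra_simps)
  have "d $ k + (- dot f c) * b $ k \<in> I" for k
    using I_diff [OF k(1) I_mult [OF vec_inD [OF R(1)] ff], of k k] by (simp add: algebra_simps)
  moreover have "c $ k + (- dot f c) * a $ k \<in> I" for k
    using I_add [OF I_diff [OF I_mult [OF vec_inD [OF R(1)] fg] k(2)] I_mult [OF vec_inD [OF R(2)] gg], of k k k]
    by (simp add: algebra_simps)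
  moreover have "- dot f c \<in> R"
    using f R by (auto intro!: dot_R)
  ultimately show ?thesis
    by (intro bexI [of _ "- dot f c"]) (auto simp: vec_in_def)
qed

end

section \<open>Stable models over a local ring\<close>

text \<open>Pfaffians transform contragrediently, and the determinant is one here: adding multiples
  of row \<open>a\<close> to the other rows changes the Pfaffian \<open>a\<close> alone.\<close>

lemma pfc_row_operation:
  fixes M :: "'k::field model"
  assumes M: "alternating M" and u: "u $ a = 0"
  shows "pfc (act (rank1 u (axis a 1)) (mat 1) M) j k l =
    pfc M j k l - (if j = a then \<Sum>i\<in>UNIV. u $ i * pfc M i k l else 0)"
proof -
  let ?E = "rank1 u (axis a 1)"
  let ?p = "\<lambda>j. pfc (act ?E (mat 1) M) j k l"
  have det: "det ?E = 1"
    using u by (simp add: det_rank1_axis)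
  then have inv: "invertible ?E"
    by (simp add: invertible_iff_det)
  have *: "(\<Sum>i\<in>UNIV. (mat 1 $ i $ j + u $ i * axis a 1 $ j) * ?p i) = pfc M j k l" for j
    using pfc_act [OF inv M, of j k l] det by (simp add: rank1_def)
  have 1: "?p j = pfc M j k l" if "j \<noteq> a" for j
    using * [of j] that by (simp add: axis_def)
  have "?p a + (\<Sum>i\<in>UNIV. u $ i * ?p i) = pfc M a k l"
    using * [of a] by (simp add: distrib_right sum.distrib)
  moreover have "(\<Sum>i\<in>UNIV. u $ i * ?p i) = (\<Sum>i\<in>UNIV. u $ i * pfc M i k l)"
    using u 1 by (intro sum.cong) (metis mult_zero_left)+
  ultimately show ?thesis
    using 1 by (auto simp: algebra_simps)
qed

lemma complete_distinct:
  assumes "distinct [a, d, e :: 5]"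
  obtains b c where "distinct [a, b, c, d, e]"
proof -
  have "card (UNIV - {a, d, e}) = 2"
    using assms by (subst card_Diff_subset) auto
  then obtain b c where "UNIV - {a, d, e} = {b, c}" "b \<noteq> c"
    by (auto simp: card_2_iff)
  then have "b \<notin> {a, d, e}" "c \<notin> {a, d, e}" "b \<noteq> c"
    by blast+
  then show ?thesis
    using assms by (intro that [of b c]) auto
qed

lemma exists_distinct:
  obtains b c d e where "distinct [a :: 5, b, c, d, e]"
proof -
  have "\<exists>d e. distinct [a, d, e]"
  proof (cases "a = 1 \<or> a = 2")
    case True
    then have "distinct [a, 3, 4]" by auto
    then show ?thesis by blast
  next
    case False
    then have "distinct [a, 1, 2]" by auto
    then show ?thesis by blast
  qed
  then show ?thesis
    using complete_distinct that by metis
qed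

context subring_ideal
begin

definition int_model :: "'k model \<Rightarrow> bool" where
  "int_model M \<longleftrightarrow> alternating M \<and> (\<forall>i j. vec_in R (M $ i $ j))"

definition zero_block :: "'k model \<Rightarrow> 5 \<Rightarrow> 5 \<Rightarrow> 5 \<Rightarrow> bool" where
  "zero_block M x y z \<longleftrightarrow> vec_in I (M $ x $ y) \<and> vec_in I (M $ x $ z) \<and> vec_in I (M $ y $ z)"

lemma int_model_alternating: "int_model M \<Longrightarrow> alternating M"
  and int_model_vec_in: "int_model M \<Longrightarrow> vec_in R (M $ i $ j)"
  by (simp_all add: int_model_def)

lemma form_in:
  assumes "\<And>i j. vec_in S (M $ i $ j)" "vec_in R x" "vec_in R y" "S = R \<or> S = I"
  shows "vec_in S (form M x y)"
  using assms(4)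
proof
  assume S: "S = R"
  show ?thesis
    using assms(1-3) unfolding S vec_in_def form_nth by (intro allI R_sum R_mult) auto
next
  assume S: "S = I"
  show ?thesis
    using assms(1-3) unfolding S vec_in_def form_nth by (intro allI I_sum I_mult R_mult) auto
qed

lemma int_model_act:
  assumes "int_model M" "\<And>i j. A $ i $ j \<in> R"
  shows "int_model (act A (mat 1) M)"
proof -
  have "vec_in R (act A (mat 1) M $ i $ j)" for i j
    using assms by (auto simp: act_nth int_model_def vec_in_def intro!: form_in [unfolded vec_in_def, rule_format])
  then show ?thesis
    using assms alternating_act by (auto simp: int_model_def)
qed

lemma vec_in_flip: "alternating M \<Longrightarrow> vec_in I (M $ i $ j) \<Longrightarrow> vec_in I (M $ j $ i)"
  using alternating_nth(2) [of M j i] vec_in_ops(8) [of "M $ i $ j"] by simp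

lemma pfc4_in_I:
  assumes "int_model M" "distinct [a, b, c, d, e]" "\<And>k l. pfc M a k l \<in> I"
  shows "pfc4 M b c d e k l \<in> I"
proof -
  obtain s where s: "s \<in> {1, -1}" "pfc M a k l = s * pfc4 M b c d e k l"
    using pfc_perm [OF int_model_alternating assms(2)] assms(1) by blast
  then have "pfc4 M b c d e k l = s * pfc M a k l"
    by auto
  moreover have "s * pfc M a k l \<in> I"
    using s(1) assms(3) I_uminus by auto
  ultimately show ?thesis
    by simp
qed

lemma pfc_in_I:
  assumes "int_model M" "distinct [a, b, c, d, e]" "\<And>k l. pfc4 M b c d e k l \<in> I"
  shows "pfc M a k l \<in> I"
proof -
  obtain s where s: "s \<in> {1, -1}" "pfc M a k l = s * pfc4 M b c d e k l"
    using pfc_perm [OF int_model_alternating assms(2)] assms(1) by blast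
  then show ?thesis
    using s assms(3) I_uminus by auto
qed

lemma pf_in_R:
  assumes "int_model M"
  shows "Poly_Mapping.lookup (pf M i) m \<in> R"
proof (cases "Poly_Mapping.lookup (pf M i) m = 0")
  case False
  then obtain k l where m: "m = mono2 k l"
    using pf_support by blast
  obtain b c d e where d: "distinct [i, b, c, d, e]"
    using exists_distinct by blast
  have "pfc4 M b c d e k l \<in> R"
    unfolding pfc4_def using assms by (intro R_add R_diff sq_R int_model_vec_in)
  then have "pfc M i k l \<in> R"
    using pfc_perm [OF int_model_alternating [OF assms] d] R_uminus by auto
  then show ?thesis
    by (simp add: m pfc_def)
qed simp

text \<open>Column \<open>a\<close> of \<open>A\<close> is a basis vector, so component
  \<open>a\<close> of the transformation law involves no other Pfaffian.\<close>

lemma pfc_act_fixed: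
  assumes "A \<in> GL_over R" "A *v axis a 1 = axis a 1" "int_model M" "\<And>k l. pfc M a k l \<in> I"
  shows "pfc (act A (mat 1) M) a k l \<in> I"
proof -
  have "A $ i $ a = axis a 1 $ i" for i
    using arg_cong [OF assms(2), of "\<lambda>x. x $ i"] by (simp add: matrix_vector_mult_def)
  then have "pfc (act A (mat 1) M) a k l = det A * pfc M a k l"
    using pfc_act [OF GL_over_invertible int_model_alternating, OF assms(1,3), of a k l] by simp
  then show ?thesis
    using I_mult [OF det_in_R [OF GL_entry [OF assms(1)]] assms(4)] by simp
qed

lemma GL_row_operation:
  assumes "vec_in R u" "u $ i = 0"
  shows "rank1 u (axis i 1) \<in> GL_over R"
  using assms by (intro GL_rank1) (auto simp: vec_in_def)

text \<open>The alternatives correspond to the two families of planes on the Klein quadric: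
  alternating forms in four variables divisible by a fixed linear form (zero block), or sharing a
  kernel vector (a row that is zero outside column \<open>a\<close>). The base change fixes the
  basis vector \<open>a\<close> so that \<open>pfc_act_fixed\<close> keeps the Pfaffian
  \<open>a\<close> in \<open>I\<close>.\<close>

definition degenerate4 :: "5 \<Rightarrow> 'k model \<Rightarrow> bool" where
  "degenerate4 a M \<longleftrightarrow> (\<exists>A\<in>GL_over R. A *v axis a 1 = axis a 1 \<and>
     ((\<exists>x y z. distinct [x, y, z] \<and> zero_block (act A (mat 1) M) x y z) \<or>
      (\<exists>x y z w. distinct [a, x, y, z, w] \<and> vec_in I (act A (mat 1) M $ x $ y) \<and>
        vec_in I (act A (mat 1) M $ x $ z) \<and> vec_in I (act A (mat 1) M $ x $ w))))"

lemma degenerate4_block: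
  assumes "distinct [x, y, z]" "zero_block M x y z"
  shows "degenerate4 a M"
proof -
  have "\<exists>x y z. distinct [x, y, z] \<and> zero_block (act (mat 1) (mat 1) M) x y z"
    unfolding act_one using assms by blast
  then show ?thesis
    unfolding degenerate4_def by (intro bexI [OF _ GL_mat1] conjI disjI1) simp_all
qed

lemma degenerate4_kernel:
  assumes "distinct [a, x, y, z, w]" "vec_in I (M $ x $ y)" "vec_in I (M $ x $ z)"
    "vec_in I (M $ x $ w)"
  shows "degenerate4 a M"
proof -
  have "\<exists>x y z w. distinct [a, x, y, z, w] \<and> vec_in I (act (mat 1) (mat 1) M $ x $ y) \<and>
      vec_in I (act (mat 1) (mat 1) M $ x $ z) \<and> vec_in I (act (mat 1) (mat 1) M $ x $ w)"
    unfolding act_one using assms by blast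
  then show ?thesis
    unfolding degenerate4_def by (intro bexI [OF _ GL_mat1] conjI disjI2) simp_all
qed

lemma degenerate4_row_operation:
  assumes u: "vec_in R u" "u $ i = 0" "a \<noteq> i"
    and "degenerate4 a (act (rank1 u (axis i 1)) (mat 1) M)"
  shows "degenerate4 a M"
proof -
  let ?E = "rank1 u (axis i 1)"
  have E: "?E *v axis a 1 = axis a 1"
    using u(3) axis_nth_neq [of a i "1::'k"] by (simp add: rank1_axis_mult_vec)
  have *: "act A (mat 1) (act ?E (mat 1) M) = act (A ** ?E) (mat 1) M" for A
    by (simp add: act_act)
  obtain A where A: "A \<in> GL_over R" "A *v axis a 1 = axis a 1"
    "(\<exists>x y z. distinct [x, y, z] \<and> zero_block (act (A ** ?E) (mat 1) M) x y z) \<or>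
     (\<exists>x y z w. distinct [a, x, y, z, w] \<and> vec_in I (act (A ** ?E) (mat 1) M $ x $ y) \<and>
        vec_in I (act (A ** ?E) (mat 1) M $ x $ z) \<and> vec_in I (act (A ** ?E) (mat 1) M $ x $ w))"
    using assms(4) unfolding degenerate4_def * by blast
  moreover have "(A ** ?E) *v axis a 1 = axis a 1"
    using A(2) E by (simp add: matrix_vector_mul_assoc [symmetric])
  moreover have "A ** ?E \<in> GL_over R"
    using A(1) u by (intro GL_mult GL_row_operation)
  ultimately show ?thesis
    unfolding degenerate4_def by blast
qed

end

context local_subring
begin

text \<open>A unit coefficient in the entry (d, e) makes \<open>d\<close>, \<open>e\<close> a
  hyperbolic pair that clears one variable from the entries joining them to \<open>b\<close>,
  \<open>c\<close>. The Pfaffian then forces the entry (b, c) into \<open>I\<close>, and a 2 x 2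
  determinant remains: proportional rows lead to a zero row, proportional columns to a zero
  block.\<close>

lemma degenerate4_unit:
  assumes M: "int_model M" and dist: "distinct [a, b, c, d, e]" and p: "\<And>k l. pfc M a k l \<in> I"
    and unit: "M $ d $ e $ k \<notin> I"
  shows "degenerate4 a M"
proof -
  let ?q = "M $ d $ e $ k"
  have MR: "M $ i $ j $ l \<in> R" for i j l
    using int_model_vec_in [OF M] by (simp add: vec_in_def)
  have q: "?q \<noteq> 0" "inverse ?q \<in> R"
    using unit inverse_R [OF MR] I_0 by metis+
  \<comment> \<open>Multiples of row \<open>d\<close> clear the coefficient \<open>k\<close> in
    column \<open>e\<close>, and multiples of row \<open>e\<close> clear it in column
    \<open>d\<close>; the signs differ because \<open>M $ e $ d\<close> is the negative of
    \<open>M $ d $ e\<close>.\<close>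
  define x where "x = - inverse ?q *s (M $ b $ e $ k *s axis b 1 + M $ c $ e $ k *s axis c 1)"
  define y where "y = inverse ?q *s (M $ b $ d $ k *s axis b 1 + M $ c $ d $ k *s axis c 1)"
  have xy: "vec_in R x" "vec_in R y"
    unfolding x_def y_def using q MR by (auto intro!: vec_in_ops)
  have x: "x $ b = - inverse ?q * M $ b $ e $ k" "x $ c = - inverse ?q * M $ c $ e $ k"
    "x $ d = 0" "x $ e = 0"
    and y: "y $ b = inverse ?q * M $ b $ d $ k" "y $ c = inverse ?q * M $ c $ d $ k"
    "y $ d = 0" "y $ e = 0"
    using dist by (auto simp: x_def y_def axis_def)
  define M1 where "M1 = act (rank1 x (axis d 1)) (mat 1) M"
  define M2 where "M2 = act (rank1 y (axis e 1)) (mat 1) M1"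
  have int1: "int_model M1"
    unfolding M1_def by (intro int_model_act M GL_entry GL_row_operation xy x)
  have int2: "int_model M2"
    unfolding M2_def by (intro int_model_act int1 GL_entry GL_row_operation xy y)
  note alt = int_model_alternating [OF M] int_model_alternating [OF int1]
    int_model_alternating [OF int2]
  note R2 = int_model_vec_in [OF int2]
  have M1: "M1 $ i $ j = M $ i $ j + x $ i *s M $ d $ j + x $ j *s M $ i $ d" for i j
    unfolding M1_def by (rule act_rank1_axis_nth [OF alt(1)])
  have M2: "M2 $ i $ j = M1 $ i $ j + y $ i *s M1 $ e $ j + y $ j *s M1 $ i $ e" for i j
    unfolding M2_def by (rule act_rank1_axis_nth [OF alt(2)])
  have neg: "M $ e $ d = - M $ d $ e"
    by (rule alternating_nth(2) [OF alt(1)])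
  have zero: "M2 $ b $ d $ k = 0" "M2 $ c $ d $ k = 0" "M2 $ b $ e $ k = 0" "M2 $ c $ e $ k = 0"
    and de: "M2 $ d $ e = M $ d $ e"
    using q by (simp_all add: M1 M2 x y neg alternating_nth(1) [OF alt(1)] alternating_nth(1) [OF alt(2)])
  have "pfc M1 a k l \<in> I" for k l
    unfolding M1_def using dist axis_nth_neq [of a d "1::'k"]
    by (intro pfc_act_fixed M p GL_row_operation xy x) (simp add: rank1_axis_mult_vec)
  then have p2: "pfc M2 a k l \<in> I" for k l
    unfolding M2_def using dist axis_nth_neq [of a e "1::'k"]
    by (intro pfc_act_fixed int1 GL_row_operation xy y) (simp add: rank1_axis_mult_vec)
  have p4: "sq (M2 $ b $ c) (M2 $ d $ e) k l - sq (M2 $ b $ d) (M2 $ c $ e) k l +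
     sq (M2 $ b $ e) (M2 $ c $ d) k l \<in> I" for k l
    using pfc4_in_I [OF int2 dist p2] by (simp add: pfc4_def)
  have R2k: "M2 $ i $ j $ l \<in> R" for i j l
    using R2 by (simp add: vec_in_def)
  \<comment> \<open>Among the entries of this Pfaffian the variable \<open>k\<close> now occurs only
    in (b, c) and (d, e). The coefficient of its square gives the entry \<open>k\<close> of (b, c),
    and the mixed coefficients then give the other entries.\<close>
  have "M2 $ b $ c $ k * ?q \<in> I"
    using p4 [of k k] zero de by (simp add: sq_def)
  then have bck: "M2 $ b $ c $ k \<in> I"
    using cancel_unit [OF MR unit] R2k by (metis mult.commute)
  have "M2 $ b $ c $ l \<in> I" for l
  proof (cases "l = k")
    case False
    then have "M2 $ b $ c $ k * M $ d $ e $ l + M2 $ b $ c $ l * ?q \<in> I"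
      using p4 [of k l] zero de by (simp add: sq_def)
    then have "(M2 $ b $ c $ k * M $ d $ e $ l + M2 $ b $ c $ l * ?q) - M2 $ b $ c $ k * M $ d $ e $ l \<in> I"
      using bck MR by blast
    then show ?thesis
      using cancel_unit [OF MR unit R2k, of b c l] by (simp add: mult.commute)
  qed (use bck in simp)
  then have bc: "vec_in I (M2 $ b $ c)"
    by (simp add: vec_in_def)
  then have cb: "vec_in I (M2 $ c $ b)"
    using vec_in_flip [OF alt(3)] by blast
  have "sq (M2 $ b $ d) (M2 $ c $ e) k l - sq (M2 $ b $ e) (M2 $ c $ d) k l \<in> I" for k l
    using I_diff [OF sq_I(1) [OF bc R2] p4, of d e k l k l] by (simp add: algebra_simps)
  from rank_one_2x2 [OF this R2 R2 R2 R2]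
  obtain t where t: "t \<in> R" and cases:
    "vec_in I (M2 $ b $ d + t *s M2 $ c $ d) \<and> vec_in I (M2 $ b $ e + t *s M2 $ c $ e) \<or>
     vec_in I (M2 $ c $ d + t *s M2 $ b $ d) \<and> vec_in I (M2 $ c $ e + t *s M2 $ b $ e) \<or>
     vec_in I (M2 $ b $ d + t *s M2 $ b $ e) \<and> vec_in I (M2 $ c $ d + t *s M2 $ c $ e) \<or>
     vec_in I (M2 $ b $ e + t *s M2 $ b $ d) \<and> vec_in I (M2 $ c $ e + t *s M2 $ c $ d)"
    by blast
  define N where "N i j = act (rank1 (t *s axis i 1) (axis j 1)) (mat 1) M2" for i j
  have N: "N i j $ p $ r = M2 $ p $ r + (if p = i then t else 0) *s M2 $ j $ r +
      (if r = i then t else 0) *s M2 $ p $ j" for i j p r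
    unfolding N_def by (subst act_rank1_axis_nth [OF alt(3)]) (auto simp: axis_def)
  have vin: "vec_in R (t *s axis i 1)" for i
    using t by (intro vec_in_ops) auto
  have deg: "degenerate4 a M2" if "degenerate4 a (N i j)" "a \<noteq> j" "i \<noteq> j" for i j
  proof (rule degenerate4_row_operation)
    show "vec_in R (t *s axis i 1)" "a \<noteq> j"
      using vin that by blast+
    show "(t *s axis i 1) $ j = 0"
      using that(3) by (simp add: axis_nth_neq)
    show "degenerate4 a (act (rank1 (t *s axis i 1) (axis j 1)) (mat 1) M2)"
      using that(1) unfolding N_def .
  qed
  note nz = alternating_nth(1) [OF alt(3)]
  have "degenerate4 a M2"
    using cases
  proof (elim disjE conjE)
    assume "vec_in I (M2 $ b $ d + t *s M2 $ c $ d)" "vec_in I (M2 $ b $ e + t *s M2 $ c $ e)"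
    then have "degenerate4 a (N b c)"
      using dist bc by (intro degenerate4_kernel [of a b c d e]) (auto simp: N nz)
    then show ?thesis using dist by (intro deg) auto
  next
    assume "vec_in I (M2 $ c $ d + t *s M2 $ b $ d)" "vec_in I (M2 $ c $ e + t *s M2 $ b $ e)"
    then have "degenerate4 a (N c b)"
      using dist cb by (intro degenerate4_kernel [of a c b d e]) (auto simp: N nz)
    then show ?thesis using dist by (intro deg) auto
  next
    assume "vec_in I (M2 $ b $ d + t *s M2 $ b $ e)" "vec_in I (M2 $ c $ d + t *s M2 $ c $ e)"
    then have "degenerate4 a (N d e)"
      using dist bc by (intro degenerate4_block [of b c d]) (auto simp: N nz zero_block_def)
    then show ?thesis using dist by (intro deg) auto
  next
    assume "vec_in I (M2 $ b $ e + t *s M2 $ b $ d)" "vec_in I (M2 $ c $ e + t *s M2 $ c $ d)"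
    then have "degenerate4 a (N e d)"
      using dist bc by (intro degenerate4_block [of b c e]) (auto simp: N nz zero_block_def)
    then show ?thesis using dist by (intro deg) auto
  qed
  moreover have "a \<noteq> d" "a \<noteq> e"
    using dist by auto
  ultimately show ?thesis
    using degenerate4_row_operation [OF xy(2) y(4)] degenerate4_row_operation [OF xy(1) x(3)]
    unfolding M1_def M2_def by blast
qed

text \<open>This is the classification of the totally isotropic subspaces of the Klein quadric.\<close>
lemma pfaffian_zero_degenerate4:
  assumes M: "int_model M" and p: "\<And>k l. pfc M a k l \<in> I"
  shows "degenerate4 a M"
proof (cases "\<exists>d e. d \<noteq> a \<and> e \<noteq> a \<and> d \<noteq> e \<and> \<not> vec_in I (M $ d $ e)")
  case True
  then obtain d e where de: "d \<noteq> a" "e \<noteq> a" "d \<noteq> e" "\<not> vec_in I (M $ d $ e)"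
    by blast
  then obtain k where k: "M $ d $ e $ k \<notin> I"
    by (auto simp: vec_in_def)
  have "distinct [a, d, e]"
    using de by auto
  then obtain b c where "distinct [a, b, c, d, e]"
    by (rule complete_distinct)
  then show ?thesis
    using p k by (rule degenerate4_unit [OF M])
next
  case False
  obtain b c d e where d: "distinct [a, b, c, d, e]"
    using exists_distinct by blast
  then have "zero_block M b c d"
    using False by (auto simp: zero_block_def)
  then show ?thesis
    using d by (intro degenerate4_block [of b c d]) auto
qed

text \<open>The two excluded patterns are those that \<open>zero_block_lowers\<close> and
  \<open>zero_row_lowers\<close> convert into an integral model of smaller level.\<close>

definition stable :: "'k model \<Rightarrow> bool" where
  "stable M \<longleftrightarrow> (\<forall>A\<in>GL_over R.
     (\<forall>x y z. distinct [x, y, z] \<longrightarrow> \<not> zero_block (act A (mat 1) M) x y z) \<and>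
     (\<forall>x. \<exists>y. \<not> vec_in I (act A (mat 1) M $ x $ y)))"

lemma stable_act: "stable M \<Longrightarrow> A \<in> GL_over R \<Longrightarrow> stable (act A (mat 1) M)"
  unfolding stable_def act_act matrix_mul_lid using GL_mult by blast

lemma stable_no_block: "stable M \<Longrightarrow> distinct [x, y, z] \<Longrightarrow> \<not> zero_block M x y z"
  unfolding stable_def using GL_mat1 by (metis act_one)

lemma stable_no_row: "stable M \<Longrightarrow> \<exists>y. \<not> vec_in I (M $ x $ y)"
  unfolding stable_def using GL_mat1 by (metis act_one)

text \<open>If \<open>r\<close> were a unit, the relation would let multiples of row
  \<open>e\<close>, added to rows \<open>c\<close> and \<open>d\<close>, clear the entry (c, d)
  without disturbing the zeros in row \<open>b\<close>. Then \<open>b\<close>, \<open>c\<close>,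
  \<open>d\<close> would span a zero block.\<close>

lemma stable_block_relation:
  assumes M: "int_model M" "stable M" and dist: "distinct [b, c, d, e]"
    and b: "vec_in I (M $ b $ c)" "vec_in I (M $ b $ d)" "vec_in I (M $ b $ e)"
    and R: "r \<in> R" "s \<in> R" "t \<in> R" and rel: "vec_in I (r *s M $ c $ d + s *s M $ c $ e + t *s M $ d $ e)"
  shows "r \<in> I"
proof (rule ccontr)
  assume "r \<notin> I"
  then have r: "r \<noteq> 0" "inverse r \<in> R"
    using inverse_R R I_0 by metis+
  note alt = int_model_alternating [OF M(1)]
  define u where "u = (- inverse r * t) *s axis c 1 + (inverse r * s) *s axis d 1"
  have uR: "vec_in R u"
    unfolding u_def using r R by (auto intro!: vec_in_ops)
  have u: "u $ b = 0" "u $ c = - inverse r * t" "u $ d = inverse r * s" "u $ e = 0"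
    using dist by (auto simp: u_def axis_def)
  define N where "N = act (rank1 u (axis e 1)) (mat 1) M"
  have N: "N $ i $ j = M $ i $ j + u $ i *s M $ e $ j + u $ j *s M $ i $ e" for i j
    unfolding N_def by (rule act_rank1_axis_nth [OF alt])
  have "vec_in I (inverse r *s (r *s M $ c $ d + s *s M $ c $ e + t *s M $ d $ e))"
    using r(2) rel by (rule vec_in_ops(9))
  moreover have "N $ c $ d = inverse r *s (r *s M $ c $ d + s *s M $ c $ e + t *s M $ d $ e)"
    using r alternating_nth(2) [OF alt, of e d]
    by (simp add: N u vec_eq_iff algebra_simps)
  moreover have "vec_in I (N $ b $ c)" "vec_in I (N $ b $ d)"
    using b r R by (auto simp: N u intro!: vec_in_ops(6,7,9))
  ultimately have "zero_block N b c d"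
    by (simp add: zero_block_def)
  moreover have "stable N"
    unfolding N_def by (intro stable_act M GL_row_operation uR u)
  ultimately show False
    using stable_no_block dist by fastforce
qed

text \<open>Relabelling \<open>c\<close>, \<open>d\<close>, \<open>e\<close> brings each of the
  three coefficients into the leading place of \<open>stable_block_relation\<close>.\<close>

lemma stable_independent3:
  assumes M: "int_model M" "stable M" and dist: "distinct [b, c, d, e]"
    and b: "vec_in I (M $ b $ c)" "vec_in I (M $ b $ d)" "vec_in I (M $ b $ e)"
  shows "independent3 (M $ c $ d) (M $ c $ e) (M $ d $ e)"
  unfolding independent3_def
proof (intro ballI impI)
  fix r s t assume R: "r \<in> R" "s \<in> R" "t \<in> R"
    and rel: "vec_in I (r *s M $ c $ d + s *s M $ c $ e + t *s M $ d $ e)"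
  note alt = alternating_nth(2) [OF int_model_alternating [OF M(1)]]
  have r: "r \<in> I"
    by (rule stable_block_relation [OF M dist b R rel])
  have "s *s M $ c $ e + r *s M $ c $ d + (- t) *s M $ e $ d =
      r *s M $ c $ d + s *s M $ c $ e + t *s M $ d $ e"
    unfolding alt [of e d] by (simp add: vec_eq_iff)
  then have rel_s: "vec_in I (s *s M $ c $ e + r *s M $ c $ d + (- t) *s M $ e $ d)"
    using rel by (simp only:)
  have "t *s M $ d $ e + (- r) *s M $ d $ c + (- s) *s M $ e $ c =
      r *s M $ c $ d + s *s M $ c $ e + t *s M $ d $ e"
    unfolding alt [of d c] alt [of e c] by (simp add: vec_eq_iff)
  then have rel_t: "vec_in I (t *s M $ d $ e + (- r) *s M $ d $ c + (- s) *s M $ e $ c)"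
    using rel by (simp only:)
  have "distinct [b, c, e, d]" "distinct [b, d, e, c]"
    using dist by auto
  then have s: "s \<in> I" and t: "t \<in> I"
    using stable_block_relation [OF M _ b(1,3,2) R(2,1) R_uminus [OF R(3)] rel_s]
      stable_block_relation [OF M _ b(2,3,1) R(3) R_uminus [OF R(1)] R_uminus [OF R(2)] rel_t]
    by blast+
  show "r \<in> I \<and> s \<in> I \<and> t \<in> I"
    using r s t by blast
qed

lemma independent3_cancel:
  fixes A B C :: "'k^'n::finite"
  assumes ind: "independent3 A B C" and R: "vec_in R x" "vec_in R A" "vec_in R B" "vec_in R C"
    and rst: "r \<in> R" "s \<in> R" "t \<in> R"
    and rel: "\<And>k l. r * sq x A k l + s * sq x B k l + t * sq x C k l \<in> I"
    and x: "\<not> vec_in I x"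
  shows "r \<in> I \<and> s \<in> I \<and> t \<in> I"
proof -
  have "sq x (r *s A + s *s B + t *s C) k l \<in> I" for k l
    using rel [of k l] by (simp add: sq_simps)
  then have "vec_in I x \<or> vec_in I (r *s A + s *s B + t *s C)"
    using R rst by (intro sq_domain vec_in_ops)
  then show ?thesis
    using x ind rst by (auto simp: independent3_def)
qed

text \<open>The other two products in this Pfaffian contain an entry of row \<open>b\<close> lying
  in \<open>I\<close>, so one product survives.\<close>

lemma pfc_mod_I:
  assumes M: "int_model M" and dist: "distinct [p, a, b, x, y]"
    and b: "vec_in I (M $ b $ x)" "vec_in I (M $ b $ y)"
  shows "\<exists>s\<in>{1, -1}. \<forall>k l. pfc M p k l - s * sq (M $ a $ b) (M $ x $ y) k l \<in> I"
proof -
  obtain s where s: "s \<in> {1, -1}" "\<And>k l. pfc M p k l = s * pfc4 M a b x y k l"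
    using pfc_perm [OF int_model_alternating [OF M] dist] by blast
  then have sR: "s \<in> R" by auto
  have "pfc M p k l - s * sq (M $ a $ b) (M $ x $ y) k l \<in> I" for k l
  proof -
    have "pfc M p k l - s * sq (M $ a $ b) (M $ x $ y) k l =
      s * (sq (M $ a $ y) (M $ b $ x) k l - sq (M $ a $ x) (M $ b $ y) k l)"
      by (simp add: s pfc4_def algebra_simps)
    also have "\<dots> \<in> I"
      using M b sR by (intro I_mult I_diff sq_I(2)) (auto simp: int_model_def)
    finally show ?thesis .
  qed
  then show ?thesis using s by blast
qed

end

lemma forall_distinct_5:
  assumes "distinct [a, b, c, d, e :: 5]" "P a" "P b" "P c" "P d" "P e"
  shows "P y"
proof -
  have "y \<in> {a, b, c, d, e}"
    using distinct_5_UNIV [OF assms(1)] by blast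
  then show ?thesis using assms by auto
qed

section \<open>Linear relations between the Pfaffians of a stable model\<close>

context local_subring
begin

definition pfaffian_basis :: "'k model \<Rightarrow> 5 set \<Rightarrow> bool" where
  "pfaffian_basis M S \<longleftrightarrow> (\<forall>i k l. i \<notin> S \<longrightarrow> pfc M i k l \<in> I) \<and>
     (\<forall>c. (\<forall>i\<in>S. c i \<in> R) \<and> (\<forall>k l. (\<Sum>i\<in>S. c i * pfc M i k l) \<in> I) \<longrightarrow> (\<forall>i\<in>S. c i \<in> I))"

text \<open>Modulo \<open>I\<close> the Pfaffians \<open>c\<close>, \<open>d\<close>,
  \<open>e\<close> are up to sign the entry (a, b) times an entry of the block, so a relation
  between the four Pfaffians is a Koszul syzygy of the block. The signs from \<open>pfc_perm\<close>
  are absorbed into the new coefficients, which is why only their membership in \<open>I\<close> is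
  recorded.\<close>

lemma sum_pfc_four:
  fixes M :: "'k model"
  assumes M: "int_model M" and dist: "distinct [a, b, c, d, e]"
    and b: "vec_in I (M $ b $ c)" "vec_in I (M $ b $ d)" "vec_in I (M $ b $ e)"
    and g: "g b \<in> R" "g c \<in> R" "g d \<in> R" "g e \<in> R"
    and rel: "\<And>k l. (\<Sum>i\<in>{b, c, d, e}. g i * pfc M i k l) \<in> I"
  obtains gb gc gd ge where "gb \<in> R" "gc \<in> R" "gd \<in> R" "ge \<in> R"
    "gb \<in> I \<longleftrightarrow> g b \<in> I" "gc \<in> I \<longleftrightarrow> g c \<in> I" "gd \<in> I \<longleftrightarrow> g d \<in> I" "ge \<in> I \<longleftrightarrow> g e \<in> I"
    "\<And>k l. sq (gb *s M $ a $ c + gc *s M $ a $ b) (M $ d $ e) k l -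
      sq (gb *s M $ a $ d - gd *s M $ a $ b) (M $ c $ e) k l +
      sq (gb *s M $ a $ e + ge *s M $ a $ b) (M $ c $ d) k l \<in> I"
proof -
  have d: "distinct [b, a, c, d, e]" "distinct [c, a, b, d, e]" "distinct [d, a, b, c, e]"
    "distinct [e, a, b, c, d]"
    using dist by auto
  obtain sb where sb: "sb \<in> {1, -1}" "\<And>k l. pfc M b k l = sb * pfc4 M a c d e k l"
    using pfc_perm [OF int_model_alternating [OF M] d(1)] by blast
  obtain sc where sc: "sc \<in> {1, -1}" "\<And>k l. pfc M c k l - sc * sq (M $ a $ b) (M $ d $ e) k l \<in> I"
    using pfc_mod_I [OF M d(2) b(2,3)] by blast
  obtain sd where sd: "sd \<in> {1, -1}" "\<And>k l. pfc M d k l - sd * sq (M $ a $ b) (M $ c $ e) k l \<in> I"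
    using pfc_mod_I [OF M d(3) b(1,3)] by blast
  obtain se where se: "se \<in> {1, -1}" "\<And>k l. pfc M e k l - se * sq (M $ a $ b) (M $ c $ d) k l \<in> I"
    using pfc_mod_I [OF M d(4) b(1,2)] by blast
  have sgn: "x * s \<in> R" "x * s \<in> I \<longleftrightarrow> x \<in> I" if "s \<in> {1, -1}" "x \<in> R" for x s
    using that I_uminus [of x] I_uminus [of "- x"] R_uminus [of x] by auto
  have "sq ((g b * sb) *s M $ a $ c + (g c * sc) *s M $ a $ b) (M $ d $ e) k l -
      sq ((g b * sb) *s M $ a $ d - (g d * sd) *s M $ a $ b) (M $ c $ e) k l +
      sq ((g b * sb) *s M $ a $ e + (g e * se) *s M $ a $ b) (M $ c $ d) k l \<in> I" for k l
  proof -
    have sum: "(\<Sum>i\<in>{b, c, d, e}. g i * pfc M i k l) =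
        g b * pfc M b k l + g c * pfc M c k l + g d * pfc M d k l + g e * pfc M e k l"
      using dist by (simp add: add.assoc)
    have "(\<Sum>i\<in>{b, c, d, e}. g i * pfc M i k l) -
        g c * (pfc M c k l - sc * sq (M $ a $ b) (M $ d $ e) k l) -
        g d * (pfc M d k l - sd * sq (M $ a $ b) (M $ c $ e) k l) -
        g e * (pfc M e k l - se * sq (M $ a $ b) (M $ c $ d) k l) \<in> I"
      by (intro I_diff I_mult rel sc(2) sd(2) se(2) g)
    then show ?thesis
      unfolding sum by (simp add: sb(2) pfc4_def sq_simps algebra_simps)
  qed
  then show ?thesis
    using sgn(1) [OF sb(1) g(1)] sgn(1) [OF sc(1) g(2)] sgn(1) [OF sd(1) g(3)] sgn(1) [OF se(1) g(4)]
      sgn(2) [OF sb(1) g(1)] sgn(2) [OF sc(1) g(2)] sgn(2) [OF sd(1) g(3)] sgn(2) [OF se(1) g(4)]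
      that by blast
qed

lemma independent3_dual:
  fixes A B C :: "'k^5"
  assumes "independent3 A B C" "vec_in R A" "vec_in R B" "vec_in R C" "vec_in R x3" "vec_in R x4" "vec_in R x5"
    and "\<And>k l. sq x3 C k l - sq x4 B k l + sq x5 A k l \<in> I"
  shows "\<exists>w3\<in>R. \<exists>w4\<in>R. \<exists>w5\<in>R. vec_in I (x3 - w4 *s A - w5 *s B) \<and>
    vec_in I (x4 + w3 *s A - w5 *s C) \<and> vec_in I (x5 + w3 *s B + w4 *s C)"
proof -
  obtain fa fb fc where "vec_in R fa" "vec_in R fb" "vec_in R fc"
    "dot fa A = 1" "dot fa B = 0" "dot fa C = 0" "dot fb A = 0" "dot fb B = 1"
    "dot fb C = 0" "dot fc A = 0" "dot fc B = 0" "dot fc C = 1"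
    using dual3 assms by metis
  then show ?thesis
    using assms by (intro koszul)
qed

text \<open>With u_i = - g_i / g_a the row operation of \<open>pfc_row_operation\<close> replaces
  the Pfaffian \<open>a\<close> by the given relation divided by g_a.\<close>

lemma eliminate_pfaffian:
  assumes M: "int_model M" and g: "\<And>i. g i \<in> R" "\<And>k l. (\<Sum>i\<in>UNIV. g i * pfc M i k l) \<in> I" "g a \<notin> I"
  shows "\<exists>E\<in>GL_over R. \<forall>k l. pfc (act E (mat 1) M) a k l \<in> I"
proof -
  have ga: "g a \<noteq> 0" "inverse (g a) \<in> R"
    using inverse_R g I_0 by metis+
  define u where "u = (\<chi> i. if i = a then 0 else - inverse (g a) * g i)"
  have u: "u $ a = 0" "vec_in R u"
    using g ga by (auto simp: u_def vec_in_def)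
  have "pfc (act (rank1 u (axis a 1)) (mat 1) M) a k l \<in> I" for k l
  proof -
    have "pfc (act (rank1 u (axis a 1)) (mat 1) M) a k l = pfc M a k l - (\<Sum>i\<in>UNIV. u $ i * pfc M i k l)"
      using pfc_row_operation [OF int_model_alternating u(1), OF M] by simp
    also have "\<dots> = (\<Sum>i\<in>UNIV. (if i = a then pfc M i k l else 0) - u $ i * pfc M i k l)"
      by (simp add: sum_subtractf)
    also have "\<dots> = (\<Sum>i\<in>UNIV. inverse (g a) * (g i * pfc M i k l))"
      using ga by (intro sum.cong) (auto simp: u_def)
    also have "\<dots> = inverse (g a) * (\<Sum>i\<in>UNIV. g i * pfc M i k l)"
      by (simp add: sum_distrib_left)
    also have "\<dots> \<in> I"
      using g ga by blast
    finally show ?thesis .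
  qed
  then show ?thesis
    using GL_row_operation [OF u(2,1)] by blast
qed

lemma stable_row_entry:
  assumes M: "int_model M" "stable M" and dist: "distinct [y, x, c, d, e]"
    and zero: "vec_in I (M $ x $ c)" "vec_in I (M $ x $ d)" "vec_in I (M $ x $ e)"
  shows "\<not> vec_in I (M $ x $ y)"
proof
  assume "vec_in I (M $ x $ y)"
  moreover have "vec_in I (M $ x $ x)"
    using alternating_nth(1) [OF int_model_alternating [OF M(1)], of x] by (simp add: vec_in_ops)
  ultimately have "vec_in I (M $ x $ z)" for z
    using zero forall_distinct_5 [OF dist, of "\<lambda>z. vec_in I (M $ x $ z)"] by blast
  then show False
    using stable_no_row [OF M(2)] by blast
qed

text \<open>Once the term of the Pfaffian \<open>b\<close> drops out, the relation is the entry (a,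
  b) times a combination of the block entries. The first factor is nonzero modulo \<open>I\<close>,
  so the combination vanishes.\<close>

lemma block_pfaffians_independent:
  fixes M :: "'k model"
  assumes M: "int_model M" and dist: "distinct [a, b, c, d, e]"
    and b: "vec_in I (M $ b $ c)" "vec_in I (M $ b $ d)" "vec_in I (M $ b $ e)"
    and psi: "independent3 (M $ c $ d) (M $ c $ e) (M $ d $ e)" and ab: "\<not> vec_in I (M $ a $ b)"
    and g: "g b \<in> I" "g c \<in> R" "g d \<in> R" "g e \<in> R"
    and rel: "\<And>k l. (\<Sum>i\<in>{b, c, d, e}. g i * pfc M i k l) \<in> I"
  shows "g c \<in> I \<and> g d \<in> I \<and> g e \<in> I"
proof -
  note R = int_model_vec_in [OF M]
  obtain gb gc gd ge where gR: "gb \<in> R" "gc \<in> R" "gd \<in> R" "ge \<in> R"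
    and gI: "gb \<in> I \<longleftrightarrow> g b \<in> I" "gc \<in> I \<longleftrightarrow> g c \<in> I" "gd \<in> I \<longleftrightarrow> g d \<in> I" "ge \<in> I \<longleftrightarrow> g e \<in> I"
    and rel': "\<And>k l. sq (gb *s M $ a $ c + gc *s M $ a $ b) (M $ d $ e) k l -
      sq (gb *s M $ a $ d - gd *s M $ a $ b) (M $ c $ e) k l +
      sq (gb *s M $ a $ e + ge *s M $ a $ b) (M $ c $ d) k l \<in> I"
    by (rule sum_pfc_four [OF M dist b I_R [OF g(1)] g(2-4) rel]) (rule that)
  have "ge * sq (M $ a $ b) (M $ c $ d) k l + gd * sq (M $ a $ b) (M $ c $ e) k l +
      gc * sq (M $ a $ b) (M $ d $ e) k l \<in> I" for k l
  proof -
    have "gb * (sq (M $ a $ c) (M $ d $ e) k l - sq (M $ a $ d) (M $ c $ e) k l +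
        sq (M $ a $ e) (M $ c $ d) k l) \<in> I"
      using gI(1) g(1) R by (intro I_mult' R_add R_diff sq_R) blast+
    from I_diff [OF rel' [of k l] this] show ?thesis
      by (simp add: sq_simps algebra_simps)
  qed
  from independent3_cancel [OF psi R R R R gR(4,3,2) this ab] show ?thesis
    using gI by blast
qed

text \<open>Five, four or three Pfaffians are independent, and in the last two cases their indices
  include an independent block. One relation lets the Pfaffian \<open>a\<close> be made zero; of the
  two degenerate shapes stability then leaves only the zero row. A second relation is a syzygy of
  the block and clears another row, after which exactly the three Pfaffians of the block are
  left.\<close>

lemma stable_pfaffians:
  assumes M: "int_model M" "stable M"
  shows "pfaffian_basis M UNIV \<or>
    (\<exists>A\<in>GL_over R. \<exists>c d e S. distinct [c, d, e] \<and> {c, d, e} \<subseteq> S \<and>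
      independent3 (act A (mat 1) M $ c $ d) (act A (mat 1) M $ c $ e) (act A (mat 1) M $ d $ e) \<and>
      pfaffian_basis (act A (mat 1) M) S)"
proof (cases "pfaffian_basis M UNIV")
  case False
  then obtain g a where g: "\<And>i. g i \<in> R" "\<And>k l. (\<Sum>i\<in>UNIV. g i * pfc M i k l) \<in> I" "g a \<notin> I"
    by (auto simp: pfaffian_basis_def)
  obtain E where E1: "E \<in> GL_over R" and p: "\<And>k l. pfc (act E (mat 1) M) a k l \<in> I"
    using eliminate_pfaffian [OF M(1) g] by blast
  define M1 where "M1 = act E (mat 1) M"
  have M1: "int_model M1" "stable M1"
    unfolding M1_def by (intro int_model_act stable_act M E1 GL_entry)+
  note p1 = p [folded M1_def]
  obtain A2 where A2: "A2 \<in> GL_over R" "A2 *v axis a 1 = axis a 1"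
    "(\<exists>x y z. distinct [x, y, z] \<and> zero_block (act A2 (mat 1) M1) x y z) \<or>
     (\<exists>x y z w. distinct [a, x, y, z, w] \<and> vec_in I (act A2 (mat 1) M1 $ x $ y) \<and>
       vec_in I (act A2 (mat 1) M1 $ x $ z) \<and> vec_in I (act A2 (mat 1) M1 $ x $ w))"
    using pfaffian_zero_degenerate4 [OF M1(1) p1] unfolding degenerate4_def by blast
  define M2 where "M2 = act A2 (mat 1) M1"
  have M2: "int_model M2" "stable M2"
    unfolding M2_def by (intro int_model_act stable_act M1 A2 GL_entry)+
  have p2: "pfc M2 a k l \<in> I" for k l
    unfolding M2_def by (intro pfc_act_fixed A2 M1 p1)
  obtain b c d e where dist: "distinct [a, b, c, d, e]"
    and b: "vec_in I (M2 $ b $ c)" "vec_in I (M2 $ b $ d)" "vec_in I (M2 $ b $ e)"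
    using A2(3) stable_no_block [OF M2(2)] unfolding M2_def by blast
  have dist': "distinct [b, c, d, e]" "distinct [c, d, e]"
    using dist by auto
  have M2_eq: "M2 = act (A2 ** E) (mat 1) M"
    by (simp add: M2_def M1_def act_act)
  have A2E: "A2 ** E \<in> GL_over R"
    by (intro GL_mult A2 E1)
  have psi: "independent3 (M2 $ c $ d) (M2 $ c $ e) (M2 $ d $ e)"
    by (rule stable_independent3 [OF M2 dist'(1) b])
  note R2 = int_model_vec_in [OF M2(1)]
  show ?thesis
  proof (cases "pfaffian_basis M2 {b, c, d, e}")
    case True
    have "{c, d, e} \<subseteq> {b, c, d, e}" by blast
    with True show ?thesis
      using A2E dist'(2) psi unfolding M2_eq by blast
  next
    case False
    have "i = a" if "i \<notin> {b, c, d, e}" for i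
      using distinct_5_UNIV [OF dist] that by blast
    then have "\<forall>i k l. i \<notin> {b, c, d, e} \<longrightarrow> pfc M2 i k l \<in> I"
      using p2 by blast
    with False obtain h where h': "\<forall>i\<in>{b, c, d, e}. h i \<in> R"
      "\<forall>k l. (\<Sum>i\<in>{b, c, d, e}. h i * pfc M2 i k l) \<in> I" "\<not> (\<forall>i\<in>{b, c, d, e}. h i \<in> I)"
      unfolding pfaffian_basis_def by blast
    have h: "h b \<in> R" "h c \<in> R" "h d \<in> R" "h e \<in> R"
      "\<And>k l. (\<Sum>i\<in>{b, c, d, e}. h i * pfc M2 i k l) \<in> I"
      using h'(1) h'(2) [rule_format] by blast+
    obtain gb gc gd ge where gR: "gb \<in> R" "gc \<in> R" "gd \<in> R" "ge \<in> R"
      and gI: "gb \<in> I \<longleftrightarrow> h b \<in> I" "gc \<in> I \<longleftrightarrow> h c \<in> I" "gd \<in> I \<longleftrightarrow> h d \<in> I" "ge \<in> I \<longleftrightarrow> h e \<in> I"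
      and rel: "\<And>k l. sq (gb *s M2 $ a $ c + gc *s M2 $ a $ b) (M2 $ d $ e) k l -
        sq (gb *s M2 $ a $ d - gd *s M2 $ a $ b) (M2 $ c $ e) k l +
        sq (gb *s M2 $ a $ e + ge *s M2 $ a $ b) (M2 $ c $ d) k l \<in> I"
      by (rule sum_pfc_four [OF M2(1) dist b h]) (rule that)
    have "distinct [b, a, c, d, e]"
      using dist by auto
    have ab: "\<not> vec_in I (M2 $ a $ b)"
      using stable_row_entry [OF M2 dist b] vec_in_flip [OF int_model_alternating [OF M2(1)]] by blast
    \<comment> \<open>Otherwise \<open>block_pfaffians_independent\<close> would put all
      coefficients of the relation in \<open>I\<close>.\<close>
    have gb: "gb \<notin> I"
      using block_pfaffians_independent [OF M2(1) dist b psi ab _ h(2-5)] h'(3) gI by blast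
    then have gb0: "gb \<noteq> 0" "inverse gb \<in> R"
      using inverse_R gR I_0 by metis+
    have "vec_in R (gb *s M2 $ a $ c + gc *s M2 $ a $ b)" "vec_in R (gb *s M2 $ a $ d - gd *s M2 $ a $ b)"
      "vec_in R (gb *s M2 $ a $ e + ge *s M2 $ a $ b)"
      by (intro vec_in_ops R2 gR)+
    from independent3_dual [OF psi R2 R2 R2 this rel]
    obtain w3 w4 w5 where w: "w3 \<in> R" "w4 \<in> R" "w5 \<in> R"
      and acx: "vec_in I (gb *s M2 $ a $ c + gc *s M2 $ a $ b - w4 *s M2 $ c $ d - w5 *s M2 $ c $ e)"
      and adx: "vec_in I (gb *s M2 $ a $ d - gd *s M2 $ a $ b + w3 *s M2 $ c $ d - w5 *s M2 $ d $ e)"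
      and aex: "vec_in I (gb *s M2 $ a $ e + ge *s M2 $ a $ b + w3 *s M2 $ c $ e + w4 *s M2 $ d $ e)"
      by blast
    let ?h = "inverse gb"
    \<comment> \<open>The Koszul coefficients divided by \<open>gb\<close> clear row
      \<open>a\<close> in columns \<open>c\<close>, \<open>d\<close>, \<open>e\<close> up to
      multiples of the entry (a, b). The vector \<open>y\<close> below removes these by adding
      multiples of row \<open>b\<close>, whose own entries in these columns are already in
      \<open>I\<close>.\<close>
    define x where "x = (?h * w3) *s axis c 1 + (?h * w4) *s axis d 1 + (?h * w5) *s axis e 1"
    have xR: "vec_in R x"
      unfolding x_def by (intro vec_in_ops vec_in_axis R_mult w gb0)
    have xa: "x $ a = 0"
      using dist by (auto simp: x_def axis_def)
    define M3 where "M3 = act (rank1 (axis a 1) x) (mat 1) M2"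
    have E3: "rank1 (axis a 1) x \<in> GL_over R"
      using xR xa by (intro GL_rank1) (auto simp: vec_in_def)
    have M3: "int_model M3" "stable M3"
      unfolding M3_def by (intro int_model_act stable_act M2 E3 GL_entry)+
    note alt2 = int_model_alternating [OF M2(1)]
    have fx: "form M2 x (axis j 1) = (?h * w3) *s M2 $ c $ j + (?h * w4) *s M2 $ d $ j + (?h * w5) *s M2 $ e $ j" for j
      by (simp add: x_def form_add form_scale)
    have M3_a: "M3 $ a $ j = M2 $ a $ j + form M2 x (axis j 1)" if "j \<noteq> a" for j
      unfolding M3_def using that by (subst act_rank1_nth [OF alt2]) (simp add: axis_def)
    have M3_o: "M3 $ i $ j = M2 $ i $ j" if "i \<noteq> a" "j \<noteq> a" for i j
      unfolding M3_def using that by (subst act_rank1_nth [OF alt2]) (simp add: axis_def)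
    define y where "y = (?h * gc) *s axis c 1 + (- ?h * gd) *s axis d 1 + (?h * ge) *s axis e 1"
    have yR: "vec_in R y"
      unfolding y_def by (intro vec_in_ops vec_in_axis R_mult gR gb0 R_uminus)
    have y: "y $ a = 0" "y $ b = 0" "y $ c = ?h * gc" "y $ d = - ?h * gd" "y $ e = ?h * ge"
      using dist by (auto simp: y_def axis_def)
    define M4 where "M4 = act (rank1 y (axis b 1)) (mat 1) M3"
    have E4: "rank1 y (axis b 1) \<in> GL_over R"
      by (intro GL_row_operation yR y)
    have M4: "int_model M4" "stable M4"
      unfolding M4_def by (intro int_model_act stable_act M3 E4 GL_entry)+
    have M4_nth: "M4 $ i $ j = M3 $ i $ j + y $ i *s M3 $ b $ j + y $ j *s M3 $ i $ b" for i j
      unfolding M4_def by (rule act_rank1_axis_nth [OF int_model_alternating [OF M3(1)]])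
    have ne: "a \<noteq> b" "a \<noteq> c" "a \<noteq> d" "a \<noteq> e" "b \<noteq> c" "b \<noteq> d" "b \<noteq> e" "c \<noteq> d" "c \<noteq> e" "d \<noteq> e"
      using dist by auto
    note nz = alternating_nth(1) [OF alt2]
    note flip = alternating_nth(2) [OF alt2]
    have b4: "vec_in I (M4 $ b $ c)" "vec_in I (M4 $ b $ d)" "vec_in I (M4 $ b $ e)"
      using b ne ne [symmetric] by (simp_all add: M4_nth M3_o y nz)
    have fb: "vec_in I (form M2 x (axis b 1))"
      unfolding fx by (intro vec_in_ops(6,9) R_mult w gb0 b [THEN vec_in_flip [OF alt2]])
    have a4: "vec_in I (M4 $ a $ c)" "vec_in I (M4 $ a $ d)" "vec_in I (M4 $ a $ e)"
    proof -
      have "M4 $ a $ c = ?h *s (gb *s M2 $ a $ c + gc *s M2 $ a $ b - w4 *s M2 $ c $ d - w5 *s M2 $ c $ e) +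
          (?h * gc) *s form M2 x (axis b 1)"
        using ne ne [symmetric] gb0(1) flip [of d c] flip [of e c]
        by (simp add: M4_nth M3_a y fx nz vec_eq_iff algebra_simps)
      then show "vec_in I (M4 $ a $ c)"
        by (simp only:) (intro vec_in_ops(6,9) acx fb gb0 R_mult gR)
      have "M4 $ a $ d = ?h *s (gb *s M2 $ a $ d - gd *s M2 $ a $ b + w3 *s M2 $ c $ d - w5 *s M2 $ d $ e) +
          (- ?h * gd) *s form M2 x (axis b 1)"
        using ne ne [symmetric] gb0(1) flip [of e d]
        by (simp add: M4_nth M3_a y fx nz vec_eq_iff algebra_simps)
      then show "vec_in I (M4 $ a $ d)"
        by (simp only:) (intro vec_in_ops(6,9) adx fb gb0 R_mult gR R_uminus)
      have "M4 $ a $ e = ?h *s (gb *s M2 $ a $ e + ge *s M2 $ a $ b + w3 *s M2 $ c $ e + w4 *s M2 $ d $ e) +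
          (?h * ge) *s form M2 x (axis b 1)"
        using ne ne [symmetric] gb0(1)
        by (simp add: M4_nth M3_a y fx nz vec_eq_iff algebra_simps)
      then show "vec_in I (M4 $ a $ e)"
        by (simp only:) (intro vec_in_ops(6,9) aex fb gb0 R_mult gR)
    qed
    have psi4: "independent3 (M4 $ c $ d) (M4 $ c $ e) (M4 $ d $ e)"
      by (rule stable_independent3 [OF M4 dist'(1) b4])
    note R4 = int_model_vec_in [OF M4(1)]
    \<comment> \<open>Each product in the Pfaffian \<open>a\<close> contains an entry of row
      \<open>b\<close>, and each product in the Pfaffian \<open>b\<close> an entry of row
      \<open>a\<close>; all these entries lie in \<open>I\<close>.\<close>
    have pa: "pfc M4 a k l \<in> I" for k l
      using b4 R4 by (intro pfc_in_I [OF M4(1) dist]) (auto simp: pfc4_def intro!: sq_I(1))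
    have pb: "pfc M4 b k l \<in> I" for k l
      using a4 R4 ne by (intro pfc_in_I [OF M4(1), of b a c d e]) (auto simp: pfc4_def intro!: sq_I(1))
    have ab4: "\<not> vec_in I (M4 $ a $ b)"
      using \<open>distinct [b, a, c, d, e]\<close> by (rule stable_row_entry [OF M4 _ a4])
    have "pfaffian_basis M4 {c, d, e}"
      unfolding pfaffian_basis_def
    proof (intro conjI allI impI)
      fix i k l assume "i \<notin> {c, d, e}"
      then have "i = a \<or> i = b"
        using distinct_5_UNIV [OF dist] by blast
      then show "pfc M4 i k l \<in> I"
        using pa pb by blast
    next
      fix h assume "(\<forall>i\<in>{c, d, e}. h i \<in> R) \<and> (\<forall>k l. (\<Sum>i\<in>{c, d, e}. h i * pfc M4 i k l) \<in> I)"
      then have h: "h c \<in> R" "h d \<in> R" "h e \<in> R" "\<And>k l. (\<Sum>i\<in>{c, d, e}. h i * pfc M4 i k l) \<in> I"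
        by auto
      have h0: "(\<Sum>i\<in>{b, c, d, e}. (h(b := 0)) i * pfc M4 i k l) \<in> I" for k l
        using h(4) [of k l] ne by simp
      have "(h(b := 0)) c \<in> I \<and> (h(b := 0)) d \<in> I \<and> (h(b := 0)) e \<in> I"
        using h ne by (intro block_pfaffians_independent [OF M4(1) dist b4 psi4 ab4 _ _ _ _ h0]) auto
      then show "\<forall>i\<in>{c, d, e}. h i \<in> I"
        using ne by auto
    qed
    moreover have "M4 = act (rank1 y (axis b 1) ** (rank1 (axis a 1) x ** (A2 ** E))) (mat 1) M"
      by (simp add: M4_def M3_def M2_eq act_act)
    moreover have "rank1 y (axis b 1) ** (rank1 (axis a 1) x ** (A2 ** E)) \<in> GL_over R"
      by (intro GL_mult E4 E3 A2E)
    ultimately show ?thesis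
      using dist'(2) psi4 by blast
  qed
qed simp

end

section \<open>Discrete valuations\<close>

text \<open>The fractional ideal of multiples of \<pi>^n; negative \<open>n\<close> serves to bound
  denominators.\<close>

definition val_ge :: "('k::field \<Rightarrow> int) \<Rightarrow> int \<Rightarrow> 'k set" where
  "val_ge v n = {x. x = 0 \<or> n \<le> v x}"

definition dg :: "('n \<Rightarrow> 'a::comm_ring_1) \<Rightarrow> 'a^'n::finite^'n" where
  "dg g = (\<chi> i j. if i = j then g i else 0)"

lemma det_dg: "det (dg g) = (\<Prod>i\<in>UNIV. g i)"
  by (subst det_diagonal) (simp_all add: dg_def)

lemma dg_nth: "dg g $ i = g i *s axis i 1"
  by (auto simp: dg_def axis_def vec_eq_iff)

lemma act_dg: "act (dg g) (mat c) M $ i $ j = (c * g i * g j) *s M $ i $ j"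
  by (simp add: act_mat dg_nth form_scale vec_eq_iff)

lemma mat_mult_mat: "mat a ** mat b = (mat (a * b) :: 'a::comm_ring_1^'n::finite^'n)"
  using matrix_vector_mul_assoc [of "mat a" "mat b"]
  by (intro matrix_eq [THEN iffD2] allI) (simp add: mat_mult_vec matrix_vector_mul_assoc [symmetric])

lemma prod_if_card: "(\<Prod>i\<in>UNIV. if i \<in> S then c else 1) = (c :: 'a::comm_ring_1) ^ card (S :: 'n::finite set)"
  by (simp add: prod.If_cases)

locale dvr =
  fixes v :: "'k::field \<Rightarrow> int" and \<pi> :: 'k
  assumes valuation: "discrete_valuation v" and unif: "uniformiser v \<pi>"
begin

lemma v_mult: "x \<noteq> 0 \<Longrightarrow> y \<noteq> 0 \<Longrightarrow> v (x * y) = v x + v y"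
  and v_add: "x \<noteq> 0 \<Longrightarrow> y \<noteq> 0 \<Longrightarrow> x + y \<noteq> 0 \<Longrightarrow> min (v x) (v y) \<le> v (x + y)"
  using valuation by (auto simp: discrete_valuation_def)

lemma pi: "\<pi> \<noteq> 0" "v \<pi> = 1"
  using unif by (auto simp: uniformiser_def)

lemma v_one: "v 1 = 0"
  using v_mult [of 1 1] by simp

lemma v_uminus: "v (- x) = v x"
proof (cases "x = 0")
  case False
  have "v (-1) = 0"
    using v_mult [of "-1" "-1"] v_one by simp
  then show ?thesis
    using v_mult [of "-1" x] False by simp
qed simp

lemma v_inverse: "x \<noteq> 0 \<Longrightarrow> v (inverse x) = - v x"
  using v_mult [of x "inverse x"] v_one by simp

lemma v_power: "x \<noteq> 0 \<Longrightarrow> v (x ^ n) = int n * v x"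
  by (induction n) (simp_all add: v_one v_mult algebra_simps)

lemma v_pi_power_int: "v (\<pi> powi n) = n"
  by (cases "n \<ge> 0") (simp_all add: power_int_def v_power v_inverse pi)

lemma val_ge_0 [simp]: "0 \<in> val_ge v n"
  by (simp add: val_ge_def)

lemma val_ring_eq: "val_ring v = val_ge v 0" and max_ideal_eq: "max_ideal v = val_ge v 1"
  by (simp_all add: val_ring_def max_ideal_def val_ge_def)

lemma val_ge_add: "x \<in> val_ge v n \<Longrightarrow> y \<in> val_ge v n \<Longrightarrow> x + y \<in> val_ge v n"
  using v_add [of x y] by (cases "x = 0 \<or> y = 0 \<or> x + y = 0") (auto simp: val_ge_def)

lemma val_ge_mult: "x \<in> val_ge v m \<Longrightarrow> y \<in> val_ge v n \<Longrightarrow> x * y \<in> val_ge v (m + n)"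
  by (cases "x = 0 \<or> y = 0") (auto simp: val_ge_def v_mult)

lemma val_ge_mono: "m \<le> n \<Longrightarrow> x \<in> val_ge v n \<Longrightarrow> x \<in> val_ge v m"
  by (auto simp: val_ge_def)

lemma val_ge_self: "x \<in> val_ge v (v x)"
  by (simp add: val_ge_def)

lemma val_ge_sum: "(\<And>i. i \<in> S \<Longrightarrow> f i \<in> val_ge v n) \<Longrightarrow> sum f S \<in> val_ge v n"
  by (induction S rule: infinite_finite_induct) (simp_all add: val_ge_add)

lemma val_ge_scale: "x \<noteq> 0 \<Longrightarrow> x * y \<in> val_ge v n \<longleftrightarrow> y \<in> val_ge v (n - v x)"
  by (cases "y = 0") (auto simp: val_ge_def v_mult)

lemma val_ge_powi: "\<pi> powi n \<in> val_ge v n"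
  by (simp add: val_ge_def v_pi_power_int)

lemma subring_ideal_val_ge: "0 \<le> n \<Longrightarrow> subring_ideal (val_ring v) (val_ge v n)"
proof
  assume n: "0 \<le> n"
  show "val_ge v n \<subseteq> val_ring v"
    using val_ge_mono [OF n] by (auto simp: val_ring_eq)
  show "x * y \<in> val_ring v" if "x \<in> val_ring v" "y \<in> val_ring v" for x y
    using val_ge_mult [of x 0 y 0] that by (simp add: val_ring_eq)
  show "x * y \<in> val_ge v n" if "x \<in> val_ring v" "y \<in> val_ge v n" for x y
    using val_ge_mult [of x 0 y n] that by (simp add: val_ring_eq)
  show "- x \<in> val_ring v" if "x \<in> val_ring v" for x
    using that by (auto simp: val_ring_def v_uminus)
  show "1 \<in> val_ring v"
    by (simp add: val_ring_def v_one)
qed (auto simp: val_ring_eq val_ge_add)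

sublocale local_subring "val_ring v" "max_ideal v"
proof -
  interpret subring_ideal "val_ring v" "max_ideal v"
    unfolding max_ideal_eq by (rule subring_ideal_val_ge) simp
  show "local_subring (val_ring v) (max_ideal v)"
    by unfold_locales (auto simp: val_ring_def max_ideal_def v_one v_inverse)
qed

lemma unit_iff: "x \<in> val_ring v \<Longrightarrow> x \<notin> max_ideal v \<longleftrightarrow> x \<noteq> 0 \<and> v x = 0"
  by (auto simp: val_ring_def max_ideal_def)

lemma integral_model_iff: "integral_model v M \<longleftrightarrow> int_model M"
  by (simp add: integral_model_def int_model_def vec_in_def)

lemma v_det_GL:
  assumes "A \<in> GL_over (val_ring v)"
  shows "det A \<noteq> 0" "v (det A) = 0"
proof -
  obtain A' where A': "A' \<in> GL_over (val_ring v)" "A ** A' = mat 1"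
    using GL_inverse [OF assms] by blast
  then have "det A * det A' = 1"
    by (metis det_mul det_I)
  then show nz: "det A \<noteq> 0"
    by auto
  have "det A' \<noteq> 0"
    using \<open>det A * det A' = 1\<close> by auto
  with \<open>det A * det A' = 1\<close> nz have "v (det A) + v (det A') = 0"
    using v_mult [of "det A" "det A'"] v_one by auto
  moreover have "det A \<in> val_ring v" "det A' \<in> val_ring v"
    using assms A' by (auto intro!: det_in_R GL_entry)
  ultimately show "v (det A) = 0"
    using nz \<open>det A' \<noteq> 0\<close> by (auto simp: val_ring_def)
qed

lemma minimal_value:
  fixes f :: "'i::finite \<Rightarrow> 'k"
  assumes "f i0 \<noteq> 0"
  obtains i where "f i \<noteq> 0" "\<And>j. f j \<in> val_ge v (v (f i))"
proof -
  let ?S = "{i. f i \<noteq> 0}"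
  have "Min ((v \<circ> f) ` ?S) \<in> (v \<circ> f) ` ?S"
    using assms by (intro Min_in) auto
  then obtain i where i: "f i \<noteq> 0" "v (f i) = Min ((v \<circ> f) ` ?S)"
    by auto
  have "f j \<in> val_ge v (v (f i))" for j
    unfolding i(2) by (auto simp: val_ge_def intro!: Min_le)
  with i(1) show ?thesis
    by (rule that)
qed

end

section \<open>Models whose Pfaffians are a multiple of independent quadrics\<close>

text \<open>The situation that Step 1 leaves behind. By \<open>step1_scaled_model\<close> the
  constant \<open>c\<close> is \<open>\<mu> ^ 2 * det A\<close> for the matrix and scalar of that
  step.\<close>

locale scaled_model = dvr v \<pi> for v :: "'k::field \<Rightarrow> int" and \<pi> :: 'k +
  fixes M :: "'k model" and q :: "5 \<Rightarrow> (5, 'k) mpoly" and c :: 'k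
  assumes M: "int_model M" and primitive: "\<exists>i j k. M $ i $ j $ k \<notin> max_ideal v"
    and q_int: "\<And>i. integral_poly v (q i)" and q_ind: "independent_mod v q"
    and c0: "c \<noteq> 0" and pf_M: "\<And>i. pf M i = mconst c * q i"
begin

text \<open>Dividing by the power of \<pi> in the smallest coefficient would otherwise give a
  combination with a unit coefficient that vanishes modulo \<pi>.\<close>

lemma coefficients_in:
  assumes "\<And>m. (\<Sum>i\<in>UNIV. n i * Poly_Mapping.lookup (q i) m) \<in> val_ge v r"
  shows "n j \<in> val_ge v r"
proof (rule ccontr)
  assume j: "n j \<notin> val_ge v r"
  then have "n j \<noteq> 0"
    by (auto simp: val_ge_def)
  then obtain b where b: "n b \<noteq> 0" "\<And>i. n i \<in> val_ge v (v (n b))"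
    by (rule minimal_value) (rule that)
  define s where "s = v (n b)"
  have "s < r"
    using j b(2) [of j] val_ge_mono [of r s] unfolding s_def by force
  define d where "d i = \<pi> powi (- s) * n i" for i
  have d: "d i \<in> val_ring v" for i
    using val_ge_mult [OF val_ge_powi [of "- s"] b(2) [of i]] by (simp add: d_def s_def val_ring_eq)
  have "Poly_Mapping.lookup (\<Sum>i\<in>UNIV. mconst (d i) * q i) m \<in> max_ideal v" for m
  proof -
    have "Poly_Mapping.lookup (\<Sum>i\<in>UNIV. mconst (d i) * q i) m =
        \<pi> powi (- s) * (\<Sum>i\<in>UNIV. n i * Poly_Mapping.lookup (q i) m)"
      by (simp add: lookup_sum lookup_mconst_mult d_def sum_distrib_left mult.assoc)
    also have "\<dots> \<in> val_ge v (- s + r)"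
      by (rule val_ge_mult [OF val_ge_powi assms])
    finally show ?thesis
      using val_ge_mono [of 1 "- s + r"] \<open>s < r\<close> by (simp add: max_ideal_eq)
  qed
  then have "d b \<in> max_ideal v"
    using q_ind d by (simp add: independent_mod_def)
  moreover have "d b \<noteq> 0" "v (d b) = 0"
    using b(1) pi by (simp_all add: d_def s_def v_mult v_pi_power_int)
  ultimately show False
    by (simp add: max_ideal_def)
qed

abbreviation qc :: "5 \<Rightarrow> 5 \<Rightarrow> 5 \<Rightarrow> 'k" where
  "qc i k l \<equiv> Poly_Mapping.lookup (q i) (mono2 k l)"

lemma qc_in: "qc i k l \<in> val_ring v"
  using q_int by (auto simp: integral_poly_def)

text \<open>The transformation law solved for the new Pfaffians by the inverse transpose of
  \<open>A\<close>; the factor \<mu>^2 arises because Pfaffians are quadratic in the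
  entries.\<close>

lemma pf_equivalent:
  fixes \<mu> :: 'k
  assumes A: "A ** A' = mat 1"
  defines "N \<equiv> (\<chi> i j. (\<mu> ^ 2 * det A * c) * A' $ j $ i)"
  shows "pf (act A (mat \<mu>) M) i = (\<Sum>j\<in>UNIV. mconst (N $ i $ j) * q j)"
proof -
  have A': "A' ** A = mat 1"
    using A by (rule matrix_left_right_inverse [THEN iffD1])
  then have inv: "invertible A"
    using A unfolding invertible_def by blast
  let ?p = "pf (act A (mat 1) M)"
  have "(\<Sum>j\<in>UNIV. mconst (A' $ j $ i) * (mconst (det A) * pf M j)) =
      (\<Sum>j\<in>UNIV. mconst (A' $ j $ i) * (\<Sum>l\<in>UNIV. mconst (A $ l $ j) * ?p l))"
    using pf_act [OF inv int_model_alternating [OF M]] by simp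
  also have "\<dots> = (\<Sum>j\<in>UNIV. \<Sum>l\<in>UNIV. mconst (A $ l $ j * A' $ j $ i) * ?p l)"
    by (simp only: sum_distrib_left mconst_mult ac_simps)
  also have "\<dots> = (\<Sum>l\<in>UNIV. (\<Sum>j\<in>UNIV. mconst (A $ l $ j * A' $ j $ i)) * ?p l)"
    unfolding sum_distrib_right by (rule sum.swap)
  also have "\<dots> = (\<Sum>l\<in>UNIV. mconst ((A ** A') $ l $ i) * ?p l)"
    by (simp only: mconst_sum matrix_matrix_mult_def vec_lambda_beta)
  also have "\<dots> = (\<Sum>l\<in>UNIV. if l = i then ?p l else 0)"
    unfolding A by (rule sum.cong) (auto simp: mat_def)
  finally have p: "?p i = (\<Sum>j\<in>UNIV. mconst (A' $ j $ i) * (mconst (det A) * pf M j))"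
    by simp
  have "pf (act A (mat \<mu>) M) i =
      mconst (\<mu> ^ 2) * (\<Sum>j\<in>UNIV. mconst (A' $ j $ i) * (mconst (det A) * pf M j))"
    using pf_act_mat [of A \<mu> M i] p by simp
  then show ?thesis
    unfolding pf_M N_def vec_lambda_beta
    by (simp only: sum_distrib_left mconst_mult ac_simps)
qed

lemma N_integral:
  assumes A: "A ** A' = mat 1" and int: "int_model (act A (mat \<mu>) M)"
  shows "(\<mu> ^ 2 * det A * c) * A' $ j $ i \<in> val_ring v"
proof -
  let ?N = "\<chi> i j. (\<mu> ^ 2 * det A * c) * A' $ j $ i"
  have "(\<Sum>j\<in>UNIV. ?N $ i $ j * Poly_Mapping.lookup (q j) m) \<in> val_ge v 0" for m
  proof -
    have *: "(\<Sum>j\<in>UNIV. ?N $ i $ j * Poly_Mapping.lookup (q j) m) =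
        Poly_Mapping.lookup (pf (act A (mat \<mu>) M) i) m"
      unfolding pf_equivalent [OF A] by (simp add: lookup_sum lookup_mconst_mult)
    show ?thesis
      unfolding * val_ring_eq [symmetric] by (rule pf_in_R [OF int])
  qed
  then have "?N $ i $ j \<in> val_ge v 0"
    by (rule coefficients_in)
  then show ?thesis
    by (simp add: val_ring_eq)
qed

text \<open>The right-hand side is the change of level. Let w be the least valuation in the inverse
  of \<open>A\<close>. Integrality of \<open>N\<close> gives 2 v(\<mu>) + v(det A) + v(c) + w \<ge>
  0. Going back to \<open>M\<close>, which has a unit coefficient, gives 2 w \<le> v(\<mu>). Twice
  the first inequality together with the second eliminates w.\<close>

lemma level_change_bound:
  assumes inv: "invertible A" and mu: "\<mu> \<noteq> 0" and int: "int_model (act A (mat \<mu>) M)"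
  shows "- 2 * v c \<le> 2 * v (det A) + 5 * v \<mu>"
proof -
  obtain A' where A: "A ** A' = mat 1" "A' ** A = mat 1"
    using inv unfolding invertible_def by blast
  have det: "det A \<noteq> 0"
    using inv invertible_iff_det by blast
  have "\<exists>a b. A' $ a $ b \<noteq> 0"
  proof (rule ccontr)
    assume "\<nexists>a b. A' $ a $ b \<noteq> 0"
    then have "(A ** A') $ 1 $ 1 = 0"
      by (simp add: matrix_matrix_mult_def)
    then show False
      by (simp add: A mat_def)
  qed
  then obtain a0 b0 where "(\<lambda>p. A' $ fst p $ snd p) (a0, b0) \<noteq> 0"
    by auto
  then obtain p where "A' $ fst p $ snd p \<noteq> 0"
    "\<And>r. A' $ fst r $ snd r \<in> val_ge v (v (A' $ fst p $ snd p))"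
    by (rule minimal_value) (rule that)
  then obtain a b where ab: "A' $ a $ b \<noteq> 0" "\<And>i j. A' $ i $ j \<in> val_ge v (v (A' $ a $ b))"
    by (metis fst_conv snd_conv)
  define w where "w = v (A' $ a $ b)"
  have "0 \<le> v ((\<mu> ^ 2 * det A * c) * A' $ a $ b)"
    using N_integral [OF A(1) int, of a b] ab(1) mu det c0 by (simp add: val_ring_def)
  also have "\<dots> = 2 * v \<mu> + v (det A) + v c + w"
    using ab(1) mu det c0 by (simp add: v_mult v_power w_def)
  finally have 1: "0 \<le> 2 * v \<mu> + v (det A) + v c + w" .
  obtain i j k where ijk: "M $ i $ j $ k \<notin> max_ideal v"
    using primitive by blast
  have "M = act A' (mat (inverse \<mu>)) (act A (mat \<mu>) M)"
    using mu by (simp add: act_act A mat_mult_mat)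
  then have "M $ i $ j = inverse \<mu> *s form (act A (mat \<mu>) M) (A' $ i) (A' $ j)"
    by (metis act_mat)
  then have "M $ i $ j $ k = inverse \<mu> * form (act A (mat \<mu>) M) (A' $ i) (A' $ j) $ k"
    by simp
  moreover have "form (act A (mat \<mu>) M) (A' $ i) (A' $ j) $ k \<in> val_ge v (w + w + 0)"
    unfolding form_nth w_def using int_model_vec_in [OF int]
    by (intro val_ge_sum val_ge_mult ab) (simp add: vec_in_def val_ring_eq)
  ultimately have "M $ i $ j $ k \<in> val_ge v (2 * w - v \<mu>)"
    using mu by (simp add: val_ge_scale v_inverse)
  then have "2 * w - v \<mu> \<le> 0"
    using ijk val_ge_mono [of 1 "2 * w - v \<mu>"] by (force simp: max_ideal_eq)
  with 1 show ?thesis by linarith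
qed

end

lemma ex_minimal_int:
  fixes f :: "'a \<Rightarrow> 'b \<Rightarrow> int"
  assumes "P a b" and bound: "\<And>a b. P a b \<Longrightarrow> k \<le> f a b"
  shows "\<exists>a b. P a b \<and> (\<forall>a' b'. P a' b' \<longrightarrow> f a b \<le> f a' b')"
proof -
  let ?Q = "\<lambda>p. P (fst p) (snd p)" and ?g = "\<lambda>p. nat (f (fst p) (snd p) - k)"
  obtain p where p: "?Q p" "\<And>p'. ?Q p' \<Longrightarrow> ?g p \<le> ?g p'"
    using ex_has_least_nat [of ?Q "(a, b)" ?g] assms(1) by auto
  have "f (fst p) (snd p) \<le> f a' b'" if "P a' b'" for a' b'
    using p(2) [of "(a', b')"] that bound [of a' b'] bound [OF p(1)] by simp
  with p(1) show ?thesis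
    by blast
qed

context subring_ideal
begin

lemma GL_permute_rows:
  fixes A :: "'k^'n::finite^'n"
  assumes "inj p" "A \<in> GL_over R"
  shows "(\<chi> i. A $ p i) \<in> GL_over R"
proof -
  define P :: "'k^'n^'n" where "P = (\<chi> i. axis (p i) 1)"
  have 1: "P ** transpose P = mat 1"
    using assms(1)
    by (auto simp: P_def matrix_matrix_mult_def transpose_def vec_eq_iff axis_def mat_def inj_def
        if_distrib [of "\<lambda>x. x * _"] cong: if_cong)
  then have 2: "transpose P ** P = mat 1"
    by (rule matrix_left_right_inverse [THEN iffD1])
  have "P $ i $ j \<in> R" "transpose P $ i $ j \<in> R" for i j
    by (auto simp: P_def transpose_def)
  with 1 2 have "P \<in> GL_over R"
    unfolding GL_over_def by blast
  moreover have "P ** A = (\<chi> i. A $ p i)"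
    by (simp add: vec_eq_iff matrix_matrix_mult_def P_def)
  ultimately show ?thesis
    using GL_mult assms(2) by metis
qed

end

section \<open>Stable equivalent models and their independent block\<close>

context scaled_model
begin

text \<open>The two rows and columns outside the block are multiplied by \<pi> and then everything
  is divided by \<pi>. The level changes by 2 * 2 - 5.\<close>

lemma zero_block_lowers:
  assumes "int_model K" "distinct [x, y, z]" "zero_block K x y z"
  obtains A \<nu> where "invertible A" "\<nu> \<noteq> 0" "int_model (act A (mat \<nu>) K)"
    "2 * v (det A) + 5 * v \<nu> = -1"
proof -
  define S where "S = UNIV - {x, y, z}"
  have "card S = 2"
    unfolding S_def using assms(2) by (subst card_Diff_subset) auto
  let ?A = "dg (\<lambda>i. if i \<in> S then \<pi> else 1)"
  have det: "det ?A = \<pi> ^ 2"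
    unfolding det_dg prod_if_card \<open>card S = 2\<close> ..
  note alt = int_model_alternating [OF assms(1)]
  have xyz: "vec_in (max_ideal v) (K $ x $ y)" "vec_in (max_ideal v) (K $ x $ z)"
    "vec_in (max_ideal v) (K $ y $ z)"
    using assms(3) by (simp_all add: zero_block_def)
  have "vec_in (max_ideal v) (K $ i $ j)" if "i \<notin> S" "j \<notin> S" for i j
    using that xyz xyz [THEN vec_in_flip [OF alt]]
    by (auto simp: S_def alternating_nth(1) [OF alt] vec_in_ops)
  then have K: "K $ i $ j $ k \<in> val_ge v (if i \<in> S \<or> j \<in> S then 0 else 1)" for i j k
    using int_model_vec_in [OF assms(1), of i j] by (auto simp: vec_in_def val_ring_eq max_ideal_eq)
  have "act ?A (mat (inverse \<pi>)) K $ i $ j $ k \<in> val_ring v" for i j k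
    using K [of i j k] pi
    by (auto simp: act_dg val_ring_eq val_ge_scale v_inverse v_mult v_one split: if_splits)
      (auto simp: val_ge_def)
  then have int: "int_model (act ?A (mat (inverse \<pi>)) K)"
    using alternating_act [OF int_model_alternating [OF assms(1)]] by (simp add: int_model_def vec_in_def)
  show ?thesis
    by (rule that [OF _ _ int]) (simp_all add: invertible_iff_det det pi v_power v_inverse)
qed

text \<open>Row and column \<open>x\<close> are divided by \<pi>; the entry divided twice is the
  zero on the diagonal.\<close>

lemma zero_row_lowers:
  assumes "int_model K" "\<And>y. vec_in (max_ideal v) (K $ x $ y)"
  obtains A \<nu> where "invertible A" "\<nu> \<noteq> 0" "int_model (act A (mat \<nu>) K)"
    "2 * v (det A) + 5 * v \<nu> = -2"
proof -
  let ?A = "dg (\<lambda>i. if i \<in> {x} then inverse \<pi> else 1)"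
  have det: "det ?A = inverse \<pi>"
    unfolding det_dg prod_if_card by simp
  have "vec_in (max_ideal v) (K $ i $ j)" if "i = x \<or> j = x" for i j
    using assms that vec_in_flip [OF int_model_alternating [OF assms(1)]] by auto
  then have K: "K $ i $ j $ k \<in> val_ge v (if i = x \<or> j = x then 1 else 0)" for i j k
    using int_model_vec_in [OF assms(1), of i j] by (auto simp: vec_in_def val_ring_eq max_ideal_eq)
  have "act ?A (mat 1) K $ i $ j $ k \<in> val_ring v" for i j k
    using K [of i j k] pi alternating_nth(1) [OF int_model_alternating [OF assms(1)], of i]
    by (auto simp: act_dg val_ring_eq val_ge_scale v_inverse v_mult v_one split: if_splits)
  then have int: "int_model (act ?A (mat 1) K)"
    using alternating_act [OF int_model_alternating [OF assms(1)]] by (simp add: int_model_def vec_in_def)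
  show ?thesis
  proof (rule that [OF _ _ int])
    show "invertible ?A" "2 * v (det ?A) + 5 * v (1::'k) = -2"
      unfolding invertible_iff_det det by (simp_all add: pi v_inverse v_one)
  qed simp
qed

text \<open>The level changes of integral models [A, \<mu> I] M are bounded below, so a least one
  exists; at it neither destabilising pattern can occur.\<close>

lemma exists_stable:
  obtains A \<mu> where "invertible A" "\<mu> \<noteq> 0" "int_model (act A (mat \<mu>) M)"
    "stable (act A (mat \<mu>) M)"
proof -
  define P where "P A \<mu> \<longleftrightarrow> invertible A \<and> \<mu> \<noteq> 0 \<and> int_model (act A (mat \<mu>) M)" for A \<mu>
  have "P (mat 1) 1"
    using M by (simp add: P_def invertible_iff_det)
  moreover have "- 2 * v c \<le> 2 * v (det A) + 5 * v \<mu>" if "P A \<mu>" for A \<mu>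
    using that level_change_bound by (simp add: P_def)
  ultimately have "\<exists>A \<mu>. P A \<mu> \<and> (\<forall>A' \<mu>'. P A' \<mu>' \<longrightarrow>
      2 * v (det A) + 5 * v \<mu> \<le> 2 * v (det A') + 5 * v \<mu>')"
    by (rule ex_minimal_int [of P "mat 1" 1 _ "\<lambda>A \<mu>. 2 * v (det A) + 5 * v \<mu>"])
  then obtain A \<mu> where A: "P A \<mu>"
    and min: "\<And>A' \<mu>'. P A' \<mu>' \<Longrightarrow> 2 * v (det A) + 5 * v \<mu> \<le> 2 * v (det A') + 5 * v \<mu>'"
    by blast
  have dA: "det A \<noteq> 0" and mu: "\<mu> \<noteq> 0" and int: "int_model (act A (mat \<mu>) M)"
    using A by (simp_all add: P_def invertible_iff_det)
  have low: False if B: "B \<in> GL_over (val_ring v)" and C: "invertible C" "\<nu> \<noteq> 0"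
    "int_model (act C (mat \<nu>) (act B (mat 1) (act A (mat \<mu>) M)))"
    "2 * v (det C) + 5 * v \<nu> < 0" for B C \<nu>
  proof -
    have "act C (mat \<nu>) (act B (mat 1) (act A (mat \<mu>) M)) = act (C ** (B ** A)) (mat (\<nu> * \<mu>)) M"
      by (simp add: act_act mat_mult_mat matrix_mul_assoc)
    then have "P (C ** (B ** A)) (\<nu> * \<mu>)"
      using C mu dA v_det_GL [OF B] by (simp add: P_def invertible_iff_det det_mul)
    then have "2 * v (det A) + 5 * v \<mu> \<le> 2 * v (det (C ** (B ** A))) + 5 * v (\<nu> * \<mu>)"
      by (rule min)
    also have "\<dots> = (2 * v (det C) + 5 * v \<nu>) + (2 * v (det A) + 5 * v \<mu>)"
      using C mu dA v_det_GL [OF B] by (simp add: det_mul v_mult invertible_iff_det)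
    finally show False
      using C(4) by simp
  qed
  have "stable (act A (mat \<mu>) M)"
    unfolding stable_def
  proof (intro ballI conjI allI impI notI)
    fix B x y z assume B: "B \<in> GL_over (val_ring v)" and "distinct [x, y, z]"
      and "zero_block (act B (mat 1) (act A (mat \<mu>) M)) x y z"
    then obtain C \<nu> where C: "invertible C" "\<nu> \<noteq> 0"
        "int_model (act C (mat \<nu>) (act B (mat 1) (act A (mat \<mu>) M)))" "2 * v (det C) + 5 * v \<nu> = -1"
      using zero_block_lowers int_model_act [OF int GL_entry [OF B]] by metis
    then show False
      using low [OF B C(1-3)] C(4) by simp
  next
    fix B :: "'k^5^5" and x assume B: "B \<in> GL_over (val_ring v)"
    show "\<exists>y. \<not> vec_in (max_ideal v) (act B (mat 1) (act A (mat \<mu>) M) $ x $ y)"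
    proof (rule ccontr)
      assume "\<nexists>y. \<not> vec_in (max_ideal v) (act B (mat 1) (act A (mat \<mu>) M) $ x $ y)"
      then obtain C \<nu> where C: "invertible C" "\<nu> \<noteq> 0"
          "int_model (act C (mat \<nu>) (act B (mat 1) (act A (mat \<mu>) M)))" "2 * v (det C) + 5 * v \<nu> = -2"
        using zero_row_lowers int_model_act [OF int GL_entry [OF B]] by metis
      then show False
        using low [OF B C(1-3)] C(4) by simp
    qed
  qed
  with A show ?thesis
    using that unfolding P_def by blast
qed

lemma N_transpose:
  fixes k :: 'k and A A' :: "'k^5^5"
  assumes A: "A ** A' = mat 1"
  defines "N \<equiv> (\<chi> i j. k * A' $ j $ i)"
  shows "N ** transpose A = mat k" "transpose A ** N = mat k"
proof -
  have A': "A' ** A = mat 1"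
    using A by (rule matrix_left_right_inverse [THEN iffD1])
  have "(N ** transpose A) $ i $ j = k * (A ** A') $ j $ i"
    "(transpose A ** N) $ i $ j = k * (A' ** A) $ j $ i" for i j
    by (simp_all add: N_def matrix_matrix_mult_def transpose_def sum_distrib_left ac_simps)
  then show "N ** transpose A = mat k" "transpose A ** N = mat k"
    unfolding A A' by (auto simp: vec_eq_iff mat_def)
qed

text \<open>The rows of \<open>N\<close> are the coordinates of the new Pfaffians in the quadrics
  \<open>q j\<close>. As these are independent modulo \<pi>, vanishing and independence of Pfaffians
  modulo \<pi> pass to the rows.\<close>

lemma N_rows:
  fixes \<mu> :: 'k
  assumes A: "A ** A' = mat 1" and int: "int_model (act A (mat \<mu>) M)"
    and pb: "pfaffian_basis (act A (mat \<mu>) M) S"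
  defines "N \<equiv> (\<chi> i j. (\<mu> ^ 2 * det A * c) * A' $ j $ i)"
  shows "i \<notin> S \<Longrightarrow> N $ i $ j \<in> max_ideal v"
    and "\<exists>G\<in>GL_over (val_ring v). \<forall>j\<in>S. G *v N $ j = axis j 1"
proof -
  let ?K = "act A (mat \<mu>) M"
  have NR: "N $ i $ j \<in> val_ring v" for i j
    unfolding N_def using N_integral [OF A int] by simp
  have pf: "pf ?K i = (\<Sum>j\<in>UNIV. mconst (N $ i $ j) * q j)" for i
    unfolding N_def by (rule pf_equivalent [OF A])
  have look: "Poly_Mapping.lookup (pf ?K i) m = (\<Sum>j\<in>UNIV. N $ i $ j * Poly_Mapping.lookup (q j) m)" for i m
    unfolding pf by (simp add: lookup_sum lookup_mconst_mult)
  {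
    assume i: "i \<notin> S"
    have "(\<Sum>j\<in>UNIV. N $ i $ j * Poly_Mapping.lookup (q j) m) \<in> val_ge v 1" for m
    proof (cases "Poly_Mapping.lookup (pf ?K i) m = 0")
      case False
      then obtain k l where m: "m = mono2 k l"
        using pf_support by blast
      have "pfc ?K i k l \<in> max_ideal v"
        using pb i unfolding pfaffian_basis_def by blast
      then show ?thesis
        by (simp add: look [symmetric] m pfc_def max_ideal_eq)
    next
      case True
      then show ?thesis by (simp add: look [symmetric])
    qed
    then show "N $ i $ j \<in> max_ideal v"
      unfolding max_ideal_eq by (rule coefficients_in)
  }
  have "\<exists>G\<in>GL_over (val_ring v). generated G \<and> (\<forall>j\<in>S. G *v N $ j = axis j 1)"
  proof (rule reduce_independent)
    show "N $ j $ k \<in> val_ring v" for j k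
      by (rule NR)
    fix d assume d: "\<And>j. j \<in> S \<Longrightarrow> d j \<in> val_ring v" "\<And>k. (\<Sum>j\<in>S. d j * N $ j $ k) \<in> max_ideal v"
    have "(\<Sum>i\<in>S. d i * pfc ?K i k l) \<in> max_ideal v" for k l
    proof -
      have "(\<Sum>i\<in>S. d i * pfc ?K i k l) = (\<Sum>i\<in>S. \<Sum>j\<in>UNIV. d i * N $ i $ j * qc j k l)"
        by (simp add: pfc_def look sum_distrib_left mult.assoc)
      also have "\<dots> = (\<Sum>j\<in>UNIV. \<Sum>i\<in>S. d i * N $ i $ j * qc j k l)"
        by (rule sum.swap)
      also have "\<dots> \<in> max_ideal v"
        unfolding sum_distrib_right [symmetric] by (intro I_sum I_mult' d qc_in)
      finally show ?thesis .
    qed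
    then show "\<forall>j\<in>S. d j \<in> max_ideal v"
      using pb d(1) unfolding pfaffian_basis_def by blast
  qed
  then show "\<exists>G\<in>GL_over (val_ring v). \<forall>j\<in>S. G *v N $ j = axis j 1"
    by blast
qed

text \<open>
  Transporting the \<open>3 \<times> 3\<close> block of a stable equivalent model back to the model itself: modulo the
  maximal ideal the two blocks agree up to a unit.
\<close>
lemma exists_independent_block:
  assumes vc: "0 < v c"
  obtains B where "B \<in> GL_over (val_ring v)"
    "independent3 (act B (mat 1) M $ 3 $ 4) (act B (mat 1) M $ 3 $ 5) (act B (mat 1) M $ 4 $ 5)"
proof -
  obtain A \<mu> where A: "invertible A" and mu: "\<mu> \<noteq> 0" and int: "int_model (act A (mat \<mu>) M)"
    and st: "stable (act A (mat \<mu>) M)"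
    by (rule exists_stable)
  \<comment> \<open>Five independent Pfaffians would make \<open>N\<close> invertible over the
    valuation ring. With k = \<mu>^2 det(A) c, the identity det N * det A = k^5 would then give 2
    v(det A) + 5 v(\<mu>) = -(5/2) v(c), less than the permitted -2 v(c).\<close>
  have "\<not> pfaffian_basis (act A (mat \<mu>) M) UNIV"
  proof
    assume pb: "pfaffian_basis (act A (mat \<mu>) M) UNIV"
    obtain A' where A': "A ** A' = mat 1"
      using A unfolding invertible_def by blast
    let ?k = "\<mu> ^ 2 * det A * c"
    define N :: "'k^5^5" where "N = (\<chi> i j. ?k * A' $ j $ i)"
    obtain G where G: "G \<in> GL_over (val_ring v)" "\<And>j. G *v N $ j = axis j 1"
      using N_rows(2) [OF A' int pb] unfolding N_def by blast
    have "(G ** transpose N) $ i $ j = (mat 1 :: 'k^5^5) $ i $ j" for i j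
      using arg_cong [OF G(2) [of j], of "\<lambda>x. x $ i"]
      by (auto simp: matrix_vector_mult_def matrix_matrix_mult_def transpose_def axis_def mat_def)
    then have "G ** transpose N = mat 1"
      by (simp add: vec_eq_iff)
    then have "det G * det N = 1"
      by (metis det_I det_mul det_transpose)
    then have "det N \<noteq> 0" and "v (det G) + v (det N) = 0"
      using v_mult [of "det G" "det N"] v_one by (metis mult_zero_right zero_neq_one mult_zero_left)+
    then have vN: "v (det N) = 0"
      using v_det_GL [OF G(1)] by simp
    have dA: "det A \<noteq> 0"
      using A invertible_iff_det by blast
    have "det N * det A = det (mat ?k :: 'k^5^5)"
      using N_transpose(1) [OF A', of ?k] unfolding N_def by (metis det_mul det_transpose)
    also have "\<dots> = ?k ^ 5"
      by (subst det_diagonal) (auto simp: mat_def)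
    finally have "v (det N) + v (det A) = 5 * v ?k"
      using \<open>det N \<noteq> 0\<close> dA mu c0 by (simp add: v_mult [symmetric] v_power)
    moreover have "v ?k = 2 * v \<mu> + v (det A) + v c"
      using mu dA c0 by (simp add: v_mult v_power)
    ultimately show False
      using vN vc level_change_bound [OF A mu int] by simp
  qed
  then obtain B c' d e S where B: "B \<in> GL_over (val_ring v)" and dist: "distinct [c', d, e]"
    and S: "{c', d, e} \<subseteq> S"
    and ind: "independent3 (act B (mat 1) (act A (mat \<mu>) M) $ c' $ d)
        (act B (mat 1) (act A (mat \<mu>) M) $ c' $ e) (act B (mat 1) (act A (mat \<mu>) M) $ d $ e)"
    and pb: "pfaffian_basis (act B (mat 1) (act A (mat \<mu>) M)) S"
    using stable_pfaffians [OF int st] by blast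
  define A1 where "A1 = B ** A"
  have eq: "act B (mat 1) (act A (mat \<mu>) M) = act A1 (mat \<mu>) M"
    by (simp add: act_act A1_def)
  define K where "K = act A1 (mat \<mu>) M"
  have intK: "int_model K"
    using int_model_act [OF int GL_entry [OF B]] by (simp add: eq K_def)
  have dA1: "det A1 \<noteq> 0"
    using A v_det_GL [OF B] by (simp add: A1_def det_mul invertible_iff_det)
  obtain A' where A': "A1 ** A' = mat 1"
    using dA1 unfolding invertible_iff_det [symmetric] invertible_def by blast
  let ?k = "\<mu> ^ 2 * det A1 * c"
  define N :: "'k^5^5" where "N = (\<chi> i j. ?k * A' $ j $ i)"
  have NR: "N $ i $ j \<in> val_ring v" for i j
    unfolding N_def using N_integral [OF A'] intK by (simp add: K_def)
  note pbK = pb [unfolded eq]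
  have NI: "N $ i $ j \<in> max_ideal v" if "i \<notin> S" for i j
    unfolding N_def using N_rows(1) [OF A' intK [unfolded K_def] pbK that] .
  obtain G where G: "G \<in> GL_over (val_ring v)" "\<And>j. j \<in> S \<Longrightarrow> G *v N $ j = axis j 1"
    using N_rows(2) [OF A' intK [unfolded K_def] pbK] unfolding N_def by blast
  \<comment> \<open>\<open>N\<close> is \<open>?k\<close> times the inverse transpose of
    \<open>A1\<close>, so pulling \<open>K\<close> back along it undoes \<open>A1\<close>: each
    argument contributes a factor \<open>?k\<close>, and the substitution contributes \<mu>.\<close>
  let ?\<delta> = "\<mu> * ?k * ?k"
  have form_N: "form K (N *v x) (N *v y) = ?\<delta> *s form M x y" for x y
  proof -
    have *: "transpose A1 *v (N *v x) = ?k *s x" for x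
      using N_transpose(2) [OF A', of ?k] unfolding N_def
      by (simp add: matrix_vector_mul_assoc mat_mult_vec)
    show ?thesis
      unfolding K_def form_act * mat_mult_vec form_scale by (simp add: vec_eq_iff)
  qed
  have GR: "vec_in (val_ring v) (G $ j)" for j
    using GL_entry [OF G(1)] by (simp add: vec_in_def)
  \<comment> \<open>Entry \<open>i\<close> of \<open>N\<close> applied to row \<open>j\<close> of
    \<open>G\<close> equals entry \<open>j\<close> of \<open>G\<close> applied to row
    \<open>i\<close> of \<open>N\<close>. This is 0 or 1 for \<open>i\<close> in \<open>S\<close>,
    and for other \<open>i\<close> that row of \<open>N\<close> vanishes modulo \<pi>.\<close>
  have near: "vec_in (max_ideal v) (N *v G $ j - axis j 1)" if "j \<in> S" for j
    unfolding vec_in_def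
  proof
    fix i
    have *: "(N *v G $ j) $ i = (G *v N $ i) $ j"
      by (simp add: matrix_vector_mult_def mult.commute)
    show "(N *v G $ j - axis j 1) $ i \<in> max_ideal v"
    proof (cases "i \<in> S")
      case True
      then show ?thesis
        using G(2) [OF True] by (simp add: * axis_def)
    next
      case False
      then have "(G *v N $ i) $ j \<in> max_ideal v"
        using NI by (intro I_matrix_vector GL_entry [OF G(1)]) auto
      then show ?thesis
        using False that by (auto simp: * axis_def)
    qed
  qed
  have block: "vec_in (max_ideal v) (?\<delta> *s form M (G $ i) (G $ j) - K $ i $ j)" if "i \<in> S" "j \<in> S" for i j
  proof -
    let ?x = "N *v G $ i - axis i 1" and ?y = "N *v G $ j - axis j 1"
    have yR: "vec_in (val_ring v) ?y" "vec_in (val_ring v) ?x"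
      using near that vec_in_R by blast+
    have "N *v G $ i = axis i 1 + ?x" "N *v G $ j = axis j 1 + ?y"
      by simp_all
    then have "form K (N *v G $ i) (N *v G $ j) =
        form K (axis i 1 + ?x) (axis j 1 + ?y)" by simp
    also have "\<dots> = K $ i $ j + (form K (axis i 1) ?y + form K ?x (axis j 1) + form K ?x ?y)"
      by (simp only: form_add form_axis ac_simps)
    finally have e: "?\<delta> *s form M (G $ i) (G $ j) - K $ i $ j =
        form K (axis i 1) ?y + form K ?x (axis j 1) + form K ?x ?y"
      unfolding form_N by simp
    have "form K x y $ k \<in> max_ideal v" if "vec_in (max_ideal v) x" "vec_in (val_ring v) y" for x y k
      using that int_model_vec_in [OF intK] unfolding form_nth vec_in_def
      by (intro I_sum I_mult' ) auto
    moreover have "form K x y $ k \<in> max_ideal v" if "vec_in (val_ring v) x" "vec_in (max_ideal v) y" for x y k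
      using that int_model_vec_in [OF intK] unfolding form_nth vec_in_def
      by (intro I_sum I_mult' I_mult) auto
    ultimately show ?thesis
      unfolding e using near that yR by (intro vec_in_ops(6)) (simp_all add: vec_in_def)
  qed
  have "?\<delta> \<noteq> 0"
    using mu c0 dA1 by simp
  \<comment> \<open>The products of \<delta> with the coefficients of \<open>M\<close> are integral,
    and one of these coefficients is a unit.\<close>
  have d1: "?\<delta> \<in> val_ring v"
  proof -
    obtain i j k where ijk: "M $ i $ j $ k \<notin> max_ideal v"
      using primitive by blast
    have "vec_in (val_ring v) (N *v axis l 1)" for l
      unfolding vec_in_def using NR by (intro allI R_matrix_vector) auto
    then have "vec_in (val_ring v) (form K (N *v axis i 1) (N *v axis j 1))"
      by (intro form_in int_model_vec_in intK) simp_all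
    then have "vec_in (val_ring v) (?\<delta> *s M $ i $ j)"
      unfolding form_N form_axis .
    then have "M $ i $ j $ k * ?\<delta> \<in> val_ge v 0"
      by (simp add: vec_in_def val_ring_eq mult.commute)
    moreover have "M $ i $ j $ k \<noteq> 0" "v (M $ i $ j $ k) = 0"
      using ijk unit_iff int_model_vec_in [OF M] by (auto simp: vec_in_def)
    ultimately show ?thesis
      by (simp add: val_ge_scale val_ring_eq)
  qed
  note indK = ind [unfolded eq, folded K_def]
  have in_S: "c' \<in> S" "d \<in> S" "e \<in> S"
    using S by auto
  have formR: "vec_in (val_ring v) (form M (G $ i) (G $ j))" for i j
    using form_in [of "val_ring v" M, OF int_model_vec_in [OF M] GR GR] by simp
  have ind1: "independent3 (form M (G $ c') (G $ d)) (form M (G $ c') (G $ e)) (form M (G $ d) (G $ e))"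
    unfolding independent3_def
  proof (intro ballI impI)
    fix r s t assume rst: "r \<in> val_ring v" "s \<in> val_ring v" "t \<in> val_ring v"
      and rel: "vec_in (max_ideal v) (r *s form M (G $ c') (G $ d) + s *s form M (G $ c') (G $ e) +
        t *s form M (G $ d) (G $ e))"
    let ?X = "?\<delta> *s (r *s form M (G $ c') (G $ d) + s *s form M (G $ c') (G $ e) + t *s form M (G $ d) (G $ e))"
    let ?D = "\<lambda>i j. ?\<delta> *s form M (G $ i) (G $ j) - K $ i $ j"
    have "r *s K $ c' $ d + s *s K $ c' $ e + t *s K $ d $ e =
        ?X - r *s ?D c' d - s *s ?D c' e - t *s ?D d e"
      by (simp add: vec_eq_iff algebra_simps)
    also have "vec_in (max_ideal v) \<dots>"
      by (intro vec_in_ops(7) vec_in_ops(9) rst d1 rel block in_S)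
    finally show "r \<in> max_ideal v \<and> s \<in> max_ideal v \<and> t \<in> max_ideal v"
      using indK rst unfolding independent3_def by blast
  qed
  obtain a b where "distinct [a, b, c', d, e]"
  proof -
    obtain a b where "distinct [c', a, b, d, e]"
      using dist by (rule complete_distinct)
    then have "distinct [a, b, c', d, e]"
      by auto
    then show ?thesis by (rule that)
  qed
  then obtain p :: "5 \<Rightarrow> 5" where p: "inj p" "p 1 = a" "p 2 = b" "p 3 = c'" "p 4 = d" "p 5 = e"
    by (rule permutation_5) (rule that)
  have "(\<chi> i. G $ p i) \<in> GL_over (val_ring v)"
    by (rule GL_permute_rows [OF p(1) G(1)])
  moreover have "act (\<chi> i. G $ p i) (mat 1) M $ i $ j = form M (G $ p i) (G $ p j)" for i j
    by (simp add: act_nth)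
  ultimately show ?thesis
    using ind1 that by (simp add: p)
qed

end

section \<open>Dividing rows and columns in Step 2\<close>

lemma divide_rows_cols_eq:
  "divide_rows_cols S c M = act (dg (\<lambda>i. if i \<in> S then inverse c else 1)) (mat 1) M"
  by (rule model_eqI) (auto simp: act_dg divide_rows_cols_def vec_eq_iff)

lemma act_nth_left_one: "act (mat 1) B M $ i $ j = B *v M $ i $ j"
  by (simp add: act_nth mat1_nth)

context dvr
begin

lemma first_two_rows_divisible_iff:
  "first_two_rows_divisible v (\<pi> ^ e) K \<longleftrightarrow> (\<forall>i\<in>{1, 2}. \<forall>j k. K $ i $ j $ k \<in> val_ge v (int e))"
proof -
  have "(\<exists>y\<in>val_ring v. x = \<pi> ^ e * y) \<longleftrightarrow> x \<in> val_ge v (int e)" for x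
  proof
    assume "\<exists>y\<in>val_ring v. x = \<pi> ^ e * y"
    then show "x \<in> val_ge v (int e)"
      using pi by (auto simp: val_ge_scale v_power val_ring_eq)
  next
    assume x: "x \<in> val_ge v (int e)"
    have "x = \<pi> ^ e * (inverse (\<pi> ^ e) * x)"
      using pi by simp
    moreover have "inverse (\<pi> ^ e) * x \<in> val_ring v"
      using x pi by (simp add: val_ring_eq val_ge_scale v_inverse v_power)
    ultimately show "\<exists>y\<in>val_ring v. x = \<pi> ^ e * y"
      by blast
  qed
  then show ?thesis
    by (simp add: first_two_rows_divisible_def)
qed

lemma det_divide: "det (dg (\<lambda>i. if i \<in> S then inverse (\<pi> ^ e) else 1)) = inverse (\<pi> ^ e) ^ card S"
  unfolding det_dg by (rule prod_if_card)

lemma v_inverse_pi_power: "v (inverse (\<pi> ^ e)) = - int e" "inverse (\<pi> ^ e) \<noteq> 0"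
  using pi by (simp_all add: v_inverse v_power)

lemma divisible_rows_cols:
  assumes K: "int_model K" and div: "first_two_rows_divisible v (\<pi> ^ e) K"
    and ij: "i = 1 \<or> i = 2 \<or> j = 1 \<or> j = 2"
  shows "K $ i $ j $ k \<in> val_ge v (int e)"
proof -
  have row: "K $ i $ j $ k \<in> val_ge v (int e)" if "i = 1 \<or> i = 2" for i j
    using that div unfolding first_two_rows_divisible_iff by auto
  show ?thesis
  proof (cases "i = 1 \<or> i = 2")
    case False
    then have "- K $ j $ i $ k \<in> val_ge v (int e)"
      using row [of j i] ij by (auto simp: val_ge_def v_uminus)
    then show ?thesis
      using alternating_nth(2) [OF int_model_alternating [OF K], of i j] by simp
  qed (rule row)
qed

text \<open>The only entry divided twice is (1, 1), which is zero.\<close>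

lemma divide_first_integral:
  assumes K: "int_model K" and div: "first_two_rows_divisible v (\<pi> ^ e) K"
  shows "int_model (divide_rows_cols {1} (\<pi> ^ e) K)"
proof -
  note alt = int_model_alternating [OF K]
  have "divide_rows_cols {1} (\<pi> ^ e) K $ i $ j $ k \<in> val_ring v" for i j k
    using divisible_rows_cols [OF K div, of i j k] alternating_nth(1) [OF alt, of i]
      vec_inD [OF int_model_vec_in [OF K, of i j], of k]
    by (auto simp: divide_rows_cols_def val_ring_eq val_ge_scale v_inverse_pi_power pi v_one)
  moreover have "alternating (divide_rows_cols {1} (\<pi> ^ e) K)"
    unfolding divide_rows_cols_eq by (rule alternating_act [OF alt])
  ultimately show ?thesis
    by (simp add: int_model_def vec_in_def)
qed

text \<open>Relative to a coefficient of least valuation, a change of variables turns the form into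
  a multiple of a single variable, and that variable is then scaled by \<pi>^n. The whole cost in
  the determinant is \<pi>^n.\<close>

lemma clear_form:
  assumes a: "vec_in (val_ring v) (a :: 'k^'n::finite)"
  obtains B where "invertible B" "v (det B) \<le> int n" "\<And>i j. B $ i $ j \<in> val_ring v"
    "\<And>k. (B *v a) $ k \<in> val_ge v (int n)"
proof (cases "a = 0")
  case True
  show ?thesis
    by (rule that [of "mat 1"]) (auto simp: invertible_iff_det v_one True)
next
  case False
  then obtain k0 where "a $ k0 \<noteq> 0"
    by (auto simp: vec_eq_iff)
  then obtain k where k: "a $ k \<noteq> 0" "\<And>j. a $ j \<in> val_ge v (v (a $ k))"
    by (rule minimal_value) (rule that)
  define u where "u = (\<chi> l. if l = k then \<pi> ^ n - 1 else - inverse (a $ k) * a $ l)"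
  let ?B = "rank1 u (axis k 1)"
  have "inverse (a $ k) * a $ l \<in> val_ring v" for l
    using k by (simp add: val_ring_eq val_ge_scale v_inverse)
  moreover have "\<pi> \<in> val_ring v"
    using pi by (simp add: val_ring_def)
  ultimately have uR: "u $ l \<in> val_ring v" for l
    by (simp add: u_def R_uminus R_diff R_power)
  have det: "det ?B = \<pi> ^ n"
    by (simp add: det_rank1_axis u_def)
  show ?thesis
  proof (rule that [of ?B])
    show "invertible ?B" "v (det ?B) \<le> int n"
      using pi by (simp_all add: invertible_iff_det det v_power)
    show "?B $ i $ j \<in> val_ring v" for i j
      using uR by (auto simp: rank1_def)
    have "(?B *v a) $ l = (if l = k then \<pi> ^ n * a $ k else 0)" for l
      using k(1) by (auto simp: rank1_axis_mult_vec u_def algebra_simps)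
    moreover have "\<pi> ^ n * a $ k \<in> val_ge v (int n)"
      using a pi by (simp add: val_ge_scale v_power vec_in_def val_ring_eq)
    ultimately show "(?B *v a) $ l \<in> val_ge v (int n)" for l
      by simp
  qed
qed

text \<open>Only the entry (1, 2) and its mirror image lose integrality: they are divided by
  \<pi>^(2e) but known to be divisible by \<pi>^e only. \<open>clear_form\<close> supplies the
  missing factor at a cost of at most \<open>e\<close>.\<close>

lemma divide_both_integral:
  assumes K: "int_model K" and div: "first_two_rows_divisible v (\<pi> ^ e) K"
  obtains B where "invertible B" "v (det B) \<le> int e"
    "int_model (act (mat 1) B (divide_rows_cols {1, 2} (\<pi> ^ e) K))"
proof -
  note alt = int_model_alternating [OF K]
  let ?p = "inverse (\<pi> ^ e)"
  let ?L = "divide_rows_cols {1, 2} (\<pi> ^ e) K"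
  have aR: "vec_in (val_ring v) (?p *s K $ 1 $ 2)"
    using divisible_rows_cols [OF K div, of 1 2]
    by (simp add: vec_in_def val_ring_eq val_ge_scale v_inverse_pi_power pi v_one)
  obtain B where B: "invertible B" "v (det B) \<le> int e" "\<And>i j. B $ i $ j \<in> val_ring v"
    "\<And>k. (B *v (?p *s K $ 1 $ 2)) $ k \<in> val_ge v (int e)"
    using aR by (rule clear_form) (rule that)
  have "alternating ?L"
    unfolding divide_rows_cols_eq by (rule alternating_act [OF alt])
  then have altL: "alternating (act (mat 1) B ?L)"
    by (rule alternating_act)
  have L12: "vec_in (val_ring v) (act (mat 1) B ?L $ 1 $ 2)"
  proof -
    have "?L $ 1 $ 2 = ?p *s (?p *s K $ 1 $ 2)"
      by (simp add: divide_rows_cols_def)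
    then have "act (mat 1) B ?L $ 1 $ 2 = ?p *s (B *v (?p *s K $ 1 $ 2))"
      unfolding act_nth_left_one by (simp only: matrix_vector_mult_scale)
    then show ?thesis
      using B(4) by (simp add: vec_in_def val_ring_eq val_ge_scale v_inverse_pi_power pi v_one)
  qed
  have L: "vec_in (val_ring v) (?L $ i $ j)" if "\<not> (i \<in> {1, 2} \<and> j \<in> {1, 2})" for i j
    using that divisible_rows_cols [OF K div, of i j] vec_inD [OF int_model_vec_in [OF K, of i j]]
    by (auto simp: divide_rows_cols_def vec_in_def val_ring_eq val_ge_scale v_inverse_pi_power pi v_one)
  have "vec_in (val_ring v) (act (mat 1) B ?L $ i $ j)" for i j
  proof (cases "i \<in> {1, 2} \<and> j \<in> {1, 2}")
    case True
    then consider "i = j" | "i = 1" "j = 2" | "i = 2" "j = 1"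
      by auto
    then show ?thesis
    proof cases
      case 1
      then show ?thesis
        using alternating_nth(1) [OF altL, of j] by (simp add: vec_in_ops)
    next
      case 2
      then show ?thesis using L12 by simp
    next
      case 3
      then show ?thesis
        using L12 alternating_nth(2) [OF altL, of 2 1] vec_in_ops(3) by simp
    qed
  next
    case False
    then show ?thesis
      unfolding act_nth_left_one vec_in_def using L [OF False] B(3)
      by (intro allI R_matrix_vector) (auto simp: vec_in_def)
  qed
  then have "int_model (act (mat 1) B ?L)"
    using altL by (simp add: int_model_def)
  with B show ?thesis
    using that by blast
qed

end

context scaled_model
begin

lemma c_integral: "0 \<le> v c"
proof -
  have "(1 ^ 2 * det (mat 1 :: 'k^5^5) * c) * (mat 1 :: 'k^5^5) $ 1 $ 1 \<in> val_ring v"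
    using M by (intro N_integral) simp_all
  moreover have "(mat 1 :: 'k^5^5) $ 1 $ 1 = 1"
    by (simp add: mat_def)
  ultimately show ?thesis
    using c0 by (simp add: val_ring_def)
qed

text \<open>An integral base change with integral inverse keeps the Pfaffians integral combinations
  of the quadrics c q_j.\<close>

lemma pfc_val_ge:
  assumes B: "B \<in> GL_over (val_ring v)"
  shows "pfc (act B (mat 1) M) i k l \<in> val_ge v (v c)"
proof -
  obtain B' where B': "B' \<in> GL_over (val_ring v)" "B ** B' = mat 1"
    using GL_inverse [OF B] by blast
  have "pfc (act B (mat 1) M) i k l = (\<Sum>j\<in>UNIV. c * (det B * B' $ j $ i * qc j k l))"
    unfolding pfc_def pf_equivalent [OF B'(2)]
    by (simp add: lookup_sum lookup_mconst_mult) (simp add: ac_simps)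
  also have "\<dots> = c * (\<Sum>j\<in>UNIV. det B * B' $ j $ i * qc j k l)"
    by (simp add: sum_distrib_left)
  also have "\<dots> \<in> val_ge v (v c + 0)"
    using B B' by (intro val_ge_mult val_ge_self)
      (auto simp: val_ring_eq [symmetric] intro!: R_sum R_mult det_in_R GL_entry qc_in)
  finally show ?thesis by simp
qed

text \<open>With m = v(c), the Koszul argument is run modulo \<pi>^m: Pfaffians 2 and 1 are syzygies
  that clear rows 1 and 2 in columns 3, 4, 5. Pfaffian 3 is then the entry (1, 2) times the entry
  (4, 5), and the functional dual to the latter cancels it.\<close>

lemma rows_divisible:
  "\<exists>B\<in>GL_over (val_ring v). first_two_rows_divisible v (\<pi> ^ nat (v c)) (act B (mat 1) M)"
proof (cases "v c = 0")
  case True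
  then have "first_two_rows_divisible v (\<pi> ^ nat (v c)) (act (mat 1) (mat 1) M)"
    unfolding first_two_rows_divisible_iff using int_model_vec_in [OF M]
    by (simp add: vec_in_def val_ring_eq)
  then show ?thesis
    using GL_mat1 by blast
next
  case False
  then have pos: "0 < v c"
    using c_integral by simp
  \<comment> \<open>For v(c) > 1 this ideal is not prime, so only results that avoid division by
    units modulo the ideal are available for it.\<close>
  interpret J: subring_ideal "val_ring v" "val_ge v (v c)"
    using pos by (intro subring_ideal_val_ge) simp
  obtain B where B: "B \<in> GL_over (val_ring v)"
    and ind: "independent3 (act B (mat 1) M $ 3 $ 4) (act B (mat 1) M $ 3 $ 5) (act B (mat 1) M $ 4 $ 5)"
    using pos by (rule exists_independent_block)
  define K where "K = act B (mat 1) M"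
  have K: "int_model K"
    unfolding K_def by (intro int_model_act M GL_entry B)
  note alt = int_model_alternating [OF K]
  note KR = int_model_vec_in [OF K]
  obtain fa fb fc where f: "vec_in (val_ring v) fa" "vec_in (val_ring v) fb" "vec_in (val_ring v) fc"
    and dual: "dot fa (K $ 3 $ 4) = 1" "dot fa (K $ 3 $ 5) = 0" "dot fa (K $ 4 $ 5) = 0"
      "dot fb (K $ 3 $ 4) = 0" "dot fb (K $ 3 $ 5) = 1" "dot fb (K $ 4 $ 5) = 0"
      "dot fc (K $ 3 $ 4) = 0" "dot fc (K $ 3 $ 5) = 0" "dot fc (K $ 4 $ 5) = 1"
    using KR KR KR ind [folded K_def] by (rule dual3) (rule that)
  have p: "pfc K i k l \<in> val_ge v (v c)" for i k l
    unfolding K_def by (rule pfc_val_ge [OF B])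
  have kill: "\<exists>w. vec_in (val_ring v) w \<and> w $ 1 = 0 \<and> w $ 2 = 0 \<and>
      (\<forall>j\<in>{3, 4, 5}. vec_in (val_ge v (v c)) (K $ i $ j + form K w (axis j 1)))"
    if rel: "\<And>k l. pfc4 K i 3 4 5 k l \<in> val_ge v (v c)" for i
  proof -
    obtain w3 w4 w5 where w: "w3 \<in> val_ring v" "w4 \<in> val_ring v" "w5 \<in> val_ring v"
      and k: "vec_in (val_ge v (v c)) (K $ i $ 3 - w4 *s K $ 3 $ 4 - w5 *s K $ 3 $ 5)"
        "vec_in (val_ge v (v c)) (K $ i $ 4 + w3 *s K $ 3 $ 4 - w5 *s K $ 4 $ 5)"
        "vec_in (val_ge v (v c)) (K $ i $ 5 + w3 *s K $ 3 $ 5 + w4 *s K $ 4 $ 5)"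
      using J.koszul [OF rel [unfolded pfc4_def] KR KR KR KR KR KR f dual] by blast
    let ?w = "w3 *s axis 3 1 + w4 *s axis 4 1 + w5 *s axis 5 1 :: 'k^5"
    have "form K ?w (axis j 1) = w3 *s K $ 3 $ j + w4 *s K $ 4 $ j + w5 *s K $ 5 $ j" for j
      by (simp add: form_add form_scale)
    then have "vec_in (val_ge v (v c)) (K $ i $ j + form K ?w (axis j 1))" if "j \<in> {3, 4, 5}" for j
      using that k alternating_nth(1) [OF alt] alternating_nth(2) [OF alt, of 4 3]
        alternating_nth(2) [OF alt, of 5 3] alternating_nth(2) [OF alt, of 5 4]
      by (auto simp: algebra_simps)
    moreover have "vec_in (val_ring v) ?w"
      by (intro vec_in_ops vec_in_axis w)
    moreover have "?w $ 1 = 0" "?w $ 2 = 0"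
      by (simp_all add: axis_def)
    ultimately show ?thesis
      by blast
  qed
  have "pfc4 K 1 3 4 5 k l \<in> val_ge v (v c)" for k l
    using J.I_uminus [OF p [of 2 k l]] by (simp add: pfc_simps)
  then obtain w where w: "vec_in (val_ring v) w" "w $ 1 = 0" "w $ 2 = 0"
    "\<And>j. j \<in> {3, 4, 5} \<Longrightarrow> vec_in (val_ge v (v c)) (K $ 1 $ j + form K w (axis j 1))"
    using kill [of 1] by blast
  have "pfc4 K 2 3 4 5 k l \<in> val_ge v (v c)" for k l
    using p [of 1 k l] by (simp add: pfc_simps)
  then obtain x where x: "vec_in (val_ring v) x" "x $ 1 = 0" "x $ 2 = 0"
    "\<And>j. j \<in> {3, 4, 5} \<Longrightarrow> vec_in (val_ge v (v c)) (K $ 2 $ j + form K x (axis j 1))"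
    using kill [of 2] by blast
  \<comment> \<open>Both corrections use rows 3, 4, 5 only, so the two factors are unipotent and do
    not interfere with each other.\<close>
  define E where "E = rank1 (axis 1 1) w ** rank1 (axis 2 1) x"
  have row: "rank1 (axis i 1) w $ j = axis j 1 + (if j = i then w else 0)" for i j :: 5 and w :: "'k^5"
    by (simp add: rank1_def vec_eq_iff mat1_nth) (simp add: axis_def)
  have tr: "transpose (rank1 (axis 2 1) x) *v y = y + y $ 2 *s x" for y :: "'k^5"
    unfolding transpose_mult_vec row
    by (simp add: sum_5 vec_eq_iff forall_5 axis_def distrib_left)
  have E_rows: "E $ 1 = axis 1 1 + w" "E $ 2 = axis 2 1 + x" "E $ 3 = axis 3 1" "E $ 4 = axis 4 1"
    "E $ 5 = axis 5 1"
    unfolding E_def matrix_mult_nth row tr by (simp_all add: w x) (simp_all add: axis_def)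
  have E: "E \<in> GL_over (val_ring v)"
    unfolding E_def using w x by (intro GL_mult GL_rank1) (auto simp: vec_in_def)
  define L where "L = act (E ** B) (mat 1) M"
  have EB: "E ** B \<in> GL_over (val_ring v)"
    by (intro GL_mult E B)
  have L_eq: "L = act E (mat 1) K"
    by (simp add: L_def K_def act_act)
  have intL: "int_model L"
    unfolding L_eq by (intro int_model_act K GL_entry E)
  have L1: "vec_in (val_ge v (v c)) (L $ 1 $ j)" if "j \<in> {3, 4, 5}" for j
    using that w(4) by (auto simp: L_eq act_nth E_rows form_add)
  have L2: "vec_in (val_ge v (v c)) (L $ 2 $ j)" if "j \<in> {3, 4, 5}" for j
    using that x(4) by (auto simp: L_eq act_nth E_rows form_add)
  have L45: "L $ 4 $ 5 = K $ 4 $ 5"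
    by (simp add: L_eq act_nth E_rows)
  have "sq (L $ 1 $ 2) (L $ 4 $ 5) k l \<in> val_ge v (v c)" for k l
  proof -
    have "pfc L 3 k l \<in> val_ge v (v c)"
      unfolding L_def by (rule pfc_val_ge [OF EB])
    moreover have "sq (L $ 1 $ 4) (L $ 2 $ 5) k l \<in> val_ge v (v c)"
      "sq (L $ 1 $ 5) (L $ 2 $ 4) k l \<in> val_ge v (v c)"
      using L1 int_model_vec_in [OF intL] by (intro J.sq_I(1); simp)+
    ultimately have "pfc L 3 k l + sq (L $ 1 $ 4) (L $ 2 $ 5) k l - sq (L $ 1 $ 5) (L $ 2 $ 4) k l \<in> val_ge v (v c)"
      by (intro J.I_add J.I_diff)
    then show ?thesis
      by (simp add: pfc_simps pfc4_def)
  qed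
  then have L12: "vec_in (val_ge v (v c)) (L $ 1 $ 2)"
    using f(3) dual(9) by (intro J.sq_cancel [of _ "L $ 4 $ 5" fc]) (simp_all add: L45 KR)
  have L21: "vec_in (val_ge v (v c)) (L $ 2 $ 1)"
    using J.vec_in_flip [OF int_model_alternating [OF intL] L12] .
  have diag: "vec_in (val_ge v (v c)) (L $ i $ i)" for i
    using alternating_nth(1) [OF int_model_alternating [OF intL], of i] by (simp add: J.vec_in_ops)
  have "\<forall>j. vec_in (val_ge v (v c)) (L $ 1 $ j) \<and> vec_in (val_ge v (v c)) (L $ 2 $ j)"
    using diag L12 L21 L1 L2 unfolding forall_5 by simp
  then have "first_two_rows_divisible v (\<pi> ^ nat (v c)) L"
    unfolding first_two_rows_divisible_iff using pos by (auto simp: vec_in_def)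
  then show ?thesis
    using EB unfolding L_def by blast
qed

text \<open>Dividing the first row and column by \<pi>^e lowers the level by 2 e, and
  \<open>level_change_bound\<close> permits at most 2 v(c).\<close>

lemma divisible_bound:
  assumes A: "A \<in> GL_over (val_ring v)" and div: "first_two_rows_divisible v (\<pi> ^ e) (act A (mat 1) M)"
  shows "int e \<le> v c"
proof -
  let ?d = "dg (\<lambda>i. if i \<in> {1 :: 5} then inverse (\<pi> ^ e) else 1)"
  have int: "int_model (act (?d ** A) (mat 1) M)"
    using divide_first_integral [OF int_model_act [OF M GL_entry [OF A]] div]
    unfolding divide_rows_cols_eq act_act by simp
  have d: "det ?d = inverse (\<pi> ^ e)"
    unfolding det_divide by simp
  then have dA: "det (?d ** A) \<noteq> 0" "v (det (?d ** A)) = - int e"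
    unfolding det_mul d using v_det_GL [OF A] v_inverse_pi_power [of e] by (simp_all add: v_mult)
  then show ?thesis
    using level_change_bound [OF _ _ int] by (simp add: invertible_iff_det v_one)
qed

lemma exists_step2_choice: "\<exists>A e. step2_choice v \<pi> M A e"
  using rows_divisible divisible_bound unfolding step2_choice_def GL_integral_eq
  by (metis nat_int nat_mono)

lemma step2_choice_exponent:
  assumes "step2_choice v \<pi> M A e"
  shows "int e = v c" "A \<in> GL_over (val_ring v)"
    "first_two_rows_divisible v (\<pi> ^ e) (act A (mat 1) M)"
proof -
  show A: "A \<in> GL_over (val_ring v)" and div: "first_two_rows_divisible v (\<pi> ^ e) (act A (mat 1) M)"
    using assms by (simp_all add: step2_choice_def GL_integral_eq)
  have "nat (v c) \<le> e"
    using assms rows_divisible unfolding step2_choice_def GL_integral_eq by blast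
  with divisible_bound [OF A div] show "int e = v c"
    by simp
qed

lemma saturated_if_unit:
  assumes "v c = 0"
  shows "saturated v M"
  unfolding saturated_def independent_mod_def
proof (intro allI impI)
  fix d i assume d: "(\<forall>i. d i \<in> val_ring v) \<and>
    (\<forall>m. Poly_Mapping.lookup (\<Sum>i\<in>UNIV. mconst (d i) * pf M i) m \<in> max_ideal v)"
  have "(\<Sum>i\<in>UNIV. (c * d i) * Poly_Mapping.lookup (q i) m) \<in> val_ge v 1" for m
  proof -
    have "Poly_Mapping.lookup (\<Sum>i\<in>UNIV. mconst (d i) * pf M i) m =
        (\<Sum>i\<in>UNIV. (c * d i) * Poly_Mapping.lookup (q i) m)"
      by (simp add: pf_M lookup_sum lookup_mconst_mult) (simp add: ac_simps)
    moreover have "Poly_Mapping.lookup (\<Sum>i\<in>UNIV. mconst (d i) * pf M i) m \<in> val_ge v 1"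
      using d unfolding max_ideal_eq by blast
    ultimately show ?thesis
      by simp
  qed
  then have "c * d i \<in> val_ge v 1"
    by (rule coefficients_in)
  then show "d i \<in> max_ideal v"
    using c0 assms by (simp add: val_ge_scale max_ideal_eq)
qed

end

section \<open>The discriminant and the independence of the Pfaffians\<close>

lemma pfaffian_cancel:
  fixes A :: "'k::field^5^5"
  assumes "invertible A" "\<And>j. (\<Sum>i\<in>UNIV. mconst (A $ i $ j) * x i) = (\<Sum>i\<in>UNIV. mconst (A $ i $ j) * y i)"
  shows "x i = y i"
proof -
  obtain B where B: "A ** B = mat 1"
    using assms(1) unfolding invertible_def by blast
  have "(\<Sum>j\<in>UNIV. mconst (B $ j $ l) * (\<Sum>i\<in>UNIV. mconst (A $ i $ j) * z i)) = z l" for z l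
  proof -
    have "(\<Sum>j\<in>UNIV. mconst (B $ j $ l) * (\<Sum>i\<in>UNIV. mconst (A $ i $ j) * z i)) =
        (\<Sum>j\<in>UNIV. \<Sum>i\<in>UNIV. mconst (A $ i $ j * B $ j $ l) * z i)"
      by (simp only: sum_distrib_left mconst_mult ac_simps)
    also have "\<dots> = (\<Sum>i\<in>UNIV. (\<Sum>j\<in>UNIV. mconst (A $ i $ j * B $ j $ l)) * z i)"
      unfolding sum_distrib_right by (rule sum.swap)
    also have "\<dots> = (\<Sum>i\<in>UNIV. mconst ((A ** B) $ i $ l) * z i)"
      by (simp only: mconst_sum matrix_matrix_mult_def vec_lambda_beta)
    also have "\<dots> = (\<Sum>i\<in>UNIV. if i = l then z i else 0)"
      unfolding B by (rule sum.cong) (auto simp: mat_def)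
    finally show ?thesis by simp
  qed
  from this [of i x] this [of i y] show ?thesis
    using assms(2) by simp
qed

lemma pf_homogeneous: "homogeneous 2 (pf M i)"
  unfolding homogeneous_def
proof
  fix m assume "m \<in> Poly_Mapping.keys (pf M i)"
  then obtain k l where m: "m = mono2 k l"
    using pf_support [of M i m] by (auto simp: in_keys_iff)
  have "(\<Sum>i\<in>Poly_Mapping.keys m. Poly_Mapping.lookup m i) = (\<Sum>i\<in>UNIV. Poly_Mapping.lookup m i)"
    by (rule sum.mono_neutral_left) (auto simp: in_keys_iff)
  then show "(\<Sum>i\<in>Poly_Mapping.keys m. Poly_Mapping.lookup m i) = 2"
    by (simp add: m mono2_def lookup_add lookup_single sum.distrib when_def)
qed

lemma homogeneous_add: "homogeneous d f \<Longrightarrow> homogeneous d g \<Longrightarrow> homogeneous d (f + g)"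
  unfolding homogeneous_def using keys_add [of f g] by blast

lemma homogeneous_mconst_mult: "homogeneous d f \<Longrightarrow> homogeneous d (mconst c * f)"
  unfolding homogeneous_def by (auto simp: in_keys_iff lookup_mconst_mult)

lemma homogeneous_zero: "homogeneous d 0"
  by (simp add: homogeneous_def)

lemma homogeneous_sum: "(\<And>i. i \<in> S \<Longrightarrow> homogeneous d (f i)) \<Longrightarrow> homogeneous d (sum f S)"
  by (induction S rule: infinite_finite_induct) (auto intro: homogeneous_add homogeneous_zero)

context dvr
begin

lemma bounded_below:
  fixes f :: "'i::finite \<Rightarrow> 'k"
  obtains n where "\<And>i. f i \<in> val_ge v (- int n)"
proof (cases "\<forall>i. f i = 0")
  case True
  then show ?thesis using that by simp
next
  case False
  then obtain i0 where "f i0 \<noteq> 0" by blast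
  then obtain i where i: "f i \<noteq> 0" "\<And>j. f j \<in> val_ge v (v (f i))"
    by (rule minimal_value) (rule that)
  have "f j \<in> val_ge v (- int (nat (- v (f i))))" for j
    by (rule val_ge_mono [OF _ i(2)]) simp
  then show ?thesis by (rule that)
qed

lemma bounded_below_model:
  obtains n where "\<And>i j k. (K :: 'k model) $ i $ j $ k \<in> val_ge v (- int n)"
proof -
  define f :: "5 \<times> 5 \<times> 5 \<Rightarrow> 'k" where "f = (\<lambda>(i, j, k). K $ i $ j $ k)"
  obtain n where n: "\<And>p. f p \<in> val_ge v (- int n)"
    by (rule bounded_below) (rule that)
  have "K $ i $ j $ k \<in> val_ge v (- int n)" for i j k
    using n [of "(i, j, k)"] by (simp add: f_def)
  then show ?thesis by (rule that)
qed

lemma det_mat: "det (mat c :: 'k^5^5) = c ^ 5"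
  by (subst det_diagonal) (auto simp: mat_def)

lemma eval_model_integral:
  assumes "int_model K"
  shows "eval_model D K \<in> val_ring v"
  unfolding eval_model_def meval_def
  using int_model_vec_in [OF assms] by (intro R_sum R_mult R_of_int R_prod R_power) (auto simp: vec_in_def)

definition relative_invariant :: "model_poly \<Rightarrow> bool" where
  "relative_invariant D \<longleftrightarrow> (\<forall>A B (\<Phi> :: 'k model). invertible A \<and> invertible B \<and> alternating \<Phi> \<longrightarrow>
     eval_model D (act A B \<Phi>) = act_det A B ^ 12 * eval_model D \<Phi>)"

lemma v_eval_act:
  fixes K :: "'k model"
  assumes D: "relative_invariant D" and nz: "eval_model D K \<noteq> 0" and K: "alternating K"
    and AB: "invertible A" "invertible B"
  shows "eval_model D (act A B K) \<noteq> 0"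
    "v (eval_model D (act A B K)) = 12 * (2 * v (det A) + v (det B)) + v (eval_model D K)"
proof -
  have e: "eval_model D (act A B K) = (det A ^ 2 * det B) ^ 12 * eval_model D K"
    using D K AB by (simp add: relative_invariant_def act_det_def)
  have "det A \<noteq> 0" "det B \<noteq> 0"
    using AB by (simp_all add: invertible_iff_det)
  then show "eval_model D (act A B K) \<noteq> 0"
    "v (eval_model D (act A B K)) = 12 * (2 * v (det A) + v (det B)) + v (eval_model D K)"
    unfolding e using nz by (simp_all add: v_mult v_power)
qed

lemma eval_model_bound:
  fixes K :: "'k model"
  assumes D: "relative_invariant D" and nz: "eval_model D K \<noteq> 0" and K: "alternating K"
    and AB: "invertible A" "invertible B" and int: "int_model (act A B K)"
  shows "0 \<le> 12 * (2 * v (det A) + v (det B)) + v (eval_model D K)"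
  using eval_model_integral [OF int, of D] v_eval_act [OF assms(1-5)] by (simp add: val_ring_def)

text \<open>A Hilbert-Mumford argument with powers of \<pi> as parameter. Integral equivalent models
  exist for every large N, while the valuations of their discriminants are 12 (5 n - N) plus a
  constant, which cannot stay nonnegative.\<close>

lemma eval_zero_block:
  fixes K :: "'k model"
  assumes D: "relative_invariant D" and K: "alternating K" and dist: "distinct [x, y, z]"
    and zero: "K $ x $ y = 0" "K $ x $ z = 0" "K $ y $ z = 0"
  shows "eval_model D K = 0"
proof (rule ccontr)
  assume nz: "eval_model D K \<noteq> 0"
  obtain n where n: "\<And>i j k. K $ i $ j $ k \<in> val_ge v (- int n)"
    by (rule bounded_below_model) (rule that)
  \<comment> \<open>\<open>n\<close> bounds the denominators of \<open>K\<close>; the remaining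
    summands make the final valuation strictly negative.\<close>
  define N where "N = 5 * n + nat \<bar>v (eval_model D K)\<bar> + 1"
  define S where "S = UNIV - {x, y, z}"
  have "card S = 2"
    unfolding S_def using dist by (subst card_Diff_subset) auto
  let ?A = "dg (\<lambda>i. if i \<in> S then \<pi> ^ N else 1)"
  let ?m = "\<pi> powi (int n - int N)"
  have det: "det ?A = (\<pi> ^ N) ^ 2"
    unfolding det_dg prod_if_card \<open>card S = 2\<close> ..
  have zero': "K $ i $ j = 0" if "i \<notin> S" "j \<notin> S" for i j
    using that zero alternating_nth(1) [OF K] alternating_nth(2) [OF K, of y x]
      alternating_nth(2) [OF K, of z x] alternating_nth(2) [OF K, of z y]
    by (auto simp: S_def)
  have "act ?A (mat ?m) K $ i $ j $ k \<in> val_ring v" for i j k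
  proof (cases "i \<in> S \<or> j \<in> S")
    case True
    let ?e = "(if i \<in> S then int N else 0) + (if j \<in> S then int N else 0)"
    have "?m * (if i \<in> S then \<pi> ^ N else 1) * (if j \<in> S then \<pi> ^ N else 1) * K $ i $ j $ k \<in>
        val_ge v ((int n - int N) + (if i \<in> S then int N else 0) + (if j \<in> S then int N else 0) + (- int n))"
      using n by (intro val_ge_mult val_ge_powi) (auto simp: val_ge_def v_power pi v_one)
    then show ?thesis
      using True by (auto simp: act_dg val_ring_eq elim!: val_ge_mono [rotated])
  qed (simp add: act_dg zero')
  then have int: "int_model (act ?A (mat ?m) K)"
    using alternating_act [OF K] by (simp add: int_model_def vec_in_def)
  have "invertible ?A" "invertible (mat ?m :: 'k^5^5)"
    unfolding invertible_iff_det det det_mat using pi by simp_all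
  from eval_model_bound [OF D nz K this int]
  have "0 \<le> 12 * (2 * (2 * int N) + 5 * (int n - int N)) + v (eval_model D K)"
    unfolding det det_mat using pi by (simp add: v_power v_pi_power_int)
  then show False
    by (simp add: N_def)
qed

text \<open>Row \<open>x\<close> contains a single linear form. Making it divisible by \<pi>^N costs
  at most N, and dividing row and column \<open>x\<close> gains 2 N, so the valuation is again at
  most 12 (5 n - N) plus a constant.\<close>

lemma eval_zero_row:
  fixes K :: "'k model"
  assumes D: "relative_invariant D" and K: "alternating K" and dist: "distinct [a, x, b, c, d]"
    and zero: "K $ x $ b = 0" "K $ x $ c = 0" "K $ x $ d = 0"
  shows "eval_model D K = 0"
proof (rule ccontr)
  assume nz: "eval_model D K \<noteq> 0"
  obtain n where n: "\<And>i j k. K $ i $ j $ k \<in> val_ge v (- int n)"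
    by (rule bounded_below_model) (rule that)
  define N where "N = 5 * n + nat \<bar>v (eval_model D K)\<bar> + 1"
  have s: "vec_in (val_ring v) (\<pi> ^ n *s K $ i $ j)" for i j
    using n pi by (simp add: vec_in_def val_ring_eq val_ge_scale v_power)
  obtain B where B: "invertible B" "v (det B) \<le> int N" "\<And>i j. B $ i $ j \<in> val_ring v"
    "\<And>k. (B *v (\<pi> ^ n *s K $ x $ a)) $ k \<in> val_ge v (int N)"
    using s [of x a] by (rule clear_form) (rule that)
  let ?A = "dg (\<lambda>i. if i \<in> {x} then inverse (\<pi> ^ N) else 1)"
  let ?B = "B ** mat (\<pi> ^ n)"
  have det: "det ?A = inverse (\<pi> ^ N)"
    unfolding det_divide by simp
  have zero': "K $ x $ j = 0" if "j \<noteq> a" for j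
    using forall_distinct_5 [OF dist, of "\<lambda>j. j \<noteq> a \<longrightarrow> K $ x $ j = 0"] that zero
      alternating_nth(1) [OF K, of x] by simp
  have act: "act ?A ?B K = act ?A (mat 1) (act (mat 1) ?B K)"
    by (simp add: act_act)
  have nth: "act (mat 1) ?B K $ i $ j = B *v (\<pi> ^ n *s K $ i $ j)" for i j
    unfolding act_nth_left_one by (simp add: matrix_vector_mul_assoc [symmetric] mat_mult_vec)
  have x1: "vec_in (val_ring v) (act ?A ?B K $ x $ j)" for j
  proof (cases "j = a")
    case True
    then show ?thesis
      unfolding act act_dg nth using B(4) dist
      by (simp add: vec_in_def val_ring_eq val_ge_scale v_inverse_pi_power pi)
  next
    case False
    then show ?thesis
      unfolding act act_dg nth by (simp add: zero' vec_in_ops)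
  qed
  have altA: "alternating (act ?A ?B K)"
    by (rule alternating_act [OF K])
  have "vec_in (val_ring v) (act ?A ?B K $ i $ j)" for i j
  proof -
    consider "i = x" | "j = x" | "i \<noteq> x" "j \<noteq> x" by blast
    then show ?thesis
    proof cases
      case 1
      then show ?thesis using x1 by simp
    next
      case 2
      then show ?thesis
        using x1 [of i] alternating_nth(2) [OF altA, of i j] vec_in_ops(3) by simp
    next
      case 3
      then show ?thesis
        unfolding act act_dg nth using R_matrix_vector [OF B(3)] s [of i j] by (simp add: vec_in_def)
    qed
  qed
  then have int: "int_model (act ?A ?B K)"
    using altA by (simp add: int_model_def)
  have dB: "det B \<noteq> 0"
    using B(1) by (simp add: invertible_iff_det)
  have "invertible ?A" "invertible ?B"
    unfolding invertible_iff_det det det_mul det_mat using pi dB by simp_all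
  from eval_model_bound [OF D nz K this int]
  have "0 \<le> 12 * (2 * (- int N) + (v (det B) + 5 * int n)) + v (eval_model D K)"
    unfolding det det_mul det_mat using pi dB by (simp add: v_mult v_power v_inverse)
  then show False
    using B(2) by (simp add: N_def)
qed

definition pfaffians_lin_indep :: "'k model \<Rightarrow> bool" where
  "pfaffians_lin_indep K \<longleftrightarrow> (\<forall>g. (\<forall>m. (\<Sum>i\<in>UNIV. g i * Poly_Mapping.lookup (pf K i) m) = 0) \<longrightarrow> (\<forall>i. g i = 0))"

text \<open>A linear relation between the Pfaffians makes the model unstable, so that its discriminant vanishes.\<close>
lemma pfaffians_independent:
  fixes K :: "'k model"
  assumes D: "relative_invariant D" and K: "alternating K" and nz: "eval_model D K \<noteq> 0"
  shows "pfaffians_lin_indep K"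
  unfolding pfaffians_lin_indep_def
proof (intro allI impI, rule ccontr)
  fix g i
  assume rel: "\<forall>m. (\<Sum>i\<in>UNIV. g i * Poly_Mapping.lookup (pf K i) m) = 0" and gi: "g i \<noteq> 0"
  \<comment> \<open>The classification of degenerate models is applied to the field itself; a
    relation then produces exact zeros instead of zeros modulo \<pi>.\<close>
  interpret L: local_subring "UNIV :: 'k set" "{0}"
    by unfold_locales auto
  have intL: "L.int_model Z" if "alternating Z" for Z
    using that by (simp add: L.int_model_def vec_in_def)
  have zeroL: "vec_in {0} x \<longleftrightarrow> x = (0 :: 'k^5)" for x
    by (simp add: vec_in_def vec_eq_iff)
  have one: "invertible (mat 1 :: 'k^5^5)"
    by (simp add: invertible_iff_det)
  have act_nz: "eval_model D (act E (mat 1) Z) \<noteq> 0" if "invertible E" "alternating Z" "eval_model D Z \<noteq> 0" for E and Z :: "'k model"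
    using v_eval_act(1) [OF D that(3,2,1) one] .
  obtain E where E: "E \<in> GL_over UNIV" "\<And>k l. pfc (act E (mat 1) K) i k l \<in> {0}"
    using L.eliminate_pfaffian [OF intL [OF K], of g i] rel gi by (auto simp: pfc_def)
  define Z where "Z = act E (mat 1) K"
  have Z: "alternating Z" "eval_model D Z \<noteq> 0"
    unfolding Z_def using alternating_act [OF K] act_nz [OF GL_over_invertible [OF E(1)] K nz] by blast+
  have "L.degenerate4 i Z"
    using L.pfaffian_zero_degenerate4 [OF intL [OF Z(1)]] E(2) unfolding Z_def by blast
  then obtain F where F: "F \<in> GL_over UNIV" and
    "(\<exists>x y z. distinct [x, y, z] \<and> L.zero_block (act F (mat 1) Z) x y z) \<or>
      (\<exists>x y z w. distinct [i, x, y, z, w] \<and> vec_in {0} (act F (mat 1) Z $ x $ y) \<and>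
        vec_in {0} (act F (mat 1) Z $ x $ z) \<and> vec_in {0} (act F (mat 1) Z $ x $ w))"
    unfolding L.degenerate4_def by blast
  moreover have Y: "alternating (act F (mat 1) Z)" "eval_model D (act F (mat 1) Z) \<noteq> 0"
    using alternating_act [OF Z(1)] act_nz [OF GL_over_invertible [OF F] Z] by blast+
  ultimately show False
    using eval_zero_block [OF D Y(1)] eval_zero_row [OF D Y(1)]
    unfolding L.zero_block_def zeroL by blast
qed


section \<open>Saturating the Pfaffians\<close>

lemma val_det_bound:
  fixes H :: "'k^5^5"
  assumes "\<And>i j. H $ i $ j \<in> val_ge v (- int n)"
  shows "det H \<in> val_ge v (- 5 * int n)"
proof -
  have "(mat (\<pi> ^ n) ** H) $ i $ j = \<pi> ^ n * H $ i $ j" for i j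
    by (simp add: matrix_matrix_mult_def mat_def if_distrib [of "\<lambda>x. x * y" for y] cong: if_cong)
  then have "det (mat (\<pi> ^ n) ** H) \<in> val_ring v"
    using assms pi by (intro det_in_R) (simp add: val_ring_eq val_ge_scale v_power)
  then show ?thesis
    using pi by (simp add: det_mul det_mat val_ring_eq val_ge_scale v_power)
qed

definition expresses :: "(5 \<Rightarrow> (5, 'k) mpoly) \<Rightarrow> 'k^5^5 \<Rightarrow> (5 \<Rightarrow> (5, 'k) mpoly) \<Rightarrow> bool" where
  "expresses p A q \<longleftrightarrow> invertible A \<and> (\<forall>i. homogeneous 2 (q i) \<and> integral_poly v (q i)) \<and>
     (\<forall>j. p j = (\<Sum>i\<in>UNIV. mconst (A $ i $ j) * q i))"

text \<open>A fixed matrix \<open>G\<close> sends the coefficient vectors of the Pfaffians to basis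
  vectors. Applied to the integral quadrics \<open>q\<close>, it has entries with bounded
  denominators, and these form the inverse transpose of \<open>A\<close>; so det A is bounded in
  valuation.\<close>

lemma expresses_bounded:
  fixes K :: "'k model"
  assumes K: "alternating K"
    and ind: "pfaffians_lin_indep K"
  obtains C where "\<And>A q. expresses (pf K) A q \<Longrightarrow> v (det A) \<le> C"
proof -
  interpret L: local_subring "UNIV :: 'k set" "{0}"
    by unfold_locales auto
  \<comment> \<open>\<open>reduce_independent\<close> wants the vectors indexed by coordinates, here
    pairs of variables; the five Pfaffians are placed at the pairs (i, 1).\<close>
  define t :: "5 \<times> 5 \<Rightarrow> 'k^(5 \<times> 5)" where "t p = (\<chi> r. pfc K (fst p) (fst r) (snd r))" for p
  let ?S = "(\<lambda>i. (i, 1)) ` (UNIV :: 5 set)"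
  have "\<exists>G\<in>GL_over UNIV. generated G \<and> (\<forall>j\<in>?S. G *v t j = axis j 1)"
  proof (rule L.reduce_independent)
    fix g assume g: "\<And>r. (\<Sum>p\<in>?S. g p * t p $ r) \<in> {0}"
    have "(\<Sum>i\<in>UNIV. g (i, 1) * Poly_Mapping.lookup (pf K i) m) = 0" for m
    proof (cases "\<exists>k l. m = mono2 k l")
      case True
      then obtain k l where m: "m = mono2 k l" by blast
      have "(\<Sum>p\<in>?S. g p * t p $ (k, l)) = (\<Sum>i\<in>UNIV. g (i, 1) * Poly_Mapping.lookup (pf K i) m)"
        by (subst sum.reindex) (auto simp: inj_on_def t_def pfc_def m)
      then show ?thesis
        using g [of "(k, l)"] by simp
    next
      case False
      then have "Poly_Mapping.lookup (pf K i) m = 0" for i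
        using pf_support by blast
      then show ?thesis by simp
    qed
    then show "\<forall>j\<in>?S. g j \<in> {0}"
      using ind unfolding pfaffians_lin_indep_def by fast
  qed auto
  then obtain G where "\<forall>j\<in>?S. G *v t j = axis j 1"
    by blast
  then have G: "\<And>i. G *v t (i, 1) = axis (i, 1) 1"
    by blast
  obtain n where n: "\<And>r. (\<lambda>(i, j). G $ i $ j) r \<in> val_ge v (- int n)"
    by (rule bounded_below) (rule that)
  show ?thesis
  proof (rule that)
    fix A q assume "expresses (pf K) A q"
    then have A: "invertible A" and q: "\<And>i. integral_poly v (q i)"
      and p: "\<And>j. pf K j = (\<Sum>i\<in>UNIV. mconst (A $ i $ j) * q i)"
      by (auto simp: expresses_def)
    define s :: "5 \<Rightarrow> 'k^(5 \<times> 5)" where "s i = (\<chi> r. Poly_Mapping.lookup (q i) (mono2 (fst r) (snd r)))" for i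
    define H :: "'k^5^5" where "H = (\<chi> i j. (G *v s i) $ (j, 1))"
    have "H $ i $ j \<in> val_ge v (- int n + 0)" for i j
      unfolding H_def vec_lambda_beta matrix_vector_mult_def
      using n [of "((j, 1), r)" for r] q
      by (intro val_ge_sum val_ge_mult) (auto simp: s_def integral_poly_def val_ring_eq)
    then have dH: "det H \<in> val_ge v (- 5 * int n)"
      by (intro val_det_bound) simp
    have "t (j, 1) = (\<Sum>i\<in>UNIV. A $ i $ j *s s i)" for j
      by (simp add: vec_eq_iff t_def pfc_def p lookup_sum lookup_mconst_mult s_def)
    then have "(\<Sum>i\<in>UNIV. A $ i $ j * H $ i $ l) = (G *v t (j, 1)) $ (l, 1)" for j l
      by (simp add: H_def matrix_vector_mult_sum_right matrix_vector_mult_scale)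
    then have "(transpose A ** H) $ j $ l = (mat 1 :: 'k^5^5) $ j $ l" for j l
      by (simp add: G matrix_matrix_mult_def transpose_def) (simp add: axis_def mat_def)
    then have "transpose A ** H = mat 1"
      by (simp add: vec_eq_iff)
    then have "det A * det H = 1"
      by (metis det_I det_mul det_transpose)
    moreover from this have "det A \<noteq> 0" "det H \<noteq> 0"
      by auto
    ultimately have "v (det A) = - v (det H)"
      using v_mult [of "det A" "det H"] v_one by simp
    then show "v (det A) \<le> 5 * int n"
      using dH \<open>det H \<noteq> 0\<close> by (simp add: val_ge_def)
  qed
qed

text \<open>Starting from the Pfaffians themselves, take v(det A) maximal. If the quadrics were
  dependent modulo \<pi>, replacing one of them by the relation divided by \<pi> would increase
  v(det A) by one.\<close>

lemma exists_saturation: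
  fixes K :: "'k model"
  assumes K: "int_model K"
    and ind: "pfaffians_lin_indep K"
  obtains A q where "expresses (pf K) A q" "independent_mod v q"
proof -
  have "expresses (pf K) (mat 1) (pf K)"
  proof -
    have "(\<Sum>i\<in>UNIV. mconst ((mat 1 :: 'k^5^5) $ i $ j) * pf K i) = pf K j" for j
    proof -
      have "(\<Sum>i\<in>UNIV. mconst ((mat 1 :: 'k^5^5) $ i $ j) * pf K i) = (\<Sum>i\<in>UNIV. if i = j then pf K i else 0)"
        by (rule sum.cong) (auto simp: mat_def)
      then show ?thesis by simp
    qed
    then show ?thesis
      by (simp add: expresses_def pf_homogeneous integral_poly_def invertible_iff_det pf_in_R [OF K])
  qed
  moreover obtain C where C: "\<And>A q. expresses (pf K) A q \<Longrightarrow> v (det A) \<le> C"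
    using expresses_bounded [OF int_model_alternating [OF K] ind] by blast
  then have "- C \<le> - v (det A)" if "expresses (pf K) A q" for A q
    using that by fastforce
  ultimately have "\<exists>A q. expresses (pf K) A q \<and> (\<forall>A' q'. expresses (pf K) A' q' \<longrightarrow> - v (det A) \<le> - v (det A'))"
    by (rule ex_minimal_int [of "expresses (pf K)" "mat 1" "pf K" _ "\<lambda>A q. - v (det A)"])
  then obtain A q where Aq: "expresses (pf K) A q"
    and max: "\<And>A' q'. expresses (pf K) A' q' \<Longrightarrow> v (det A') \<le> v (det A)"
    by fastforce
  have A: "invertible A" and q: "\<And>i. homogeneous 2 (q i)" "\<And>i m. Poly_Mapping.lookup (q i) m \<in> val_ring v"
    and p: "\<And>j. pf K j = (\<Sum>i\<in>UNIV. mconst (A $ i $ j) * q i)"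
    using Aq by (auto simp: expresses_def integral_poly_def)
  have "independent_mod v q"
    unfolding independent_mod_def
  proof (rule ccontr)
    assume "\<not> (\<forall>c. (\<forall>i. c i \<in> val_ring v) \<and>
      (\<forall>m. Poly_Mapping.lookup (\<Sum>i\<in>UNIV. mconst (c i) * q i) m \<in> max_ideal v) \<longrightarrow>
      (\<forall>i. c i \<in> max_ideal v))"
    then obtain c a where c: "\<And>i. c i \<in> val_ring v"
      "\<And>m. Poly_Mapping.lookup (\<Sum>i\<in>UNIV. mconst (c i) * q i) m \<in> max_ideal v" "c a \<notin> max_ideal v"
      by blast
    then have ca: "c a \<noteq> 0" "v (c a) = 0"
      using unit_iff by blast+
    define r where "r = mconst (inverse \<pi>) * (\<Sum>i\<in>UNIV. mconst (c i) * q i)"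
    define q' where "q' = q(a := r)"
    \<comment> \<open>Solving \<pi> r = \<Sum> c_i q_i for q_a and substituting: row
      \<open>a\<close> of \<open>A\<close> is multiplied by \<pi> / c_a, and c_i / c_a times the old
      row \<open>a\<close> is subtracted from each other row.\<close>
    define u where "u = (\<chi> i. if i = a then \<pi> * inverse (c a) - 1 else - (c i * inverse (c a)))"
    define A' where "A' = rank1 u (axis a 1) ** A"
    have det: "det A' = \<pi> * inverse (c a) * det A"
      by (simp add: A'_def det_mul det_rank1_axis u_def)
    have dA: "det A \<noteq> 0"
      using A by (simp add: invertible_iff_det)
    have "expresses (pf K) A' q'"
      unfolding expresses_def
    proof (intro conjI allI)
      show "invertible A'"
        unfolding invertible_iff_det det using dA ca pi by simp
      have "homogeneous 2 r"
        unfolding r_def by (intro homogeneous_mconst_mult homogeneous_sum q)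
      then show "homogeneous 2 (q' i)" for i
        using q by (simp add: q'_def)
      have "Poly_Mapping.lookup r m \<in> val_ring v" for m
        using c(2) [of m] pi by (simp add: r_def lookup_mconst_mult max_ideal_eq val_ring_eq val_ge_scale v_inverse)
      then show "integral_poly v (q' i)" for i
        using q by (simp add: q'_def integral_poly_def)
      fix j
      have A'_nth: "A' $ i $ j = A $ i $ j + u $ i * A $ a $ j" for i
        by (simp add: A'_def matrix_matrix_mult_def rank1_def distrib_right sum.distrib mult.assoc
            sum_distrib_left [symmetric])
      have look: "(\<Sum>i\<in>UNIV. A $ i $ j * Poly_Mapping.lookup (q i) m) =
          (\<Sum>i\<in>UNIV. A' $ i $ j * Poly_Mapping.lookup (q' i) m)" for m
      proof -
        let ?l = "\<lambda>i. Poly_Mapping.lookup (q i) m"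
        let ?s = "\<Sum>i\<in>UNIV. c i * ?l i"
        have r: "Poly_Mapping.lookup r m = inverse \<pi> * ?s"
          by (simp add: r_def lookup_mconst_mult lookup_sum)
        have s: "?s = c a * ?l a + (\<Sum>i\<in>UNIV - {a}. c i * ?l i)"
          by (simp add: sum.remove [of UNIV a])
        have "(\<Sum>i\<in>UNIV. A' $ i $ j * Poly_Mapping.lookup (q' i) m) =
            (\<pi> * inverse (c a) * A $ a $ j) * (inverse \<pi> * ?s) +
            (\<Sum>i\<in>UNIV - {a}. (A $ i $ j - c i * inverse (c a) * A $ a $ j) * ?l i)"
          by (subst sum.remove [of UNIV a])
            (auto simp: A'_nth q'_def r u_def algebra_simps intro!: sum.cong)
        also have "(\<pi> * inverse (c a) * A $ a $ j) * (inverse \<pi> * ?s) = inverse (c a) * A $ a $ j * ?s"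
          using pi by simp
        also have "\<dots> = A $ a $ j * ?l a + (\<Sum>i\<in>UNIV - {a}. c i * inverse (c a) * A $ a $ j * ?l i)"
          unfolding s using ca by (simp add: algebra_simps sum_distrib_left)
        also have "\<dots> + (\<Sum>i\<in>UNIV - {a}. (A $ i $ j - c i * inverse (c a) * A $ a $ j) * ?l i) =
            A $ a $ j * ?l a + (\<Sum>i\<in>UNIV - {a}. A $ i $ j * ?l i)"
          by (simp add: left_diff_distrib sum_subtractf)
        also have "\<dots> = (\<Sum>i\<in>UNIV. A $ i $ j * ?l i)"
          by (simp add: sum.remove [of UNIV a])
        finally show ?thesis ..
      qed
      show "pf K j = (\<Sum>i\<in>UNIV. mconst (A' $ i $ j) * q' i)"
        unfolding p by (rule poly_mapping_eqI) (simp add: lookup_sum lookup_mconst_mult look)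
    qed
    then have "v (det A') \<le> v (det A)"
      by (rule max)
    then show False
      unfolding det using pi ca dA by (simp add: v_mult v_inverse)
  qed
  with Aq show ?thesis
    by (rule that)
qed

lemma exists_step1:
  fixes K :: "'k model"
  assumes K: "int_model K"
    and ind: "pfaffians_lin_indep K"
  shows "\<exists>\<Psi>. step1 v K \<Psi>"
proof -
  obtain A q where Aq: "expresses (pf K) A q" "independent_mod v q"
    by (rule exists_saturation [OF K ind])
  then have A: "invertible A"
    by (simp add: expresses_def)
  then obtain A' where A': "A' ** A = mat 1"
    unfolding invertible_def by blast
  let ?L = "act A (mat 1) K"
  \<comment> \<open>A zero model has zero Pfaffians, contrary to their independence; so a least
    valuation exists by which to normalise.\<close>
  have "?L \<noteq> 0"
  proof
    assume "?L = 0"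
    then have "act A' (mat 1) 0 = K"
      using act_act [of A' "mat 1" A "mat 1" K] A' by simp
    moreover have "act A' (mat 1) 0 = (0 :: 'k model)"
      by (simp add: vec_eq_iff act_nth form_nth)
    ultimately have pf0: "pf K i = 0" for i
      by (simp add: pf_def pf4_def linear_form_zero)
    then show False
      using ind [unfolded pfaffians_lin_indep_def, rule_format, of "\<lambda>_. 1"] by (simp add: pf0)
  qed
  then obtain i0 j0 k0 where "(\<lambda>(i, j, k). ?L $ i $ j $ k) (i0, j0, k0) \<noteq> 0"
    by (auto simp: vec_eq_iff)
  then obtain p where p: "(\<lambda>(i, j, k). ?L $ i $ j $ k) p \<noteq> 0"
    "\<And>r. (\<lambda>(i, j, k). ?L $ i $ j $ k) r \<in> val_ge v (v ((\<lambda>(i, j, k). ?L $ i $ j $ k) p))"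
    by (rule minimal_value) (rule that)
  define w where "w = v ((\<lambda>(i, j, k). ?L $ i $ j $ k) p)"
  let ?m = "\<pi> powi (- w)"
  have m: "?m \<noteq> 0"
    using pi by simp
  have nth: "act A (mat ?m) K $ i $ j = ?m *s ?L $ i $ j" for i j
    by (simp add: act_mat)
  have L: "?L $ i $ j $ k \<in> val_ge v w" for i j k
    using p(2) [of "(i, j, k)"] by (simp add: w_def)
  have int: "integral_model v (act A (mat ?m) K)"
    unfolding integral_model_def
    using alternating_act [OF int_model_alternating [OF K]] L pi
    by (simp add: nth val_ring_eq val_ge_scale v_pi_power_int)
  obtain i j k where ijk: "p = (i, j, k)"
    by (rule prod_cases3)
  have "?m * ?L $ i $ j $ k \<noteq> 0" "v (?m * ?L $ i $ j $ k) = 0"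
    using p(1) m by (auto simp: ijk w_def v_mult v_pi_power_int)
  then have "act A (mat ?m) K $ i $ j $ k \<notin> max_ideal v"
    by (simp add: nth max_ideal_def)
  then have "step1 v K (act A (mat ?m) K)"
    unfolding step1_def using Aq A m int
    by (intro exI [of _ A] exI [of _ q] exI [of _ ?m]) (auto simp: expresses_def)
  then show ?thesis by blast
qed

text \<open>Step 1 writes the Pfaffians as A^T q, and A^T times the new Pfaffians equals det(A)
  times the old ones. Cancelling A^T leaves a scalar multiple of \<open>q\<close>.\<close>

lemma step1_scaled_model:
  fixes K :: "'k model"
  assumes K: "int_model K" and st: "step1 v K \<Psi>"
  obtains A \<mu> q c where "invertible A" "\<mu> \<noteq> 0" "\<Psi> = act A (mat \<mu>) K" "scaled_model v \<pi> \<Psi> q c"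
proof -
  obtain A q \<mu> where A: "invertible A" and q: "\<And>i. integral_poly v (q i)"
    and p: "\<And>j. pf K j = (\<Sum>i\<in>UNIV. mconst (A $ i $ j) * q i)"
    and ind: "independent_mod v q" and mu: "\<mu> \<noteq> 0" and Psi: "\<Psi> = act A (mat \<mu>) K"
    and int: "integral_model v \<Psi>" and prim: "\<not> (\<forall>i j k. \<Psi> $ i $ j $ k \<in> max_ideal v)"
    using st unfolding step1_def by blast
  have "pf (act A (mat 1) K) i = mconst (det A) * q i" for i
  proof (rule pfaffian_cancel [OF A])
    fix j
    show "(\<Sum>i\<in>UNIV. mconst (A $ i $ j) * pf (act A (mat 1) K) i) =
        (\<Sum>i\<in>UNIV. mconst (A $ i $ j) * (mconst (det A) * q i))"
      unfolding pf_act [OF A int_model_alternating [OF K]] p by (simp only: sum_distrib_left ac_simps)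
  qed
  then have "pf \<Psi> i = mconst (\<mu> ^ 2 * det A) * q i" for i
    using pf_act_mat [of A \<mu> K i] unfolding Psi mconst_mult by (simp only: mult.assoc)
  moreover have "\<mu> ^ 2 * det A \<noteq> 0"
    using mu A by (simp add: invertible_iff_det)
  ultimately have "scaled_model v \<pi> \<Psi> q (\<mu> ^ 2 * det A)"
    using int prim q ind by unfold_locales (auto simp: integral_model_iff)
  with A mu Psi show ?thesis
    by (rule that)
qed

end

section \<open>Evaluation of polynomials\<close>

locale comm_ring_hom_fun =
  fixes h :: "'a::comm_ring_1 \<Rightarrow> 'b::comm_ring_1"
  assumes hom_0 [simp]: "h 0 = 0" and hom_1 [simp]: "h 1 = 1"
    and hom_add: "h (x + y) = h x + h y" and hom_mult: "h (x * y) = h x * h y"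
begin

lemma meval_superset:
  fixes f :: "('v::finite, 'a) mpoly"
  assumes "finite S" "Poly_Mapping.keys f \<subseteq> S"
  shows "meval h x f = (\<Sum>m\<in>S. h (Poly_Mapping.lookup f m) * (\<Prod>i\<in>UNIV. x i ^ Poly_Mapping.lookup m i))"
proof -
  have "(\<Prod>i\<in>Poly_Mapping.keys m. x i ^ Poly_Mapping.lookup m i) = (\<Prod>i\<in>UNIV. x i ^ Poly_Mapping.lookup m i)" for m
    by (rule prod.mono_neutral_left) (auto simp: in_keys_iff)
  then have "meval h x f =
      (\<Sum>m\<in>Poly_Mapping.keys f. h (Poly_Mapping.lookup f m) * (\<Prod>i\<in>UNIV. x i ^ Poly_Mapping.lookup m i))"
    by (simp add: meval_def)
  also have "\<dots> = (\<Sum>m\<in>S. h (Poly_Mapping.lookup f m) * (\<Prod>i\<in>UNIV. x i ^ Poly_Mapping.lookup m i))"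
    using assms by (intro sum.mono_neutral_left) (auto simp: in_keys_iff)
  finally show ?thesis .
qed

lemma meval_add: "meval h x (f + g :: ('v::finite, 'a) mpoly) = meval h x f + meval h x g"
proof -
  let ?S = "Poly_Mapping.keys f \<union> Poly_Mapping.keys g"
  have "Poly_Mapping.keys (f + g) \<subseteq> ?S"
    by (rule keys_add)
  then show ?thesis
    using meval_superset [of ?S f x] meval_superset [of ?S g x] meval_superset [of ?S "f + g" x]
    by (simp add: lookup_add hom_add distrib_right sum.distrib)
qed

lemma meval_zero [simp]: "meval h x 0 = 0"
  by (simp add: meval_def)

lemma meval_sum: "meval h x (\<Sum>i\<in>S. f i :: ('v::finite, 'a) mpoly) = (\<Sum>i\<in>S. meval h x (f i))"
  by (induction S rule: infinite_finite_induct) (simp_all add: meval_add)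

lemma meval_single:
  "meval h x (Poly_Mapping.single m c :: ('v::finite, 'a) mpoly) = h c * (\<Prod>i\<in>UNIV. x i ^ Poly_Mapping.lookup m i)"
  by (subst meval_superset [of "{m}"]) auto

lemma sum_single_keys: "(\<Sum>m\<in>Poly_Mapping.keys f. Poly_Mapping.single m (Poly_Mapping.lookup f m)) = f"
  by (rule poly_mapping_eqI) (simp add: lookup_sum lookup_single when_def in_keys_iff)

lemma meval_mult: "meval h x (f * g :: ('v::finite, 'a) mpoly) = meval h x f * meval h x g"
proof -
  let ?s = "\<lambda>f m. Poly_Mapping.single m (Poly_Mapping.lookup f m)"
  have "f * g = (\<Sum>m\<in>Poly_Mapping.keys f. \<Sum>n\<in>Poly_Mapping.keys g. ?s f m * ?s g n)"
    by (subst (1 3) sum_single_keys [symmetric]) (simp add: sum_product)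
  then have "meval h x (f * g) =
      (\<Sum>m\<in>Poly_Mapping.keys f. \<Sum>n\<in>Poly_Mapping.keys g. meval h x (?s f m) * meval h x (?s g n))"
    by (simp add: meval_sum mult_single meval_single hom_mult lookup_add power_add prod.distrib ac_simps)
  also have "\<dots> = meval h x (\<Sum>m\<in>Poly_Mapping.keys f. ?s f m) * meval h x (\<Sum>n\<in>Poly_Mapping.keys g. ?s g n)"
    by (simp add: meval_sum sum_product)
  finally show ?thesis
    by (simp only: sum_single_keys)
qed

lemma meval_mconst: "meval h x (mconst c :: ('v::finite, 'a) mpoly) = h c"
  by (simp add: meval_single)

lemma meval_uminus: "meval h x (- f :: ('v::finite, 'a) mpoly) = - meval h x f"
  using meval_add [of x f "- f"] by (simp add: eq_neg_iff_add_eq_0 add.commute)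

lemma meval_diff: "meval h x (f - g :: ('v::finite, 'a) mpoly) = meval h x f - meval h x g"
  using meval_add [of x f "- g"] meval_uminus [of x g] by simp

lemma meval_power: "meval h x (f ^ n :: ('v::finite, 'a) mpoly) = meval h x f ^ n"
  using meval_mconst [of x 1] by (induction n) (simp_all add: meval_mult)

lemma meval_prod: "meval h x (\<Prod>i\<in>S. f i :: ('v::finite, 'a) mpoly) = (\<Prod>i\<in>S. meval h x (f i))"
  using meval_mconst [of x 1] by (induction S rule: infinite_finite_induct) (simp_all add: meval_mult)

lemma meval_mvar: "meval h x (mvar k :: ('v::finite, 'a) mpoly) = x k"
proof -
  have "(\<Prod>i\<in>UNIV. x i ^ Poly_Mapping.lookup (Poly_Mapping.single k 1) i) = (\<Prod>i\<in>UNIV. if i = k then x i else 1)"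
    by (rule prod.cong) (auto simp: lookup_single when_def)
  then show ?thesis
    by (simp add: meval_single)
qed

lemma meval_linear_form: "meval h x (linear_form c :: ('n::finite, 'a) mpoly) = (\<Sum>k\<in>UNIV. h (c $ k) * x k)"
  by (simp only: linear_form_def meval_sum meval_mult meval_mconst meval_mvar)

lemma meval_pf: "meval h x (pf M i) = pfaff (\<lambda>i j. meval h x (linear_form (M $ i $ j))) i"
  by (cases i rule: exhaust_5) (simp_all add: pf_eq_pfaff pfaff_simps meval_mult meval_add meval_diff meval_uminus)

end

interpretation id_hom: comm_ring_hom_fun id
  by unfold_locales simp_all

interpretation ac_hom: comm_ring_hom_fun to_ac
  by unfold_locales simp_all

lemma homogeneous_iff:
  "homogeneous d (f :: ('n::finite, 'a::zero) mpoly) \<longleftrightarrow>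
    (\<forall>m\<in>Poly_Mapping.keys f. (\<Sum>i\<in>UNIV. Poly_Mapping.lookup m i) = d)"
proof -
  have "(\<Sum>i\<in>Poly_Mapping.keys m. Poly_Mapping.lookup m i) = (\<Sum>i\<in>UNIV. Poly_Mapping.lookup m i)"
    for m :: "'n \<Rightarrow>\<^sub>0 nat"
    by (rule sum.mono_neutral_left) (auto simp: in_keys_iff)
  then show ?thesis
    by (simp add: homogeneous_def)
qed

lemma homogeneous_mult:
  fixes f g :: "('n::finite, 'a::comm_ring_1) mpoly"
  assumes "homogeneous d f" "homogeneous e g"
  shows "homogeneous (d + e) (f * g)"
  using assms keys_mult [of f g] unfolding homogeneous_iff
  by (fastforce simp: lookup_add sum.distrib)

lemma homogeneous_one: "homogeneous 0 (1 :: ('n::finite, 'a::comm_ring_1) mpoly)"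
  by (simp add: homogeneous_iff)

lemma homogeneous_power:
  fixes f :: "('n::finite, 'a::comm_ring_1) mpoly"
  shows "homogeneous d f \<Longrightarrow> homogeneous (n * d) (f ^ n)"
  by (induction n) (simp_all add: homogeneous_one homogeneous_mult)

lemma homogeneous_prod:
  fixes f :: "'i \<Rightarrow> ('n::finite, 'a::comm_ring_1) mpoly"
  shows "(\<And>i. i \<in> S \<Longrightarrow> homogeneous (d i) (f i)) \<Longrightarrow> homogeneous (\<Sum>i\<in>S. d i) (\<Prod>i\<in>S. f i)"
  by (induction S rule: infinite_finite_induct) (simp_all add: homogeneous_one homogeneous_mult)

lemma homogeneous_linear_form: "homogeneous 1 (linear_form c)"
  unfolding linear_form_def
proof (intro homogeneous_sum homogeneous_mconst_mult)
  fix k :: 'a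
  show "homogeneous 1 (mvar k :: ('a, 'b) mpoly)"
    by (simp add: homogeneous_iff lookup_single when_def)
qed

definition subst_linear ::
    "'a::comm_ring_1^'n::finite^'m::finite \<Rightarrow> ('m, 'a) mpoly \<Rightarrow> ('n, 'a) mpoly" where
  "subst_linear L f = (\<Sum>m\<in>Poly_Mapping.keys f. mconst (Poly_Mapping.lookup f m) *
     (\<Prod>i\<in>UNIV. linear_form (L $ i) ^ Poly_Mapping.lookup m i))"

lemma homogeneous_subst_linear: "homogeneous d f \<Longrightarrow> homogeneous d (subst_linear L f)"
  unfolding subst_linear_def
proof (intro homogeneous_sum homogeneous_mconst_mult)
  fix m assume f: "homogeneous d f" "m \<in> Poly_Mapping.keys f"
  have "homogeneous (\<Sum>i\<in>UNIV. Poly_Mapping.lookup m i * 1)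
      (\<Prod>i\<in>UNIV. linear_form (L $ i) ^ Poly_Mapping.lookup m i)"
    by (intro homogeneous_prod homogeneous_power homogeneous_linear_form)
  then show "homogeneous d (\<Prod>i\<in>UNIV. linear_form (L $ i) ^ Poly_Mapping.lookup m i)"
    using f by (simp add: homogeneous_iff)
qed

lemma meval_subst_linear: "meval id (($) P) (subst_linear L f) = meval id (($) (L *v P)) f"
proof -
  have "meval id (($) P) (linear_form (L $ i)) = (L *v P) $ i" for i
    by (simp add: id_hom.meval_linear_form matrix_vector_mult_def)
  moreover have "meval id (($) (L *v P)) f = (\<Sum>m\<in>Poly_Mapping.keys f.
      id (Poly_Mapping.lookup f m) * (\<Prod>i\<in>UNIV. (L *v P) $ i ^ Poly_Mapping.lookup m i))"
    by (rule id_hom.meval_superset) auto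
  ultimately show ?thesis
    by (simp add: subst_linear_def id_hom.meval_sum id_hom.meval_mult id_hom.meval_mconst
        id_hom.meval_prod id_hom.meval_power)
qed


section \<open>Jacobians of equivalent models\<close>

lemma proj_morphism_precompose:
  assumes "proj_morphism V W f"
  shows "proj_morphism {P. L *v P \<in> V} W (\<lambda>P. f (L *v P))"
  unfolding proj_morphism_def
proof (intro conjI ballI)
  show "f (L *v P) \<in> W" if "P \<in> {P. L *v P \<in> V}" for P
    using assms that by (auto simp: proj_morphism_def)
  fix P assume "P \<in> {P. L *v P \<in> V}"
  then have "L *v P \<in> V" by simp
  then obtain d F where F: "\<And>i. homogeneous d (F i)" "(\<chi> i. meval id (($) (L *v P)) (F i)) \<noteq> 0"
    "\<And>Q. Q \<in> V \<Longrightarrow> (\<chi> i. meval id (($) Q) (F i)) \<noteq> 0 \<Longrightarrow> proj_eq (f Q) (\<chi> i. meval id (($) Q) (F i))"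
    using assms unfolding proj_morphism_def by blast
  show "\<exists>d F. (\<forall>i. homogeneous d (F i)) \<and> (\<chi> i. meval id (($) P) (F i)) \<noteq> 0 \<and>
      (\<forall>Q\<in>{P. L *v P \<in> V}. (\<chi> i. meval id (($) Q) (F i)) \<noteq> 0 \<longrightarrow>
        proj_eq (f (L *v Q)) (\<chi> i. meval id (($) Q) (F i)))"
    using F by (intro exI [of _ d] exI [of _ "\<lambda>i. subst_linear L (F i)"])
      (auto simp: meval_subst_linear intro: homogeneous_subst_linear)
qed

text \<open>The representing polynomials are combined by the rows of \<open>L\<close>; the left
  inverse ensures that nonzero coordinate vectors stay nonzero.\<close>

lemma proj_morphism_postcompose:
  fixes L :: "'a::field^'n::finite^'n"
  assumes f: "proj_morphism V W f" and L: "L' ** L = mat 1" and W: "\<And>Q. Q \<in> W \<Longrightarrow> L *v Q \<in> W'"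
  shows "proj_morphism V W' (\<lambda>P. L *v f P)"
  unfolding proj_morphism_def
proof (intro conjI ballI)
  show "L *v f P \<in> W'" if "P \<in> V" for P
    using f that W by (auto simp: proj_morphism_def)
  fix P assume "P \<in> V"
  then obtain d F where F: "\<And>i. homogeneous d (F i)" "(\<chi> i. meval id (($) P) (F i)) \<noteq> 0"
    "\<And>Q. Q \<in> V \<Longrightarrow> (\<chi> i. meval id (($) Q) (F i)) \<noteq> 0 \<Longrightarrow> proj_eq (f Q) (\<chi> i. meval id (($) Q) (F i))"
    using f unfolding proj_morphism_def by blast
  define F' where "F' i = (\<Sum>j\<in>UNIV. mconst (L $ i $ j) * F j)" for i
  have ev: "(\<chi> i. meval id (($) Q) (F' i)) = L *v (\<chi> i. meval id (($) Q) (F i))" for Q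
    by (simp add: F'_def vec_eq_iff matrix_vector_mult_def id_hom.meval_sum id_hom.meval_mult
        id_hom.meval_mconst)
  have inj: "L *v x = 0 \<longleftrightarrow> x = 0" for x
    using L by (metis matrix_vector_mul_assoc matrix_vector_mul_lid matrix_vector_mult_0_right)
  have proj: "proj_eq (L *v x) (L *v y)" if "proj_eq x y" for x y
    using that unfolding proj_eq_def by (auto simp: matrix_vector_mult_scale)
  show "\<exists>d F. (\<forall>i. homogeneous d (F i)) \<and> (\<chi> i. meval id (($) P) (F i)) \<noteq> 0 \<and>
      (\<forall>Q\<in>V. (\<chi> i. meval id (($) Q) (F i)) \<noteq> 0 \<longrightarrow>
        proj_eq (L *v f Q) (\<chi> i. meval id (($) Q) (F i)))"
  proof (intro exI conjI allI ballI impI)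
    show "homogeneous d (F' i)" for i
      unfolding F'_def by (intro homogeneous_sum homogeneous_mconst_mult F)
    show "(\<chi> i. meval id (($) P) (F' i)) \<noteq> 0"
      unfolding ev inj by (rule F)
    fix Q assume "Q \<in> V" "(\<chi> i. meval id (($) Q) (F' i)) \<noteq> 0"
    then show "proj_eq (L *v f Q) (\<chi> i. meval id (($) Q) (F' i))"
      unfolding ev inj by (intro proj F)
  qed
qed

lemma proj_isomorphism_precompose:
  fixes L :: "'a::field^'n::finite^'n"
  assumes f: "proj_isomorphism V W f" and L: "L ** L' = mat 1" "L' ** L = mat 1"
  shows "proj_isomorphism {P. L *v P \<in> V} W (\<lambda>P. f (L *v P))"
proof -
  have LL: "L *v (L' *v x) = x" "L' *v (L *v x) = x" for x
    using L by (simp_all add: matrix_vector_mul_assoc)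
  obtain g where g: "proj_morphism W V g" "\<And>P. P \<in> V \<Longrightarrow> proj_eq (g (f P)) P"
    "\<And>Q. Q \<in> W \<Longrightarrow> proj_eq (f (g Q)) Q" and mf: "proj_morphism V W f"
    using f unfolding proj_isomorphism_def by blast
  have "proj_morphism W {P. L *v P \<in> V} (\<lambda>Q. L' *v g Q)"
    using g(1) L(1) by (rule proj_morphism_postcompose) (simp add: LL)
  moreover have "proj_eq (L' *v g (f (L *v P))) P" if P: "L *v P \<in> V" for P
  proof -
    obtain k where "k \<noteq> 0" "g (f (L *v P)) = k *s (L *v P)"
      using g(2) [OF P] unfolding proj_eq_def by blast
    then show ?thesis
      unfolding proj_eq_def by (auto simp: matrix_vector_mult_scale LL)
  qed
  ultimately show ?thesis
    unfolding proj_isomorphism_def using proj_morphism_precompose [OF mf] g(3)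
    by (intro conjI exI [of _ "\<lambda>Q. L' *v g Q"]) (simp_all add: LL)
qed

definition ac_matrix :: "'k::field^'n^'m \<Rightarrow> 'k alg_closure^'n^'m" where
  "ac_matrix A = (\<chi> i j. to_ac (A $ i $ j))"

lemma ac_matrix_mult: "ac_matrix (A ** B) = ac_matrix A ** ac_matrix (B :: 'k::field^'n::finite^'m::finite)"
  by (simp add: ac_matrix_def matrix_matrix_mult_def vec_eq_iff to_ac_sum)

lemma ac_matrix_one: "ac_matrix (mat 1) = mat 1"
  by (auto simp: ac_matrix_def mat_def vec_eq_iff)

text \<open>\<open>A\<close> replaces the Pfaffians by an invertible constant combination, with the
  same zeros; \<open>B\<close> is a substitution, which turns evaluation at P into evaluation at B^T
  P.\<close>

lemma geometric_points_act:
  fixes M :: "'k::field model"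
  assumes M: "alternating M" and A: "invertible A" and B: "B ** B' = mat 1"
  shows "geometric_points (pf (act A B M)) =
    {P. ac_matrix (transpose B) *v P \<in> geometric_points (pf M)}"
proof -
  let ?L = "ac_matrix (transpose B)"
  have eval: "meval to_ac (($) P) (linear_form (B *v c)) = meval to_ac (($) (?L *v P)) (linear_form c)" for P c
  proof -
    have "meval to_ac (($) P) (linear_form (B *v c)) =
        (\<Sum>k\<in>UNIV. \<Sum>l\<in>UNIV. to_ac (B $ k $ l) * to_ac (c $ l) * P $ k)"
      by (simp add: ac_hom.meval_linear_form matrix_vector_mult_def to_ac_sum sum_distrib_right)
    also have "\<dots> = (\<Sum>l\<in>UNIV. \<Sum>k\<in>UNIV. to_ac (B $ k $ l) * to_ac (c $ l) * P $ k)"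
      by (rule sum.swap)
    also have "\<dots> = meval to_ac (($) (?L *v P)) (linear_form c)"
      by (simp add: ac_hom.meval_linear_form matrix_vector_mult_def ac_matrix_def transpose_def
          sum_distrib_left ac_simps)
    finally show ?thesis .
  qed
  have "act A B M $ i $ j = B *v act A (mat 1) M $ i $ j" for i j
    by (simp add: act_nth)
  then have pfB: "meval to_ac (($) P) (pf (act A B M) i) = meval to_ac (($) (?L *v P)) (pf (act A (mat 1) M) i)" for P i
    by (simp only: ac_hom.meval_pf eval)
  have pfA: "(\<forall>i. meval to_ac x (pf (act A (mat 1) M) i) = 0) \<longleftrightarrow> (\<forall>i. meval to_ac x (pf M i) = 0)" for x
  proof -
    have *: "(\<Sum>i\<in>UNIV. to_ac (A $ i $ j) * meval to_ac x (pf (act A (mat 1) M) i)) =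
        to_ac (det A) * meval to_ac x (pf M j)" for j
      using arg_cong [OF pf_act [OF A M, of j], of "meval to_ac x"]
      by (simp only: ac_hom.meval_sum ac_hom.meval_mult ac_hom.meval_mconst)
    have det: "to_ac (det A) \<noteq> 0"
      using A by (simp add: invertible_iff_det)
    obtain A' where A': "A ** A' = mat 1"
      using A unfolding invertible_def by blast
    show ?thesis
    proof
      assume "\<forall>i. meval to_ac x (pf (act A (mat 1) M) i) = 0"
      then show "\<forall>i. meval to_ac x (pf M i) = 0"
        using * det by simp
    next
      assume 0: "\<forall>i. meval to_ac x (pf M i) = 0"
      define y where "y = (\<chi> i. meval to_ac x (pf (act A (mat 1) M) i))"
      have "ac_matrix (transpose A) *v y = 0"
        using * 0 by (simp add: y_def vec_eq_iff matrix_vector_mult_def ac_matrix_def transpose_def)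
      then have "ac_matrix (transpose A' ** transpose A) *v y = 0"
        by (simp add: ac_matrix_mult matrix_vector_mul_assoc [symmetric])
      then have "y = 0"
        by (simp add: matrix_transpose_mul [symmetric] A' transpose_mat ac_matrix_one)
      then show "\<forall>i. meval to_ac x (pf (act A (mat 1) M) i) = 0"
        by (simp add: y_def vec_eq_iff)
    qed
  qed
  have inj: "?L *v P = 0 \<longleftrightarrow> P = 0" for P
  proof
    assume "?L *v P = 0"
    then have "ac_matrix (transpose B' ** transpose B) *v P = 0"
      by (simp add: ac_matrix_mult matrix_vector_mul_assoc [symmetric])
    then show "P = 0"
      by (simp add: matrix_transpose_mul [symmetric] B transpose_mat ac_matrix_one)
  qed simp
  show ?thesis
    unfolding geometric_points_def using pfB pfA inj by auto
qed

lemma vec_map_ac_matrix: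
  assumes "\<sigma> \<in> closure_auts"
  shows "vec_map \<sigma> (ac_matrix L *v P) = ac_matrix L *v vec_map \<sigma> (P :: 'k::field alg_closure^'n::finite)"
proof -
  have s: "\<sigma> (x + y) = \<sigma> x + \<sigma> y" "\<sigma> (x * y) = \<sigma> x * \<sigma> y" "\<sigma> (to_ac c) = to_ac c" for x y c
    using assms unfolding closure_auts_def by blast+
  have s0: "\<sigma> 0 = 0"
    using s(1) [of 0 0] by (metis add.right_neutral add_left_cancel)
  have "\<sigma> (\<Sum>i\<in>S. f i) = (\<Sum>i\<in>S. \<sigma> (f i))" for S :: "'n set" and f
    by (induction S rule: infinite_finite_induct) (simp_all add: s s0)
  then show ?thesis
    by (simp add: vec_map_def ac_matrix_def matrix_vector_mult_def vec_eq_iff s)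
qed

text \<open>The isomorphism \<psi> is composed with a linear map over the base field. Such a map
  commutes with every \<sigma>, so the same translations occur.\<close>

lemma jacobian_equation_act_imp:
  fixes M :: "'k::field model"
  assumes M: "alternating M" and AB: "invertible A" "invertible B"
    and J: "jacobian_equation (pf M) W"
  shows "jacobian_equation (pf (act A B M)) W"
proof -
  obtain B' where B: "B ** B' = mat 1" "B' ** B = mat 1"
    using AB(2) unfolding invertible_def by blast
  let ?L = "ac_matrix (transpose B)" and ?L' = "ac_matrix (transpose B')"
  have L: "?L ** ?L' = mat 1" "?L' ** ?L = mat 1"
    by (simp_all add: ac_matrix_mult [symmetric] matrix_transpose_mul [symmetric] B transpose_mat ac_matrix_one)
  let ?C = "geometric_points (pf M)" and ?W' = "map_weierstrass to_ac W"
  obtain \<psi> where disc: "wdisc W \<noteq> 0" and iso: "proj_isomorphism ?C (wcurve ?W') \<psi>"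
    and gal: "\<And>\<sigma>. \<sigma> \<in> closure_auts \<Longrightarrow> \<exists>T\<in>wcurve ?W'. \<forall>P\<in>?C.
      waffine (vec_map \<sigma> (\<psi> P)) = wadd ?W' (waffine (\<psi> (vec_map \<sigma> P))) (waffine T)"
    using J unfolding jacobian_equation_def Let_def by blast
  have C: "geometric_points (pf (act A B M)) = {P. ?L *v P \<in> ?C}"
    by (rule geometric_points_act [OF M AB(1) B(1)])
  have "proj_isomorphism {P. ?L *v P \<in> ?C} (wcurve ?W') (\<lambda>P. \<psi> (?L *v P))"
    using iso L by (rule proj_isomorphism_precompose)
  moreover have "\<exists>T\<in>wcurve ?W'. \<forall>P\<in>{P. ?L *v P \<in> ?C}.
      waffine (vec_map \<sigma> (\<psi> (?L *v P))) = wadd ?W' (waffine (\<psi> (?L *v vec_map \<sigma> P))) (waffine T)"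
    if "\<sigma> \<in> closure_auts" for \<sigma>
    using gal [OF that] by (auto simp: vec_map_ac_matrix [OF that, symmetric])
  ultimately show ?thesis
    unfolding jacobian_equation_def Let_def C using disc by blast
qed

lemma jacobian_equation_act:
  fixes M :: "'k::field model"
  assumes M: "alternating M" and AB: "invertible A" "invertible B"
  shows "jacobian_equation (pf (act A B M)) W \<longleftrightarrow> jacobian_equation (pf M) W"
proof
  obtain A' B' where A': "A' ** A = mat 1" "A ** A' = mat 1" and B': "B' ** B = mat 1" "B ** B' = mat 1"
    using AB unfolding invertible_def by blast
  then have inv: "invertible A'" "invertible B'"
    unfolding invertible_def by blast+
  assume "jacobian_equation (pf (act A B M)) W"
  then have "jacobian_equation (pf (act A' B' (act A B M))) W"
    by (rule jacobian_equation_act_imp [OF alternating_act [OF M] inv])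
  then show "jacobian_equation (pf M) W"
    by (simp add: act_act A' B')
qed (rule jacobian_equation_act_imp [OF assms])

lemma min_disc_valuation_act:
  assumes "alternating M" "invertible A" "invertible B"
  shows "min_disc_valuation v (act A B M) = min_disc_valuation v M"
  unfolding min_disc_valuation_def jacobian_equation_act [OF assms] ..

section \<open>Minimisation\<close>

context dvr
begin

text \<open>The weight 12 cancels the denominator of the level, and the minimal discriminant is
  unchanged because equivalent models have the same Jacobian equations.\<close>

lemma level_act:
  fixes K :: "'k model"
  assumes "relative_invariant D" "eval_model D K \<noteq> 0" "alternating K" "invertible A" "invertible B"
  shows "level v D (act A B K) = level v D K + of_int (2 * v (det A) + v (det B))"
  unfolding level_def v_eval_act(2) [OF assms] min_disc_valuation_act [OF assms(3-5)]
  by (simp add: field_simps)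

lemma level_act_mat:
  fixes K :: "'k model"
  assumes "relative_invariant D" "eval_model D K \<noteq> 0" "alternating K" "invertible A" "\<mu> \<noteq> 0"
  shows "level v D (act A (mat \<mu>) K) = level v D K + of_int (2 * v (det A) + 5 * v \<mu>)"
  using level_act [OF assms(1-4), of "mat \<mu>"] assms(5) by (simp add: invertible_iff_det det_mat v_power)

lemma integral_orbitI:
  assumes "int_model (act A (mat \<mu>) K)" "invertible A" "\<mu> \<noteq> 0"
  shows "act A (mat \<mu>) K \<in> integral_orbit v K"
  using assms unfolding integral_orbit_def integral_model_iff by blast

text \<open>All levels are compared with that of \<open>M\<close>: Step 2 changes it by - 2 v(c),
  the least change possible within the orbit. Dividing two rows and columns changes it by - 4 e +
  v(det B), which is at most - 3 e and so smaller when e = v(c) > 0.\<close>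

lemma step1_step2:
  fixes K :: "'k model"
  assumes D: "relative_invariant D" and K: "int_model K" and nz: "eval_model D K \<noteq> 0"
    and st: "step1 v K M"
  shows "\<exists>A e. step2_choice v \<pi> M A e"
    and "step2_choice v \<pi> M A e \<Longrightarrow>
      divide_rows_cols {1} (\<pi> ^ e) (act A (mat 1) M) \<in> integral_orbit v K"
    and "step2_choice v \<pi> M A e \<Longrightarrow> L \<in> integral_orbit v K \<Longrightarrow>
      level v D (divide_rows_cols {1} (\<pi> ^ e) (act A (mat 1) M)) \<le> level v D L"
    and "step2_choice v \<pi> M A e \<Longrightarrow> \<not> saturated v M \<Longrightarrow>
      \<exists>B. invertible B \<and> int_model (act (mat 1) B (divide_rows_cols {1, 2} (\<pi> ^ e) (act A (mat 1) M))) \<and>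
        level v D (act (mat 1) B (divide_rows_cols {1, 2} (\<pi> ^ e) (act A (mat 1) M))) <
        level v D (divide_rows_cols {1} (\<pi> ^ e) (act A (mat 1) M))"
proof -
  obtain A0 \<mu>0 q c where A0: "invertible A0" and mu0: "\<mu>0 \<noteq> 0" and M_eq: "M = act A0 (mat \<mu>0) K"
    and sm: "scaled_model v \<pi> M q c"
    using K st by (rule step1_scaled_model)
  interpret S: scaled_model v \<pi> M q c
    by (rule sm)
  have one: "invertible (mat 1 :: 'k^5^5)"
    by (simp add: invertible_iff_det)
  have altM: "alternating M"
    by (rule int_model_alternating [OF S.M])
  have nzM: "eval_model D M \<noteq> 0"
    unfolding M_eq using mu0
    by (intro v_eval_act(1) [OF D nz int_model_alternating [OF K] A0]) (simp add: invertible_iff_det det_mat)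
  note level_M = level_act [OF D nzM altM]
  show "\<exists>A e. step2_choice v \<pi> M A e"
    by (rule S.exists_step2_choice)
  {
    assume choice: "step2_choice v \<pi> M A e"
    note e = S.step2_choice_exponent [OF choice]
    have intA: "int_model (act A (mat 1) M)"
      by (intro int_model_act S.M GL_entry e(2))
    let ?d = "\<lambda>S. dg (\<lambda>i. if i \<in> S then inverse (\<pi> ^ e) else 1) :: 'k^5^5"
    have eq: "divide_rows_cols S (\<pi> ^ e) (act A (mat 1) M) = act (?d S ** A) (mat 1) M" for S
      unfolding divide_rows_cols_eq act_act by simp
    have det: "det (?d S ** A) \<noteq> 0" "v (det (?d S ** A)) = - int (card S) * int e" for S
      unfolding det_mul det_divide using v_det_GL [OF e(2)] v_inverse_pi_power [of e]
      by (simp_all add: v_mult v_power)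
    have int1: "int_model (act (?d {1} ** A) (mat 1) M)"
      using divide_first_integral [OF intA e(3)] unfolding eq .
    have level1: "level v D (divide_rows_cols {1} (\<pi> ^ e) (act A (mat 1) M)) =
        level v D M + of_int (- 2 * v c)"
      unfolding eq using level_M [of "?d {1} ** A" "mat 1"] det [of "{1}"] e(1)
      by (simp add: invertible_iff_det v_one)
    have "act (?d {1} ** A) (mat 1) M = act (?d {1} ** A ** A0) (mat \<mu>0) K"
      by (simp add: M_eq act_act)
    moreover have "invertible (?d {1} ** A ** A0)"
      using A0 det(1) [of "{1}"] by (simp add: invertible_iff_det det_mul)
    ultimately show "divide_rows_cols {1} (\<pi> ^ e) (act A (mat 1) M) \<in> integral_orbit v K"
      using int1 mu0 unfolding eq by (simp add: integral_orbitI)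
    {
      assume "L \<in> integral_orbit v K"
      then obtain B \<mu> where L: "int_model L" "invertible B" "\<mu> \<noteq> 0" "L = act B (mat \<mu>) K"
        unfolding integral_orbit_def integral_model_iff by blast
      \<comment> \<open>\<open>L\<close> is given as an equivalent of \<open>K\<close>; undoing Step
        1 presents it as an equivalent of \<open>M\<close>, to which the bound applies.\<close>
      obtain A0' where A0': "A0 ** A0' = mat 1" "A0' ** A0 = mat 1"
        using A0 unfolding invertible_def by blast
      have "act (B ** A0') (mat (\<mu> * inverse \<mu>0)) M = act (B ** (A0' ** A0)) (mat (\<mu> * inverse \<mu>0 * \<mu>0)) K"
        by (simp add: M_eq act_act matrix_mul_assoc mat_mult_mat)
      moreover have "\<mu> * inverse \<mu>0 * \<mu>0 = \<mu>"
        using mu0 by simp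
      ultimately have L_eq: "L = act (B ** A0') (mat (\<mu> * inverse \<mu>0)) M"
        by (simp only: A0' L(4) matrix_mul_rid)
      have "invertible A0'"
        using A0' unfolding invertible_def by blast
      then have inv: "invertible (B ** A0')" "\<mu> * inverse \<mu>0 \<noteq> 0"
        using L(2,3) mu0 by (simp_all add: invertible_iff_det det_mul)
      have "- 2 * v c \<le> 2 * v (det (B ** A0')) + 5 * v (\<mu> * inverse \<mu>0)"
        using S.level_change_bound [OF inv] L(1) unfolding L_eq by blast
      then have "of_int (- 2 * v c) \<le> (of_int (2 * v (det (B ** A0')) + 5 * v (\<mu> * inverse \<mu>0)) :: rat)"
        by (simp only: of_int_le_iff)
      then show "level v D (divide_rows_cols {1} (\<pi> ^ e) (act A (mat 1) M)) \<le> level v D L"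
        unfolding level1 unfolding L_eq level_act_mat [OF D nzM altM inv] by simp
    }
    assume "\<not> saturated v M"
    then have "v c \<noteq> 0"
      using S.saturated_if_unit by blast
    then have pos: "0 < v c"
      using S.c_integral by simp
    obtain B where B: "invertible B" "v (det B) \<le> int e"
      "int_model (act (mat 1) B (divide_rows_cols {1, 2} (\<pi> ^ e) (act A (mat 1) M)))"
      using intA e(3) by (rule divide_both_integral) (rule that)
    have "act (mat 1) B (divide_rows_cols {1, 2} (\<pi> ^ e) (act A (mat 1) M)) = act (?d {1, 2} ** A) B M"
      unfolding eq act_act by simp
    moreover have "level v D (act (?d {1, 2} ** A) B M) =
        level v D M + of_int (2 * v (det (?d {1, 2} ** A)) + v (det B))"
      using det(1) [of "{1, 2}"] B(1) by (intro level_M) (simp_all add: invertible_iff_det)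
    moreover have "2 * v (det (?d {1, 2} ** A)) + v (det B) < - 2 * v c"
      using det(2) [of "{1, 2}"] B(2) e(1) pos by simp
    then have "of_int (2 * v (det (?d {1, 2} ** A)) + v (det B)) < (of_int (- 2 * v c) :: rat)"
      by (simp only: of_int_less_iff)
    ultimately have "level v D (act (mat 1) B (divide_rows_cols {1, 2} (\<pi> ^ e) (act A (mat 1) M))) <
        level v D (divide_rows_cols {1} (\<pi> ^ e) (act A (mat 1) M))"
      unfolding level1 by simp
    with B show "\<exists>B. invertible B \<and> int_model (act (mat 1) B (divide_rows_cols {1, 2} (\<pi> ^ e) (act A (mat 1) M))) \<and>
        level v D (act (mat 1) B (divide_rows_cols {1, 2} (\<pi> ^ e) (act A (mat 1) M))) <
        level v D (divide_rows_cols {1} (\<pi> ^ e) (act A (mat 1) M))"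
      by blast
  }
qed

end

theorem theorem3p2:
  fixes v :: "'k::field \<Rightarrow> int" and \<pi> :: 'k and D :: model_poly and \<Phi> :: "'k model"
  assumes "discrete_valuation v"
    and "perfect_residue_field v"
    and "uniformiser v \<pi>"
    and "discriminant_polynomial TYPE('k) D"
    and "integral_model v \<Phi>"
    and "nonsingular_model \<Phi>"
  shows "\<exists>l0.
    (l0 \<in> level v D ` integral_orbit v \<Phi> \<and> (\<forall>\<Psi>\<in>integral_orbit v \<Phi>. l0 \<le> level v D \<Psi>)) \<and>
    (\<exists>\<Phi>1. step1 v \<Phi> \<Phi>1) \<and>
    (\<forall>\<Phi>1. step1 v \<Phi> \<Phi>1 \<longrightarrow>
      (\<exists>A e. step2_choice v \<pi> \<Phi>1 A e) \<and>
      (\<forall>A e. step2_choice v \<pi> \<Phi>1 A e \<longrightarrow>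
        (let \<Phi>2 = divide_rows_cols {1} (\<pi> ^ e) (act A (mat 1) \<Phi>1)
         in \<Phi>2 \<in> integral_orbit v \<Phi> \<and> level v D \<Phi>2 = l0) \<and>
        (\<not> saturated v \<Phi>1 \<longrightarrow>
          (\<exists>B. invertible B \<and>
            (let \<Phi>3 = act (mat 1) B (divide_rows_cols {1, 2} (\<pi> ^ e) (act A (mat 1) \<Phi>1))
             in integral_model v \<Phi>3 \<and> level v D \<Phi>3 < l0)))))"
proof -
  interpret dvr v \<pi>
    using assms(1,3) by unfold_locales
  have K: "int_model \<Phi>"
    using assms(5) by (simp add: integral_model_iff)
  have D: "relative_invariant D"
    using assms(4) unfolding discriminant_polynomial_def relative_invariant_def by blast
  \<comment> \<open>The value is the discriminant of an equation of the Jacobian, which is nonzero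
    by the definition of such an equation.\<close>
  have nz: "eval_model D \<Phi> \<noteq> 0"
    using assms(4,6) int_model_alternating [OF K]
    unfolding discriminant_polynomial_def jacobian_equation_def by metis
  let ?two = "\<lambda>M A e. divide_rows_cols {1} (\<pi> ^ e) (act A (mat 1) M)"
  obtain M0 where M0: "step1 v \<Phi> M0"
    using exists_step1 [OF K pfaffians_independent [OF D int_model_alternating [OF K] nz]] by blast
  note step = step1_step2 [OF D K nz]
  obtain A0 e0 where choice0: "step2_choice v \<pi> M0 A0 e0"
    using step(1) [OF M0] by blast
  \<comment> \<open>The minimum is taken from one run of the algorithm; any other run has a level
    that is minimal in the same orbit and so agrees with it.\<close>
  define l0 where "l0 = level v D (?two M0 A0 e0)"
  have min: "l0 \<in> level v D ` integral_orbit v \<Phi>" "\<And>L. L \<in> integral_orbit v \<Phi> \<Longrightarrow> l0 \<le> level v D L"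
    unfolding l0_def using step(2,3) [OF M0 choice0] by blast+
  have two: "?two M A e \<in> integral_orbit v \<Phi>" "level v D (?two M A e) = l0"
    if "step1 v \<Phi> M" "step2_choice v \<pi> M A e" for M A e
  proof -
    show orb: "?two M A e \<in> integral_orbit v \<Phi>"
      by (rule step(2) [OF that])
    have "?two M0 A0 e0 \<in> integral_orbit v \<Phi>"
      by (rule step(2) [OF M0 choice0])
    then show "level v D (?two M A e) = l0"
      using min(2) [OF orb] step(3) [OF that] unfolding l0_def by (intro antisym)
  qed
  show ?thesis
    unfolding Let_def
  proof (intro exI [of _ l0] conjI allI impI ballI)
    show "l0 \<in> level v D ` integral_orbit v \<Phi>" "\<And>L. L \<in> integral_orbit v \<Phi> \<Longrightarrow> l0 \<le> level v D L"
      by (rule min)+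
    show "\<exists>M. step1 v \<Phi> M"
      using M0 by blast
    fix M assume M: "step1 v \<Phi> M"
    show "\<exists>A e. step2_choice v \<pi> M A e"
      by (rule step(1) [OF M])
    fix A e assume choice: "step2_choice v \<pi> M A e"
    show "?two M A e \<in> integral_orbit v \<Phi>" "level v D (?two M A e) = l0"
      by (rule two [OF M choice])+
    assume "\<not> saturated v M"
    then show "\<exists>B. invertible B \<and>
        integral_model v (act (mat 1) B (divide_rows_cols {1, 2} (\<pi> ^ e) (act A (mat 1) M))) \<and>
        level v D (act (mat 1) B (divide_rows_cols {1, 2} (\<pi> ^ e) (act A (mat 1) M))) < l0"
      using step(4) [OF M choice] two(2) [OF M choice] unfolding integral_model_iff by simp
  qed
qed

end
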